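(* Let $R=\bigoplus_{\alpha\in\Gamma}R_\alpha$ be a graded integral domain, $H$ the set of nonzero homogeneous elements of $R$, and $N(H)=\{f\in R\mid C(f)_v=R\}$. The following statements are equivalent. (1) $R$ is a P$v$MD. (2) $R_Q$ is a valuation domain for all homogeneous maximal $t$-ideals $Q$ of $R$. (3) $R$ is integrally closed and $I_t=I_w$ for all nonzero homogeneous ideals $I$ of $R$. (4) Every homogeneous $t$-linked overring of $R$ is integrally closed. (5) $R_{H\setminus Q}$ is a graded-valuation domain for all homogeneous maximal $t$-ideals $Q$ of $R$. (6) $R_{N(H)}$ is a P$v$MD. (7) Every nonzero finitely generated homogeneous ideal of $R$ is $t$-invertible.
   Context: $\Gamma$ is a nonzero torsionless (i.e. $n\alpha=n\beta$ with $n\ge1$ implies $\alpha=\beta$) commutative cancellative monoid, written additively, with quotient group $\langle\Gamma\rangle$. $R=\bigoplus_{\alpha\in\Gamma}R_\alpha$ is an integral domain graded by $\Gamma$, with $R_\alpha\neq\{0\}$ for all $\alpha$. $R_H$ is $\langle\Gamma\rangle$-graded. For $f\in R_H$, $C(f)$ is the fractional ideal of $R$ generated by the homogeneous components of $f$. An ideal of $R$ is homogeneous if it is generated by homogeneous elements. A homogeneous maximal $t$-ideal is an ideal maximal among proper homogeneous $t$-ideals; equivalently, a maximal $t$-ideal $Q$ of $R$ with $Q\cap H\ne\emptyset$. A homogeneous overring of $R$ is a ring $T$ with $R\subseteq T\subseteq R_H$ and $T=\bigoplus_{\alpha\in\langle\Gamma\rangle}(T\cap(R_H)_\alpha)$.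 A graded integral domain is a graded-valuation domain if for all nonzero homogeneous elements $a,b$, either $\frac ab$ or $\frac ba$ belongs to it. For an integral domain $D$ with quotient field $K$ and a nonzero fractional ideal $A$ of $D$: $A^{-1}=\{x\in K\mid xA\subseteq D\}$, $A_v=(A^{-1})^{-1}$, $A_t=\bigcup\{I_v\mid I\subseteq A$ a nonzero finitely generated ideal$\}$, and $A_w=\{x\in K\mid xJ\subseteq A$ for some nonzero finitely generated ideal $J$ of $D$ with $J_v=D\}$. A (nonzero) ideal $A$ is a $t$-ideal if $A_t=A$; a maximal $t$-ideal is one maximal among proper integral $t$-ideals. $A$ is $t$-invertible if $(AA^{-1})_t=D$. $D$ is a P$v$MD (Prüfer $v$-multiplication domain) if each nonzero finitely generated ideal is $t$-invertible. An overring $T$ of $D$ (ring between $D$ and $K$) is $t$-linked over $D$ if $(IT)_v=T$ (the $v$-operation of $T$) for each nonzero finitely generated ideal $I$ of $D$ with $I_v=D$. Fields count as valuation domains. *)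

theory Defs
  imports Main "HOL.Hull" "HOL-Computational_Algebra.Polynomial"
begin

(* An integral domain D is a subset of a field type 'k all of whose elements are
   fractions of elements of D, so the quotient field is UNIV.  All overrings and
   localizations of D are then subsets of the same type with the same quotient field. *)

section \<open>Domains inside their quotient field\<close>

definition is_subring :: "'k::field set \<Rightarrow> bool" where
  "is_subring D \<longleftrightarrow> 1 \<in> D \<and> (\<forall>x\<in>D. \<forall>y\<in>D. x - y \<in> D \<and> x * y \<in> D)"

definition domain_in_qf :: "'k::field set \<Rightarrow> bool" where
  "domain_in_qf D \<longleftrightarrow> is_subring D \<and> (\<forall>x. \<exists>a\<in>D. \<exists>b\<in>D. b \<noteq> 0 \<and> x = a / b)"

definition localization :: "'k::field set \<Rightarrow> 'k set \<Rightarrow> 'k set" where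
  "localization D S = {a / s | a s. a \<in> D \<and> s \<in> S}"

definition valuation_domain :: "'k::field set \<Rightarrow> bool" where
  "valuation_domain D \<longleftrightarrow> domain_in_qf D \<and>
     (\<forall>a\<in>D. \<forall>b\<in>D. a \<noteq> 0 \<longrightarrow> b \<noteq> 0 \<longrightarrow> a / b \<in> D \<or> b / a \<in> D)"

definition integral_over :: "'k::field set \<Rightarrow> 'k \<Rightarrow> bool" where
  "integral_over D x \<longleftrightarrow>
     (\<exists>p. lead_coeff p = 1 \<and> (\<forall>i. coeff p i \<in> D) \<and> poly p x = 0)"

definition integrally_closed :: "'k::field set \<Rightarrow> bool" where
  "integrally_closed D \<longleftrightarrow> (\<forall>x. integral_over D x \<longrightarrow> x \<in> D)"

section \<open>Ideals and the v-, t- and w-operations\<close>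

definition submod :: "'k::field set \<Rightarrow> 'k set \<Rightarrow> bool" where
  "submod D A \<longleftrightarrow>
     0 \<in> A \<and> (\<forall>x\<in>A. \<forall>y\<in>A. x + y \<in> A) \<and> (\<forall>r\<in>D. \<forall>x\<in>A. r * x \<in> A)"

definition is_ideal :: "'k::field set \<Rightarrow> 'k set \<Rightarrow> bool" where
  "is_ideal D A \<longleftrightarrow> submod D A \<and> A \<subseteq> D"

definition fin_gen :: "'k::field set \<Rightarrow> 'k set \<Rightarrow> bool" where
  "fin_gen D A \<longleftrightarrow> (\<exists>S. finite S \<and> A = submod D hull S)"

definition nonzero_fg_ideal :: "'k::field set \<Rightarrow> 'k set \<Rightarrow> bool" where
  "nonzero_fg_ideal D A \<longleftrightarrow> is_ideal D A \<and> fin_gen D A \<and> A \<noteq> {0}"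

definition ideal_mult :: "'k::field set \<Rightarrow> 'k set \<Rightarrow> 'k set \<Rightarrow> 'k set" where
  "ideal_mult D A B = submod D hull {a * b | a b. a \<in> A \<and> b \<in> B}"

(* The following operations carry their usual meaning only for nonzero fractional ideals. *)

definition frac_inv :: "'k::field set \<Rightarrow> 'k set \<Rightarrow> 'k set" where
  "frac_inv D A = {x. \<forall>a\<in>A. x * a \<in> D}"

definition v_op :: "'k::field set \<Rightarrow> 'k set \<Rightarrow> 'k set" where
  "v_op D A = frac_inv D (frac_inv D A)"

(* A finitely generated D-submodule I of 'k is always a fractional ideal, and it is an
   ideal as soon as A is contained in D. *)
definition t_op :: "'k::field set \<Rightarrow> 'k set \<Rightarrow> 'k set" where
  "t_op D A = \<Union>{v_op D I | I. fin_gen D I \<and> I \<noteq> {0} \<and> I \<subseteq> A}"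

definition w_op :: "'k::field set \<Rightarrow> 'k set \<Rightarrow> 'k set" where
  "w_op D A = {x. \<exists>J. nonzero_fg_ideal D J \<and> v_op D J = D \<and> (\<forall>j\<in>J. x * j \<in> A)}"

definition t_ideal :: "'k::field set \<Rightarrow> 'k set \<Rightarrow> bool" where
  "t_ideal D A \<longleftrightarrow> is_ideal D A \<and> A \<noteq> {0} \<and> t_op D A = A"

definition t_invertible :: "'k::field set \<Rightarrow> 'k set \<Rightarrow> bool" where
  "t_invertible D A \<longleftrightarrow> t_op D (ideal_mult D A (frac_inv D A)) = D"

definition PvMD :: "'k::field set \<Rightarrow> bool" where
  "PvMD D \<longleftrightarrow> domain_in_qf D \<and> (\<forall>A. nonzero_fg_ideal D A \<longrightarrow> t_invertible D A)"

definition t_linked :: "'k::field set \<Rightarrow> 'k set \<Rightarrow> bool" where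
  "t_linked D T \<longleftrightarrow> is_subring T \<and> D \<subseteq> T \<and>
     (\<forall>I. nonzero_fg_ideal D I \<and> v_op D I = D \<longrightarrow> v_op T (submod T hull I) = T)"

section \<open>Graded domains\<close>

(* The grading monoid is a submonoid of an abelian group type 'g that it generates, so
   its quotient group is UNIV and cancellativity is automatic. *)
definition grading_monoid :: "'g::ab_group_add set \<Rightarrow> bool" where
  "grading_monoid \<Gamma> \<longleftrightarrow>
     0 \<in> \<Gamma> \<and> (\<forall>\<alpha>\<in>\<Gamma>. \<forall>\<beta>\<in>\<Gamma>. \<alpha> + \<beta> \<in> \<Gamma>) \<and> \<Gamma> \<noteq> {0} \<and>
     (\<forall>\<gamma>. \<exists>\<alpha>\<in>\<Gamma>. \<exists>\<beta>\<in>\<Gamma>. \<gamma> = \<alpha> - \<beta>) \<and>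
     (\<forall>n\<ge>1::nat. \<forall>\<alpha>\<in>\<Gamma>. \<forall>\<beta>\<in>\<Gamma>. (\<Sum>i<n. \<alpha>) = (\<Sum>i<n. \<beta>) \<longrightarrow> \<alpha> = \<beta>)"

definition decomposition :: "'g set \<Rightarrow> ('g \<Rightarrow> 'k::field set) \<Rightarrow> 'k \<Rightarrow> ('g \<Rightarrow> 'k) \<Rightarrow> bool" where
  "decomposition I G x c \<longleftrightarrow>
     finite {\<alpha>. c \<alpha> \<noteq> 0} \<and> {\<alpha>. c \<alpha> \<noteq> 0} \<subseteq> I \<and> (\<forall>\<alpha>\<in>I. c \<alpha> \<in> G \<alpha>) \<and>
     x = (\<Sum>\<alpha> | c \<alpha> \<noteq> 0. c \<alpha>)"

definition internal_direct_sum :: "'g set \<Rightarrow> ('g \<Rightarrow> 'k::field set) \<Rightarrow> 'k set \<Rightarrow> bool" where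
  "internal_direct_sum I G D \<longleftrightarrow>
     (\<forall>\<alpha>\<in>I. 0 \<in> G \<alpha> \<and> (\<forall>x\<in>G \<alpha>. \<forall>y\<in>G \<alpha>. x - y \<in> G \<alpha>)) \<and>
     D = {x. \<exists>c. decomposition I G x c} \<and>
     (\<forall>x\<in>D. \<exists>!c. decomposition I G x c)"

definition graded_ring :: "'g::ab_group_add set \<Rightarrow> ('g \<Rightarrow> 'k::field set) \<Rightarrow> 'k set \<Rightarrow> bool" where
  "graded_ring I G D \<longleftrightarrow> is_subring D \<and> internal_direct_sum I G D \<and>
     (\<forall>\<alpha>\<in>I. \<forall>\<beta>\<in>I. \<forall>x\<in>G \<alpha>. \<forall>y\<in>G \<beta>. x * y \<in> G (\<alpha> + \<beta>))"

definition graded_domain :: "'g::ab_group_add set \<Rightarrow> ('g \<Rightarrow> 'k::field set) \<Rightarrow> 'k set \<Rightarrow> bool" where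
  "graded_domain \<Gamma> G R \<longleftrightarrow> grading_monoid \<Gamma> \<and> domain_in_qf R \<and> graded_ring \<Gamma> G R \<and>
     (\<forall>\<alpha>\<in>\<Gamma>. G \<alpha> \<noteq> {0})"

definition homs :: "'g set \<Rightarrow> ('g \<Rightarrow> 'k::field set) \<Rightarrow> 'k set" where
  "homs I G = (\<Union>\<alpha>\<in>I. G \<alpha>) - {0}"

definition quot_grading ::
    "'g::ab_group_add set \<Rightarrow> ('g \<Rightarrow> 'k::field set) \<Rightarrow> 'g \<Rightarrow> 'k set" where
  "quot_grading \<Gamma> G \<alpha> =
     {a / b | a b \<beta> \<gamma>. \<beta> \<in> \<Gamma> \<and> \<gamma> \<in> \<Gamma> \<and> \<alpha> = \<beta> - \<gamma> \<and> a \<in> G \<beta> \<and> b \<in> G \<gamma> \<and> b \<noteq> 0}"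

definition hom_component ::
    "'g::ab_group_add set \<Rightarrow> ('g \<Rightarrow> 'k::field set) \<Rightarrow> 'k \<Rightarrow> 'g \<Rightarrow> 'k" where
  "hom_component \<Gamma> G f = (THE c. decomposition UNIV (quot_grading \<Gamma> G) f c)"

definition content ::
    "'g::ab_group_add set \<Rightarrow> ('g \<Rightarrow> 'k::field set) \<Rightarrow> 'k set \<Rightarrow> 'k \<Rightarrow> 'k set" where
  "content \<Gamma> G R f = submod R hull (range (hom_component \<Gamma> G f))"

(* f = 0 is excluded explicitly since content 0 = {0} has no v-closure in the usual sense. *)
definition N_set ::
    "'g::ab_group_add set \<Rightarrow> ('g \<Rightarrow> 'k::field set) \<Rightarrow> 'k set \<Rightarrow> 'k set" where
  "N_set \<Gamma> G R = {f \<in> R. f \<noteq> 0 \<and> v_op R (content \<Gamma> G R f) = R}"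

definition homogeneous_ideal ::
    "'g set \<Rightarrow> ('g \<Rightarrow> 'k::field set) \<Rightarrow> 'k set \<Rightarrow> 'k set \<Rightarrow> bool" where
  "homogeneous_ideal \<Gamma> G R A \<longleftrightarrow>
     is_ideal R A \<and> (\<exists>S \<subseteq> homs \<Gamma> G. A = submod R hull S)"

definition homogeneous_max_t_ideal ::
    "'g set \<Rightarrow> ('g \<Rightarrow> 'k::field set) \<Rightarrow> 'k set \<Rightarrow> 'k set \<Rightarrow> bool" where
  "homogeneous_max_t_ideal \<Gamma> G R Q \<longleftrightarrow>
     homogeneous_ideal \<Gamma> G R Q \<and> t_ideal R Q \<and> Q \<noteq> R \<and>
     (\<forall>P. homogeneous_ideal \<Gamma> G R P \<and> t_ideal R P \<and> P \<noteq> R \<and> Q \<subseteq> P \<longrightarrow> P = Q)"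

definition homogeneous_overring ::
    "'g::ab_group_add set \<Rightarrow> ('g \<Rightarrow> 'k::field set) \<Rightarrow> 'k set \<Rightarrow> 'k set \<Rightarrow> bool" where
  "homogeneous_overring \<Gamma> G R T \<longleftrightarrow>
     R \<subseteq> T \<and> T \<subseteq> localization R (homs \<Gamma> G) \<and>
     graded_ring UNIV (\<lambda>\<alpha>. T \<inter> quot_grading \<Gamma> G \<alpha>) T"

definition graded_valuation_domain ::
    "('g::ab_group_add \<Rightarrow> 'k::field set) \<Rightarrow> 'k set \<Rightarrow> bool" where
  "graded_valuation_domain G D \<longleftrightarrow> graded_ring UNIV G D \<and>
     (\<forall>a \<in> homs UNIV G. \<forall>b \<in> homs UNIV G. a / b \<in> D \<or> b / a \<in> D)"

end

theory Submission
  imports Defs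
begin

text \<open>
  A finite set \<open>A\<close> generates a t-invertible ideal iff some finite \<open>B \<subseteq> A\<^sup>-\<^sup>1\<close> satisfies
  \<open>(A B)\<^sup>-\<^sup>1 = R\<close>, so the whole statement can be phrased with finite sets and inverses.

  The substantial implication is (7) \<open>\<Longrightarrow>\<close> (1). The ring \<open>R\<^sub>H\<close> is a graded field, and it is a
  PvMD: over a finitely generated, hence free, group of degrees it arises from the field \<open>(R\<^sub>H)\<^sub>0\<close> by
  adjoining one homogeneous unit \<open>u\<close> at a time. The ring \<open>D[u, u\<^sup>-\<^sup>1]\<close> is graded by the integers, its
  homogeneous ideals come from \<open>D\<close>, and the localization at homogeneous elements is the principal ideal
  domain \<open>F[u, u\<^sup>-\<^sup>1]\<close>, so (7) \<open>\<Longrightarrow>\<close> (1) for that grading gives the induction step. Given this, a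
  finite set \<open>A\<close> is first multiplied by a set that makes its inverse over \<open>R\<^sub>H\<close> trivial, after which
  its inverse over \<open>R\<close> is that of its set of homogeneous components, because \<open>x f \<in> R\<close> implies
  \<open>x f\<^sub>\<gamma> \<in> R\<close> for all components of \<open>f\<close>.

  That last fact, the primality of homogeneous maximal t-ideals, the t-linkedness of overrings of
  \<open>R\<^bsub>H \<setminus> Q\<^esub>\<close>, and the equality \<open>R\<^bsub>N(H)\<^esub> \<inter> R\<^sub>H = R\<close> behind (6) all rest on one weak form of
  the Dedekind--Mertens lemma: if \<open>z j\<close> lies in a graded set \<open>M\<close> that is closed under subtraction and
  under multiplication by the components of \<open>j\<close>, then a power of each component of \<open>j\<close> multiplies
  \<open>z\<close> into \<open>M\<close>.
\<close>

section \<open>Subrings, submodules and inverses\<close>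

text \<open>The obstacle is that an element of the quotient field outside R_H has no homogeneous
  components. The inverse of A lies in R_H as soon as A contains a nonzero homogeneous element, but
  for an arbitrary finite A it need not. This is why R_H itself must be treated before the passage
  from homogeneous sets to all finite sets. A Dedekind--Mertens lemma without control over the
  exponents suffices, because a finite set with trivial inverse still has trivial inverse after its
  elements are replaced by powers. Conditions (2), (3) and (4) each lead to (5). From (5) the
  homogeneous form of (7) follows by contradiction: if A A^-1 had proper t-closure, it would lie in
  a homogeneous maximal t-ideal Q, yet divisibility in the localization at Q produces an element of
  A A^-1 outside Q. The existence of Q rests on describing ideals with proper t-closure as those
  containing no finite nonzero set whose inverse lies in R, a condition that passes to unions of
  chains.\<close>

lemma subring_1: "is_subring D \<Longrightarrow> 1 \<in> D"
  and subring_diff: "is_subring D \<Longrightarrow> x \<in> D \<Longrightarrow> y \<in> D \<Longrightarrow> x - y \<in> D"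
  and subring_mult: "is_subring D \<Longrightarrow> x \<in> D \<Longrightarrow> y \<in> D \<Longrightarrow> x * y \<in> D"
  by (auto simp: is_subring_def)

lemma subring_0: "is_subring D \<Longrightarrow> 0 \<in> D"
  using subring_diff[of D 1 1] subring_1[of D] by simp

lemma subring_uminus: "is_subring D \<Longrightarrow> x \<in> D \<Longrightarrow> - x \<in> D"
  using subring_diff[of D 0 x] subring_0[of D] by simp

lemma subring_add: "is_subring D \<Longrightarrow> x \<in> D \<Longrightarrow> y \<in> D \<Longrightarrow> x + y \<in> D"
  using subring_diff[of D x "- y"] subring_uminus[of D y] by simp

lemma subring_sum: "is_subring D \<Longrightarrow> (\<And>i. i \<in> I \<Longrightarrow> f i \<in> D) \<Longrightarrow> sum f I \<in> D"
  by (induction I rule: infinite_finite_induct) (auto simp: subring_0 subring_add)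

lemma subring_power: "is_subring D \<Longrightarrow> x \<in> D \<Longrightarrow> x ^ n \<in> D"
  by (induction n) (auto simp: subring_1 subring_mult)

lemmas subring_closed = subring_0 subring_1 subring_add subring_diff subring_mult
  subring_uminus subring_sum subring_power

lemma submod_hull: "submod D (submod D hull X)"
  by (rule hull_in) (simp add: submod_def)

lemma submod_0: "submod D A \<Longrightarrow> 0 \<in> A"
  and submod_add: "submod D A \<Longrightarrow> x \<in> A \<Longrightarrow> y \<in> A \<Longrightarrow> x + y \<in> A"
  and submod_mult: "submod D A \<Longrightarrow> r \<in> D \<Longrightarrow> x \<in> A \<Longrightarrow> r * x \<in> A"
  by (auto simp: submod_def)

lemma submod_sum: "submod D A \<Longrightarrow> (\<And>i. i \<in> I \<Longrightarrow> f i \<in> A) \<Longrightarrow> sum f I \<in> A"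
  by (induction I rule: infinite_finite_induct) (auto simp: submod_0 submod_add)

lemma submod_subring: "is_subring D \<Longrightarrow> is_subring T \<Longrightarrow> D \<subseteq> T \<Longrightarrow> submod D T"
  by (auto simp: submod_def subring_closed)

lemma submod_frac_inv: "is_subring D \<Longrightarrow> submod D (frac_inv D A)"
  by (auto simp: submod_def frac_inv_def subring_closed distrib_right mult.assoc)

lemma frac_inv_antimono: "A \<subseteq> B \<Longrightarrow> frac_inv D B \<subseteq> frac_inv D A"
  by (auto simp: frac_inv_def)

lemma frac_inv_hull:
  assumes "is_subring D"
  shows "frac_inv D (submod D hull X) = frac_inv D X"
proof
  show "frac_inv D (submod D hull X) \<subseteq> frac_inv D X"
    by (intro frac_inv_antimono hull_subset)
  show "frac_inv D X \<subseteq> frac_inv D (submod D hull X)"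
  proof
    fix z assume z: "z \<in> frac_inv D X"
    have "submod D hull X \<subseteq> {x. z * x \<in> D}"
    proof (rule hull_minimal)
      show "X \<subseteq> {x. z * x \<in> D}" using z by (auto simp: frac_inv_def)
      show "submod D {x. z * x \<in> D}"
        using assms by (auto simp: submod_def subring_closed distrib_left mult.left_commute)
    qed
    then show "z \<in> frac_inv D (submod D hull X)" by (auto simp: frac_inv_def)
  qed
qed

text \<open>The \<open>D\<close>-hull lies between \<open>X\<close> and the \<open>T\<close>-hull,
  and these two have the same inverse over \<open>T\<close>. Thus the extension of an ideal from
  \<open>D\<close> to \<open>T\<close> can be tested on generators.\<close>

lemma frac_inv_hull_over:
  assumes "is_subring T" "is_subring D" "D \<subseteq> T"
  shows "frac_inv T (submod D hull X) = frac_inv T X"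
proof
  show "frac_inv T (submod D hull X) \<subseteq> frac_inv T X"
    by (intro frac_inv_antimono hull_subset)
  have "submod D hull X \<subseteq> submod T hull X"
    using assms submod_hull[of T X]
    by (intro hull_minimal hull_subset) (auto simp: submod_def)
  then show "frac_inv T X \<subseteq> frac_inv T (submod D hull X)"
    using frac_inv_antimono frac_inv_hull[OF assms(1)] by metis
qed

lemma v_op_hull: "is_subring D \<Longrightarrow> v_op D (submod D hull X) = v_op D X"
  by (simp add: v_op_def frac_inv_hull)

lemma v_op_mono: "A \<subseteq> B \<Longrightarrow> v_op D A \<subseteq> v_op D B"
  by (simp add: v_op_def frac_inv_antimono)

lemma v_op_subset: "A \<subseteq> v_op D A"
  by (auto simp: v_op_def frac_inv_def mult.commute)

lemma frac_inv_v_op: "frac_inv D (v_op D A) = frac_inv D A"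
proof
  show "frac_inv D (v_op D A) \<subseteq> frac_inv D A"
    by (intro frac_inv_antimono v_op_subset)
  show "frac_inv D A \<subseteq> frac_inv D (v_op D A)"
    by (auto simp: v_op_def frac_inv_def mult.commute)
qed

lemma submod_v_op: "is_subring D \<Longrightarrow> submod D (v_op D A)"
  by (simp add: v_op_def submod_frac_inv)

lemma frac_inv_self: "is_subring D \<Longrightarrow> frac_inv D D = D"
  by (auto simp: frac_inv_def subring_closed dest: bspec[of _ _ 1])

lemma frac_inv_superset: "is_subring D \<Longrightarrow> A \<subseteq> D \<Longrightarrow> D \<subseteq> frac_inv D A"
  by (auto simp: frac_inv_def subring_closed)

lemma v_op_subset_ring: "is_subring D \<Longrightarrow> A \<subseteq> D \<Longrightarrow> v_op D A \<subseteq> D"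
  using v_op_mono[of A D D] by (simp add: v_op_def frac_inv_self)

lemma v_op_iff: "x \<in> v_op D A \<longleftrightarrow> (\<forall>z\<in>frac_inv D A. x * z \<in> D)"
  by (simp add: v_op_def frac_inv_def[of D "frac_inv D A"])

lemma one_in_v_op_iff: "1 \<in> v_op D A \<longleftrightarrow> frac_inv D A \<subseteq> D"
  by (auto simp: v_op_def frac_inv_def)

lemma v_op_eq_ring_iff:
  assumes "is_subring D" "A \<subseteq> D"
  shows "v_op D A = D \<longleftrightarrow> frac_inv D A \<subseteq> D"
proof
  assume "v_op D A = D"
  then show "frac_inv D A \<subseteq> D" using one_in_v_op_iff subring_1[OF assms(1)] by metis
next
  assume "frac_inv D A \<subseteq> D"
  then have "frac_inv D A = D" using frac_inv_superset[OF assms] by blast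
  then show "v_op D A = D" by (simp add: v_op_def frac_inv_self assms(1))
qed

lemma hull_subset_ring: "is_subring D \<Longrightarrow> X \<subseteq> D \<Longrightarrow> submod D hull X \<subseteq> D"
  by (rule hull_minimal) (auto intro: submod_subring)

lemma hull_eq_zero_iff: "submod D hull X = {0} \<longleftrightarrow> X \<subseteq> {0}"
proof
  show "submod D hull X = {0} \<Longrightarrow> X \<subseteq> {0}" using hull_subset by metis
  show "X \<subseteq> {0} \<Longrightarrow> submod D hull X = {0}"
    using hull_minimal[of X "{0}" "submod D"] submod_0[OF submod_hull[of D X]]
    by (auto simp: submod_def)
qed

lemma nonzero_fg_ideal_iff:
  assumes "is_subring D"
  shows "nonzero_fg_ideal D I \<longleftrightarrow>
    (\<exists>A. finite A \<and> A \<subseteq> D \<and> \<not> A \<subseteq> {0} \<and> I = submod D hull A)"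
proof
  assume "nonzero_fg_ideal D I"
  then obtain A where "finite A" "I = submod D hull A" "is_ideal D I" "I \<noteq> {0}"
    by (auto simp: nonzero_fg_ideal_def fin_gen_def)
  moreover have "A \<subseteq> D"
    using calculation hull_subset[of A "submod D"] by (auto simp: is_ideal_def)
  ultimately show "\<exists>A. finite A \<and> A \<subseteq> D \<and> \<not> A \<subseteq> {0} \<and> I = submod D hull A"
    by (auto simp: hull_eq_zero_iff)
next
  assume "\<exists>A. finite A \<and> A \<subseteq> D \<and> \<not> A \<subseteq> {0} \<and> I = submod D hull A"
  then obtain A where "finite A" "A \<subseteq> D" "\<not> A \<subseteq> {0}" "I = submod D hull A" by blast
  then show "nonzero_fg_ideal D I"
    using hull_subset_ring[OF assms, of A] unfolding nonzero_fg_ideal_def fin_gen_def is_ideal_def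
    by (metis hull_eq_zero_iff submod_hull)
qed

text \<open>Inverses do not see the passage from a finite set to the module it generates, so finite
  sets can stand for finitely generated modules. The clause \<open>\<not> X \<subseteq> {0}\<close>
  mirrors the exclusion of the zero module in \<open>t_op\<close>.\<close>

lemma t_op_iff:
  assumes "is_subring D" "submod D A"
  shows "x \<in> t_op D A \<longleftrightarrow> (\<exists>X. finite X \<and> X \<subseteq> A \<and> \<not> X \<subseteq> {0} \<and> x \<in> v_op D X)"
proof
  assume "x \<in> t_op D A"
  then obtain X where "finite X" "submod D hull X \<noteq> {0}" "submod D hull X \<subseteq> A"
    "x \<in> v_op D (submod D hull X)"
    by (auto simp: t_op_def fin_gen_def)
  moreover have "X \<subseteq> submod D hull X" by (rule hull_subset)
  ultimately show "\<exists>X. finite X \<and> X \<subseteq> A \<and> \<not> X \<subseteq> {0} \<and> x \<in> v_op D X"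
    using assms(1) by (metis hull_eq_zero_iff order_trans v_op_hull)
next
  assume "\<exists>X. finite X \<and> X \<subseteq> A \<and> \<not> X \<subseteq> {0} \<and> x \<in> v_op D X"
  then obtain X where X: "finite X" "X \<subseteq> A" "\<not> X \<subseteq> {0}" "x \<in> v_op D X" by blast
  have "submod D hull X \<subseteq> A" by (rule hull_minimal) (use X assms in auto)
  then show "x \<in> t_op D A"
    unfolding t_op_def fin_gen_def using X v_op_hull[OF assms(1), of X] hull_eq_zero_iff[of D X]
    by blast
qed

lemma subset_t_op:
  assumes "is_subring D" "submod D A" "A \<noteq> {0}"
  shows "A \<subseteq> t_op D A"
proof
  fix x assume "x \<in> A"
  obtain a where "a \<in> A" "a \<noteq> 0" using assms(3) submod_0[OF assms(2)] by blast
  \<comment> \<open>The nonzero \<open>a\<close> joins \<open>x\<close> because \<open>x\<close> may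
    be 0, and \<open>{0}\<close> is not an admissible finite set.\<close>
  then have "finite {x, a} \<and> {x, a} \<subseteq> A \<and> \<not> {x, a} \<subseteq> {0} \<and> x \<in> v_op D {x, a}"
    using v_op_subset[of "{x, a}" D] \<open>x \<in> A\<close> by auto
  then show "x \<in> t_op D A" unfolding t_op_iff[OF assms(1,2)] by blast
qed

text \<open>Everything turns on 1: the t-closure of an ideal lies in \<open>D\<close>, and a
  v-closure containing 1 contains all of \<open>D\<close>, being a submodule.\<close>

lemma t_op_eq_ring_iff:
  assumes "is_subring D" "is_ideal D J"
  shows "t_op D J = D \<longleftrightarrow> (\<exists>X. finite X \<and> X \<subseteq> J \<and> \<not> X \<subseteq> {0} \<and> frac_inv D X \<subseteq> D)"
proof -
  have sub: "submod D J" and JD: "J \<subseteq> D" using assms by (auto simp: is_ideal_def)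
  have "t_op D J \<subseteq> D"
  proof
    fix x assume "x \<in> t_op D J"
    then obtain X where "X \<subseteq> J" "x \<in> v_op D X" using t_op_iff[OF assms(1) sub] by blast
    then show "x \<in> D" using v_op_subset_ring[OF assms(1), of X] JD by blast
  qed
  moreover have "D \<subseteq> t_op D J" if "1 \<in> t_op D J"
  proof
    fix r assume r: "r \<in> D"
    obtain X where X: "finite X" "X \<subseteq> J" "\<not> X \<subseteq> {0}" "1 \<in> v_op D X"
      using \<open>1 \<in> t_op D J\<close> unfolding t_op_iff[OF assms(1) sub] by blast
    have "r * 1 \<in> v_op D X" using submod_mult[OF submod_v_op[OF assms(1)] r X(4)] .
    then show "r \<in> t_op D J" unfolding t_op_iff[OF assms(1) sub] using X by auto
  qed
  ultimately have "t_op D J = D \<longleftrightarrow> 1 \<in> t_op D J" using subring_1[OF assms(1)] by blast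
  then show ?thesis by (simp add: t_op_iff[OF assms(1) sub] one_in_v_op_iff)
qed

section \<open>Invertibility in terms of finite sets of generators\<close>

text \<open>Products without sums suffice: they generate the product ideal and so have the same
  inverse.\<close>

definition products :: "'k::field set \<Rightarrow> 'k set \<Rightarrow> 'k set" where
  "products A B = {a * b | a b. a \<in> A \<and> b \<in> B}"

lemma products_memI: "a \<in> A \<Longrightarrow> b \<in> B \<Longrightarrow> a * b \<in> products A B"
  by (auto simp: products_def)

lemma finite_products: "finite A \<Longrightarrow> finite B \<Longrightarrow> finite (products A B)"
  using finite_image_set2[of "\<lambda>a. a \<in> A" "\<lambda>b. b \<in> B" "(*)"] by (simp add: products_def)

lemma products_mono: "B \<subseteq> C \<Longrightarrow> products A B \<subseteq> products A C"
  by (auto simp: products_def)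

lemma frac_inv_products_iff:
  "z \<in> frac_inv D (products A B) \<longleftrightarrow> (\<forall>a\<in>A. \<forall>b\<in>B. z * a * b \<in> D)"
  by (force simp: frac_inv_def products_def mult.assoc)

lemma products_subset_iff: "products A B \<subseteq> D \<longleftrightarrow> B \<subseteq> frac_inv D A"
  by (force simp: frac_inv_def products_def mult.commute)

text \<open>For a subring \<open>D\<close> the last inclusion is an equality: the products lie in
  \<open>D\<close>, so \<open>D\<close> lies in their inverse.\<close>

definition tinv :: "'k::field set \<Rightarrow> 'k set \<Rightarrow> bool" where
  "tinv D A \<longleftrightarrow> (\<exists>B. finite B \<and> B \<subseteq> frac_inv D A \<and> frac_inv D (products A B) \<subseteq> D)"

text \<open>The scalar moves from \<open>A\<close> to the witness: the products of
  \<open>c A\<close> with \<open>B\<close> are those of \<open>A\<close> with \<open>c B\<close>.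
  This reduces fractional sets to sets inside the ring.\<close>

lemma tinv_scale:
  assumes "c \<noteq> 0" "tinv D ((*) c ` A)"
  shows "tinv D A"
proof -
  obtain B where B: "finite B" "B \<subseteq> frac_inv D ((*) c ` A)" "frac_inv D (products ((*) c ` A) B) \<subseteq> D"
    using assms(2) by (auto simp: tinv_def)
  have "products A ((*) c ` B) = products ((*) c ` A) B"
  proof (rule set_eqI)
    fix x
    have "x \<in> products A ((*) c ` B) \<longleftrightarrow> (\<exists>a\<in>A. \<exists>b\<in>B. x = a * (c * b))"
      by (auto simp: products_def)
    moreover have "x \<in> products ((*) c ` A) B \<longleftrightarrow> (\<exists>a\<in>A. \<exists>b\<in>B. x = c * a * b)"
      by (auto simp: products_def)
    ultimately show "x \<in> products A ((*) c ` B) \<longleftrightarrow> x \<in> products ((*) c ` A) B"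
      by (simp add: mult_ac)
  qed
  moreover have "(*) c ` B \<subseteq> frac_inv D A" using B(2) by (force simp: frac_inv_def mult_ac)
  ultimately show ?thesis using B unfolding tinv_def by (metis finite_imageI)
qed

lemma ideal_mult_hull:
  assumes D: "is_subring D"
  shows "ideal_mult D (submod D hull A) (frac_inv D (submod D hull A)) =
    submod D hull (products A (frac_inv D A))"
proof -
  define P where "P = products A (frac_inv D A)"
  define J where "J = submod D hull P"
  have J: "submod D J" "P \<subseteq> J" by (simp_all add: J_def submod_hull hull_subset)
  have "{a * b | a b. a \<in> submod D hull A \<and> b \<in> frac_inv D A} \<subseteq> J"
  proof (safe)
    fix a b assume ab: "a \<in> submod D hull A" "b \<in> frac_inv D A"
    have "submod D hull A \<subseteq> {a. a * b \<in> J}"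
    proof (rule hull_minimal)
      show "A \<subseteq> {a. a * b \<in> J}" using ab J(2) by (auto simp: P_def products_def)
      show "submod D {a. a * b \<in> J}"
        using J(1) by (auto simp: submod_def distrib_right mult.assoc)
    qed
    then show "a * b \<in> J" using ab by blast
  qed
  then have "ideal_mult D (submod D hull A) (frac_inv D (submod D hull A)) = J"
    unfolding ideal_mult_def frac_inv_hull[OF D]
  proof (intro antisym hull_minimal)
    have "P \<subseteq> {a * b | a b. a \<in> submod D hull A \<and> b \<in> frac_inv D A}"
      using hull_subset[of A "submod D"] by (auto simp: P_def products_def)
    then show "J \<subseteq> submod D hull {a * b | a b. a \<in> submod D hull A \<and> b \<in> frac_inv D A}"
      unfolding J_def by (rule hull_mono)
  qed (use J in auto)
  then show ?thesis by (simp add: J_def P_def)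
qed

text \<open>Each element of the ideal generated by A A^-1 involves only finitely many factors from
  A^-1, so a finite subset with trivial inverse already comes from a finite
  \<open>B\<close>.\<close>

lemma t_invertible_iff:
  assumes D: "is_subring D" and A: "finite A" "\<not> A \<subseteq> {0}"
  shows "t_invertible D (submod D hull A) \<longleftrightarrow> tinv D A"
proof -
  define P where "P = products A (frac_inv D A)"
  define J where "J = submod D hull P"
  have J: "submod D J" "P \<subseteq> J" by (simp_all add: J_def submod_hull hull_subset)
  have eq: "ideal_mult D (submod D hull A) (frac_inv D (submod D hull A)) = J"
    unfolding J_def P_def by (rule ideal_mult_hull[OF D])
  have "P \<subseteq> D" by (auto simp: P_def products_subset_iff)
  then have "is_ideal D J" using D J by (simp add: is_ideal_def J_def hull_subset_ring)
  note t_op_J = t_op_eq_ring_iff[OF D this]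
  have "(\<exists>X. finite X \<and> X \<subseteq> J \<and> \<not> X \<subseteq> {0} \<and> frac_inv D X \<subseteq> D) \<longleftrightarrow> tinv D A"
  proof
    assume "\<exists>X. finite X \<and> X \<subseteq> J \<and> \<not> X \<subseteq> {0} \<and> frac_inv D X \<subseteq> D"
    then obtain X where X: "finite X" "X \<subseteq> J" "frac_inv D X \<subseteq> D" by blast
    define U where "U = {x. \<exists>B. finite B \<and> B \<subseteq> frac_inv D A \<and> x \<in> submod D hull (products A B)}"
    have "J \<subseteq> U" unfolding J_def
    proof (rule hull_minimal)
      show "P \<subseteq> U"
      proof
        fix x assume "x \<in> P"
        then obtain a b where "a \<in> A" "b \<in> frac_inv D A" "x = a * b"
          by (auto simp: P_def products_def)
        then show "x \<in> U" unfolding U_def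
          by (auto intro!: exI[of _ "{b}"] hull_inc products_memI)
      qed
      show "submod D U" unfolding submod_def
      proof (intro conjI ballI)
        show "0 \<in> U" by (auto simp: U_def submod_0[OF submod_hull] intro!: exI[of _ "{}"])
        fix x assume "x \<in> U"
        then obtain B where B: "finite B" "B \<subseteq> frac_inv D A" "x \<in> submod D hull (products A B)"
          by (auto simp: U_def)
        then show "r * x \<in> U" if "r \<in> D" for r
          using submod_mult[OF submod_hull that] by (auto simp: U_def)
        fix y assume "y \<in> U"
        then obtain C where C: "finite C" "C \<subseteq> frac_inv D A" "y \<in> submod D hull (products A C)"
          by (auto simp: U_def)
        have "x \<in> submod D hull (products A (B \<union> C))" "y \<in> submod D hull (products A (B \<union> C))"
          using B(3) C(3) hull_mono[OF products_mono, of B "B \<union> C" "submod D" A]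
            hull_mono[OF products_mono, of C "B \<union> C" "submod D" A] by auto
        then show "x + y \<in> U" unfolding U_def
          using B C submod_add[OF submod_hull] by (auto intro!: exI[of _ "B \<union> C"])
      qed
    qed
    then have "\<forall>x\<in>X. \<exists>B. finite B \<and> B \<subseteq> frac_inv D A \<and> x \<in> submod D hull (products A B)"
      using X by (auto simp: U_def)
    then obtain B where B: "\<And>x. x \<in> X \<Longrightarrow>
        finite (B x) \<and> B x \<subseteq> frac_inv D A \<and> x \<in> submod D hull (products A (B x))"
      by metis
    let ?B = "\<Union>x\<in>X. B x"
    have "X \<subseteq> submod D hull (products A ?B)"
    proof
      fix x assume x: "x \<in> X"
      then have "submod D hull (products A (B x)) \<subseteq> submod D hull (products A ?B)"
        by (intro hull_mono products_mono) auto
      then show "x \<in> submod D hull (products A ?B)" using B[OF x] by blast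
    qed
    then have "frac_inv D (products A ?B) \<subseteq> D"
      using X(3) frac_inv_antimono frac_inv_hull[OF D] by (metis order_trans)
    then show "tinv D A" unfolding tinv_def using X(1) B by (intro exI[of _ ?B]) auto
  next
    assume "tinv D A"
    then obtain B where B: "finite B" "B \<subseteq> frac_inv D A" "frac_inv D (products A B) \<subseteq> D"
      by (auto simp: tinv_def)
    have PJ: "products A B \<subseteq> J"
      using products_mono[OF B(2), of A] J(2) unfolding P_def by (rule order_trans)
    show "\<exists>X. finite X \<and> X \<subseteq> J \<and> \<not> X \<subseteq> {0} \<and> frac_inv D X \<subseteq> D"
    proof (cases "products A B \<subseteq> {0}")
      case False
      then show ?thesis using B(3) PJ finite_products[OF A(1) B(1)]
        by (intro exI[of _ "products A B"]) simp
    next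
      \<comment> \<open>If all products vanish, their inverse is \<open>UNIV\<close>, so
        \<open>D\<close> is the whole field and \<open>{1}\<close> can replace them.\<close>
      case True
      then have "frac_inv D (products A B) = UNIV" using subring_0[OF D] by (auto simp: frac_inv_def)
      then have U: "D = UNIV" using B by auto
      obtain a where a: "a \<in> A" "a \<noteq> 0" using A by auto
      then have "1 \<in> J" using J(2) U products_memI[of a A "1/a" "frac_inv D A"]
        by (auto simp: P_def frac_inv_def)
      then show ?thesis by (intro exI[of _ "{1}"]) (auto simp: U)
    qed
  qed
  then show ?thesis by (simp add: t_invertible_def eq t_op_J)
qed

text \<open>If the given \<open>B\<close> has only zero products, their inverse is everything, so
  \<open>D\<close> is the whole field and \<open>B\<close> can be replaced by the inverse of one
  nonzero element of \<open>A\<close>.\<close>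

lemma tinvE:
  assumes "is_subring D" "tinv D A" "\<not> A \<subseteq> {0}"
  obtains B where "finite B" "B \<subseteq> frac_inv D A" "frac_inv D (products A B) \<subseteq> D"
    "\<not> products A B \<subseteq> {0}"
proof -
  obtain B where B: "finite B" "B \<subseteq> frac_inv D A" "frac_inv D (products A B) \<subseteq> D"
    using assms(2) unfolding tinv_def by blast
  show ?thesis
  proof (cases "products A B \<subseteq> {0}")
    case True
    then have "frac_inv D (products A B) = UNIV" using subring_0[OF assms(1)] by (auto simp: frac_inv_def)
    then have "D = UNIV" using B by auto
    moreover obtain a where a: "a \<in> A" "a \<noteq> 0" using assms(3) by auto
    moreover have "a * inverse a \<in> products A {inverse a}" using a by (intro products_memI) auto
    moreover have "\<not> products A {inverse a} \<subseteq> {0}" using calculation(4) a by fastforce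
    ultimately show ?thesis using that[of "{inverse a}"] by (simp add: frac_inv_def)
  qed (use B that in blast)
qed

definition all_tinv :: "'k::field set \<Rightarrow> bool" where
  "all_tinv D \<longleftrightarrow> (\<forall>A. finite A \<and> A \<subseteq> D \<and> \<not> A \<subseteq> {0} \<longrightarrow> tinv D A)"

lemma PvMD_iff: "PvMD D \<longleftrightarrow> domain_in_qf D \<and> all_tinv D"
proof (cases "is_subring D")
  case True
  then have "(\<forall>A. nonzero_fg_ideal D A \<longrightarrow> t_invertible D A) \<longleftrightarrow>
      (\<forall>A. finite A \<and> A \<subseteq> D \<and> \<not> A \<subseteq> {0} \<longrightarrow> t_invertible D (submod D hull A))"
    unfolding nonzero_fg_ideal_iff[OF True] by blast
  also have "\<dots> \<longleftrightarrow> all_tinv D"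
    unfolding all_tinv_def using t_invertible_iff[OF True] by simp
  finally show ?thesis unfolding PvMD_def by simp
qed (simp add: PvMD_def domain_in_qf_def)

lemma common_denominator:
  assumes "\<And>a b. a \<in> S \<Longrightarrow> b \<in> S \<Longrightarrow> a * b \<in> S" "1 \<in> S" "is_subring D" "S \<subseteq> D"
    and "finite X" "\<forall>x\<in>X. \<exists>s\<in>S. s * x \<in> D"
  shows "\<exists>s\<in>S. \<forall>x\<in>X. s * x \<in> D"
  using assms(5,6)
proof (induction X)
  case empty
  then show ?case using assms by auto
next
  case (insert x X)
  then obtain s t where "s \<in> S" "\<forall>x\<in>X. s * x \<in> D" "t \<in> S" "t * x \<in> D" by auto
  then show ?case
    using assms(1)[of s t] assms(3,4) subring_mult[OF assms(3), of s "t * x"]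
      subring_mult[OF assms(3), of t "s * y" for y]
    by (auto intro!: bexI[of _ "s * t"] simp: mult_ac)
qed

lemma tinv_fractional:
  assumes "PvMD D" "finite A" "\<not> A \<subseteq> {0}"
  shows "tinv D A"
proof -
  have D: "is_subring D" and q: "\<And>x. \<exists>a\<in>D. \<exists>b\<in>D. b \<noteq> 0 \<and> x = a / b"
    using assms(1) by (auto simp: PvMD_def domain_in_qf_def)
  have "\<forall>x\<in>A. \<exists>s\<in>D - {0}. s * x \<in> D"
  proof
    fix x
    obtain a b where "a \<in> D" "b \<in> D" "b \<noteq> 0" "x = a / b" using q by blast
    then show "\<exists>s\<in>D - {0}. s * x \<in> D" by (intro bexI[of _ b]) auto
  qed
  then obtain c where c: "c \<in> D - {0}" "\<forall>x\<in>A. c * x \<in> D"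
    using common_denominator[of "D - {0}" D A] D assms(2) by (auto simp: subring_closed)
  then have "finite ((*) c ` A)" "(*) c ` A \<subseteq> D" "\<not> (*) c ` A \<subseteq> {0}" using assms by auto
  then have "tinv D ((*) c ` A)" using assms(1) by (auto simp: PvMD_iff all_tinv_def)
  then show ?thesis using c tinv_scale by blast
qed

text \<open>The set \<open>Y\<close> holds the elements for which only some power is known to work.
  To remove \<open>y\<close> from it, the exponent is lowered by passing from \<open>z\<close> to
  \<open>y * z\<close>, until \<open>y\<close> itself multiplies \<open>z\<close> into
  \<open>D\<close>; once \<open>Y\<close> is empty, \<open>z\<close> lies in the inverse of
  \<open>X\<close>.\<close>

lemma frac_inv_powers:
  assumes D: "is_subring D" and X: "finite X" "X \<subseteq> D" "frac_inv D X \<subseteq> D"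
    and z: "\<forall>x\<in>X. \<exists>n. x ^ n * z \<in> D"
  shows "z \<in> D"
proof -
  have "z \<in> D" if "finite Y" "Y \<subseteq> X" "\<forall>x\<in>Y. \<exists>n. x ^ n * z \<in> D" "\<forall>x\<in>X - Y. x * z \<in> D" for Y
    using that
  proof (induction Y arbitrary: z)
    case empty
    then have "z \<in> frac_inv D X" by (auto simp: frac_inv_def mult.commute)
    then show ?case using X by blast
  next
    case (insert y Y)
    then have y: "y \<in> D" using X by blast
    obtain n where "y ^ n * z \<in> D" using insert.prems by blast
    then show ?case using insert.prems(2-3)
    proof (induction n arbitrary: z)
      case (Suc n)
      have "y * z \<in> D"
      proof (rule Suc.IH)
        show "y ^ n * (y * z) \<in> D" using Suc.prems(1) by (simp add: mult_ac)
        show "\<forall>x\<in>insert y Y. \<exists>n. x ^ n * (y * z) \<in> D"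
          using Suc.prems(2) y subring_mult[OF D] by (metis mult.left_commute)
        show "\<forall>x\<in>X - insert y Y. x * (y * z) \<in> D"
          using Suc.prems(3) y subring_mult[OF D] by (metis mult.left_commute)
      qed
      then show ?case using insert.IH[of z] insert.prems Suc.prems by blast
    qed simp
  qed
  from this[of X] show ?thesis using X z by auto
qed

section \<open>Linked overrings and localizations\<close>

lemma t_linked_iff:
  assumes D: "is_subring D"
  shows "t_linked D T \<longleftrightarrow> is_subring T \<and> D \<subseteq> T \<and>
    (\<forall>J. finite J \<and> J \<subseteq> D \<and> frac_inv D J \<subseteq> D \<longrightarrow> frac_inv T J \<subseteq> T)"
proof -
  have *: "(\<forall>I. nonzero_fg_ideal D I \<and> v_op D I = D \<longrightarrow> v_op T (submod T hull I) = T) \<longleftrightarrow>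
    (\<forall>J. finite J \<and> J \<subseteq> D \<and> frac_inv D J \<subseteq> D \<longrightarrow> frac_inv T J \<subseteq> T)"
    if T: "is_subring T" "D \<subseteq> T"
  proof -
    have 1: "v_op T (submod T hull (submod D hull J)) = T \<longleftrightarrow> frac_inv T J \<subseteq> T" if "J \<subseteq> D" for J
    proof -
      have "submod D hull J \<subseteq> T" using hull_subset_ring[OF D that] T by blast
      then show ?thesis
        by (simp add: v_op_hull T v_op_eq_ring_iff frac_inv_hull_over D)
    qed
    have 2: "v_op D (submod D hull J) = D \<longleftrightarrow> frac_inv D J \<subseteq> D" if "J \<subseteq> D" for J
      using that D by (simp add: v_op_hull v_op_eq_ring_iff)
    \<comment> \<open>The ideals in \<open>t_linked\<close> are nonzero, whereas the finite sets on
      the right may be zero; a zero set with inverse inside \<open>D\<close> forces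
      \<open>D = UNIV\<close>, hence \<open>T = UNIV\<close>.\<close>
    have 3: "frac_inv T J \<subseteq> T" if "J \<subseteq> {0}" "frac_inv D J \<subseteq> D" for J
    proof -
      have "frac_inv D J = UNIV" using that(1) subring_0[OF D] by (auto simp: frac_inv_def)
      then show ?thesis using that(2) T by auto
    qed
    have "(\<forall>I. nonzero_fg_ideal D I \<and> v_op D I = D \<longrightarrow> v_op T (submod T hull I) = T) \<longleftrightarrow>
      (\<forall>J. finite J \<and> J \<subseteq> D \<and> \<not> J \<subseteq> {0} \<longrightarrow> v_op D (submod D hull J) = D
        \<longrightarrow> v_op T (submod T hull (submod D hull J)) = T)"
      unfolding nonzero_fg_ideal_iff[OF D] by blast
    also have "\<dots> \<longleftrightarrow>
      (\<forall>J. finite J \<and> J \<subseteq> D \<and> \<not> J \<subseteq> {0} \<longrightarrow> frac_inv D J \<subseteq> D \<longrightarrow> frac_inv T J \<subseteq> T)"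
      by (simp only: 1 2 cong: conj_cong imp_cong)
    finally show ?thesis by (metis (full_types) 3)
  qed
  show ?thesis
  proof (cases "is_subring T \<and> D \<subseteq> T")
    case True
    then show ?thesis unfolding t_linked_def using * by simp
  qed (auto simp: t_linked_def)
qed

text \<open>If \<open>I\<close> is generated by the powers of \<open>x\<close> below the degree of an integral equation over \<open>T\<close>,
  then \<open>x I \<subseteq> T I\<close>, hence \<open>x\<close> multiplies \<open>I I\<^sup>-\<^sup>1\<close> into \<open>T\<close>.\<close>

lemma t_linked_integrally_closed:
  assumes D: "is_subring D" and tinv: "\<And>A. finite A \<Longrightarrow> \<not> A \<subseteq> {0} \<Longrightarrow> tinv D A"
    and T: "t_linked D T"
  shows "integrally_closed T"
  unfolding integrally_closed_def integral_over_def
proof (intro allI impI, elim exE conjE)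
  fix x p assume p: "lead_coeff p = 1" "\<forall>i. coeff p i \<in> T" "poly p x = 0"
  have subT: "is_subring T" and DT: "D \<subseteq> T" using T by (auto simp: t_linked_def)
  define n where "n = degree p"
  define A where "A = (\<lambda>i. x ^ i) ` {..<n}"
  have "n \<noteq> 0"
  proof
    assume "n = 0"
    then obtain c where "p = [:c:]" unfolding n_def by (rule degree_eq_zeroE)
    then show False using p by simp
  qed
  then have "1 \<in> A" by (force simp: A_def image_iff)
  then have "tinv D A" by (intro tinv) (auto simp: A_def)
  then obtain B where B: "finite B" "B \<subseteq> frac_inv D A" "frac_inv D (products A B) \<subseteq> D"
    by (auto simp: tinv_def)
  \<comment> \<open>The powers in \<open>A\<close> need not lie in \<open>D\<close> or
    \<open>T\<close>, but the products do lie in \<open>D\<close> and have trivial inverse there, so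
    t-linkedness applies to them.\<close>
  have fT: "frac_inv T (products A B) \<subseteq> T"
    using T B finite_products[of A B] by (auto simp: t_linked_iff[OF D] products_subset_iff A_def)
  have pow: "x ^ i * b \<in> T" if "i < n" "b \<in> B" for i b
    using that B(2) DT by (fastforce simp: frac_inv_def A_def mult.commute)
  have "x ^ n = - (\<Sum>i<n. coeff p i * x ^ i)"
    using p(1,3) by (simp add: poly_altdef n_def add_eq_0_iff flip: lessThan_Suc_atMost)
  then have "x ^ n * b = - (\<Sum>i<n. coeff p i * (x ^ i * b))" for b
    by (simp add: sum_distrib_left mult_ac)
  moreover have "- (\<Sum>i<n. coeff p i * (x ^ i * b)) \<in> T" if "b \<in> B" for b
    using subring_mult[OF subT p(2)[rule_format] pow[OF _ that]]
    by (intro subring_uminus[OF subT] subring_sum[OF subT]) simp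
  ultimately have "x ^ n * b \<in> T" if "b \<in> B" for b
    using that by simp
  then have "x * x ^ i * b \<in> T" if "i < n" "b \<in> B" for i b
    using pow[of "Suc i" b] that by (cases "Suc i = n") auto
  then have "x \<in> frac_inv T (products A B)" by (auto simp: frac_inv_products_iff A_def)
  then show "x \<in> T" using fT by blast
qed

section \<open>Rings of fractions\<close>

lemma subring_localization:
  assumes "is_subring D" "1 \<in> S" "0 \<notin> S" "S \<subseteq> D" "\<And>a b. a \<in> S \<Longrightarrow> b \<in> S \<Longrightarrow> a * b \<in> S"
  shows "is_subring (localization D S)" "D \<subseteq> localization D S"
proof -
  show sub: "D \<subseteq> localization D S"
  proof
    fix x assume "x \<in> D"
    then have "x = x / 1 \<and> x \<in> D \<and> 1 \<in> S" using assms(2) by simp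
    then show "x \<in> localization D S" unfolding localization_def by blast
  qed
  show "is_subring (localization D S)" unfolding is_subring_def
  proof (intro conjI ballI)
    show "1 \<in> localization D S" using sub subring_1[OF assms(1)] by blast
    fix x y assume "x \<in> localization D S" "y \<in> localization D S"
    then obtain a s b t where x: "x = a / s" "a \<in> D" "s \<in> S" and y: "y = b / t" "b \<in> D" "t \<in> S"
      by (auto simp: localization_def)
    have [simp]: "s \<noteq> 0" "t \<noteq> 0" using x y assms(3) by auto
    have "a * t - b * s \<in> D" "a * b \<in> D" using x y assms(1,4) by (auto intro!: subring_closed)
    moreover have "x - y = (a * t - b * s) / (s * t)" "x * y = a * b / (s * t)"
      by (simp_all add: x y field_simps)
    ultimately show "x - y \<in> localization D S" "x * y \<in> localization D S"
      using assms(5)[OF x(3) y(3)] unfolding localization_def by blast+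
  qed
qed

lemma localization_iff:
  assumes "0 \<notin> S"
  shows "x \<in> localization D S \<longleftrightarrow> (\<exists>s\<in>S. s * x \<in> D)"
proof
  assume "x \<in> localization D S"
  then obtain a s where "x = a / s" "a \<in> D" "s \<in> S" by (auto simp: localization_def)
  then show "\<exists>s\<in>S. s * x \<in> D" using assms by (intro bexI[of _ s]) auto
next
  assume "\<exists>s\<in>S. s * x \<in> D"
  then obtain s where "s \<in> S" "s * x \<in> D" by blast
  moreover have "x = s * x / s" using \<open>s \<in> S\<close> assms by auto
  ultimately show "x \<in> localization D S" unfolding localization_def by blast
qed

lemma domain_in_qf_mono:
  "domain_in_qf D \<Longrightarrow> is_subring T \<Longrightarrow> D \<subseteq> T \<Longrightarrow> domain_in_qf T"
  unfolding domain_in_qf_def by blast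

text \<open>A finite witness over \<open>D\<close> also works over the localization: if
  \<open>z\<close> multiplies the finitely many products into the localization, a common denominator
  \<open>s\<close> puts \<open>s * z\<close> into their inverse over \<open>D\<close>.\<close>

lemma PvMD_localization:
  assumes D: "PvMD D"
    and S: "1 \<in> S" "0 \<notin> S" "S \<subseteq> D" "\<And>a b. a \<in> S \<Longrightarrow> b \<in> S \<Longrightarrow> a * b \<in> S"
  shows "PvMD (localization D S)"
proof -
  let ?L = "localization D S"
  have subD: "is_subring D" using D by (auto simp: PvMD_def domain_in_qf_def)
  note L = subring_localization[OF subD S]
  have "tinv ?L A" if A: "finite A" "\<not> A \<subseteq> {0}" for A
  proof -
    obtain B where B: "finite B" "B \<subseteq> frac_inv D A" "frac_inv D (products A B) \<subseteq> D"
      using tinv_fractional[OF D A] by (auto simp: tinv_def)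
    have "frac_inv ?L (products A B) \<subseteq> ?L"
    proof
      fix z assume "z \<in> frac_inv ?L (products A B)"
      then have "\<forall>x\<in>(*) z ` products A B. \<exists>s\<in>S. s * x \<in> D"
        by (auto simp: frac_inv_def localization_iff[OF S(2)])
      then obtain s where "s \<in> S" "\<forall>x\<in>(*) z ` products A B. s * x \<in> D"
        using common_denominator[OF S(4,1) subD S(3), of "(*) z ` products A B"]
          finite_products[OF A(1) B(1)] by auto
      then have "s \<in> S" "s * z \<in> frac_inv D (products A B)" by (auto simp: frac_inv_def mult.assoc)
      then show "z \<in> ?L" using B(3) by (auto simp: localization_iff[OF S(2)])
    qed
    moreover have "B \<subseteq> frac_inv ?L A" using B(2) L(2) by (auto simp: frac_inv_def)
    ultimately show ?thesis using B(1) by (auto simp: tinv_def)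
  qed
  moreover have "domain_in_qf ?L" using D L domain_in_qf_mono by (auto simp: PvMD_def)
  ultimately show ?thesis by (auto simp: PvMD_iff all_tinv_def)
qed

section \<open>Integral elements and the w-operation\<close>

lemma integral_overI:
  assumes R: "is_subring R" and c: "\<And>k. k < m \<Longrightarrow> c k \<in> R" and eq: "x ^ m = (\<Sum>k<m. c k * x ^ k)"
  shows "integral_over R x"
proof -
  define p where "p = monom 1 m - (\<Sum>k<m. monom (c k) k)"
  have coeff: "coeff p k = (if k = m then 1 else if k < m then - c k else 0)" for k
    by (auto simp: p_def coeff_sum)
  have "degree p = m"
  proof (rule antisym)
    show "degree p \<le> m" by (rule degree_le) (simp add: coeff)
    show "m \<le> degree p" by (rule le_degree) (simp add: coeff)
  qed
  then have "lead_coeff p = 1" by (simp add: coeff)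
  moreover have "\<forall>i. coeff p i \<in> R"
    using c R by (simp add: coeff subring_0 subring_1 subring_uminus)
  moreover have "poly p x = 0" by (simp add: p_def poly_sum poly_monom eq)
  ultimately show ?thesis unfolding integral_over_def by blast
qed

text \<open>Meant for an equation in \<open>y\<close> whose even powers come from a polynomial in
  y^2.\<close>

lemma sum_even_odd:
  fixes f :: "nat \<Rightarrow> 'a::comm_monoid_add"
  shows "(\<Sum>k<2 * m. f k) = (\<Sum>i<m. f (2 * i) + f (2 * i + 1))"
  by (induction m) (simp_all add: add_ac)

text \<open>If \<open>x J\<close> lies in \<open>I\<close> and \<open>Y\<close> generates
  \<open>J\<close>, then \<open>x Y\<close> is a finite subset of \<open>I\<close> whose v-closure
  contains \<open>x\<close>: an element inverting \<open>x Y\<close> becomes, after multiplication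
  by \<open>x\<close>, an element inverting \<open>Y\<close>, hence an element of \<open>R\<close>.
  For \<open>x = 0\<close> the set \<open>x Y\<close> is inadmissible.\<close>

lemma w_op_subset_t_op:
  assumes R: "is_subring R" and I: "submod R I" "I \<noteq> {0}"
  shows "w_op R I \<subseteq> t_op R I"
proof
  fix x assume "x \<in> w_op R I"
  then obtain J where J: "nonzero_fg_ideal R J" "v_op R J = R" "\<forall>j\<in>J. x * j \<in> I"
    unfolding w_op_def by blast
  obtain Y where Y: "finite Y" "Y \<subseteq> R" "\<not> Y \<subseteq> {0}" "J = submod R hull Y"
    using J(1) unfolding nonzero_fg_ideal_iff[OF R] by blast
  have inv: "frac_inv R Y \<subseteq> R"
    using J(2) Y(2) unfolding Y(4) by (simp add: v_op_hull R v_op_eq_ring_iff)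
  obtain i where i: "i \<in> I" "i \<noteq> 0" using I submod_0[OF I(1)] by blast
  show "x \<in> t_op R I" unfolding t_op_iff[OF R I(1)]
  proof (cases "x = 0")
    case True
    then show "\<exists>X. finite X \<and> X \<subseteq> I \<and> \<not> X \<subseteq> {0} \<and> x \<in> v_op R X"
      using i submod_0[OF submod_v_op[OF R]] by (intro exI[of _ "{i}"]) simp
  next
    case False
    have "x \<in> v_op R ((*) x ` Y)" unfolding v_op_iff
    proof
      fix z assume "z \<in> frac_inv R ((*) x ` Y)"
      then have "x * z \<in> frac_inv R Y" by (simp add: frac_inv_def mult_ac)
      then show "x * z \<in> R" using inv by blast
    qed
    moreover have "(*) x ` Y \<subseteq> I" using J(3) hull_subset[of Y "submod R"] Y(4) by auto
    moreover have "\<not> (*) x ` Y \<subseteq> {0}" using False Y(3) by auto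
    ultimately show "\<exists>X. finite X \<and> X \<subseteq> I \<and> \<not> X \<subseteq> {0} \<and> x \<in> v_op R X"
      using Y(1) by (intro exI[of _ "(*) x ` Y"]) simp
  qed
qed

text \<open>The ideal witnessing the w-closure is generated by the products of \<open>X\<close> with
  \<open>B\<close>. For \<open>x\<close> in the v-closure of \<open>X\<close> each
  \<open>x * b\<close> lies in \<open>R\<close>, so \<open>x (a b) = (x b) a\<close> lies in
  \<open>I\<close>.\<close>

lemma PvMD_t_op_subset_w_op:
  assumes "PvMD R" and I: "submod R I"
  shows "t_op R I \<subseteq> w_op R I"
proof
  have R: "is_subring R" using assms(1) by (simp add: PvMD_def domain_in_qf_def)
  fix x assume "x \<in> t_op R I"
  then obtain X where X: "finite X" "X \<subseteq> I" "\<not> X \<subseteq> {0}" "x \<in> v_op R X"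
    unfolding t_op_iff[OF R I] by blast
  obtain B where B: "finite B" "B \<subseteq> frac_inv R X" "frac_inv R (products X B) \<subseteq> R"
    "\<not> products X B \<subseteq> {0}"
    using tinvE[OF R tinv_fractional[OF assms(1) X(1,3)] X(3)] by blast
  let ?J = "submod R hull (products X B)"
  have sub: "products X B \<subseteq> R" using B(2) by (simp add: products_subset_iff)
  have "?J \<subseteq> {j. x * j \<in> I}"
  proof (rule hull_minimal)
    show "products X B \<subseteq> {j. x * j \<in> I}"
    proof
      fix j assume "j \<in> products X B"
      then obtain a b where ab: "a \<in> X" "b \<in> B" "j = a * b" by (auto simp: products_def)
      have "x * b \<in> R" using X(4) ab(2) B(2) by (auto simp: v_op_def frac_inv_def)
      then have "x * b * a \<in> I" using ab(1) X(2) by (intro submod_mult[OF I]) auto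
      then show "j \<in> {j. x * j \<in> I}" using ab(3) by (simp add: mult_ac)
    qed
    show "submod R {j. x * j \<in> I}"
      using I by (auto simp: submod_def distrib_left mult.left_commute)
  qed
  moreover have "nonzero_fg_ideal R ?J"
    unfolding nonzero_fg_ideal_iff[OF R] using finite_products[OF X(1) B(1)] sub B(4) by blast
  moreover have "v_op R ?J = R" using B(3) sub by (simp add: v_op_hull R v_op_eq_ring_iff)
  ultimately show "x \<in> w_op R I" unfolding w_op_def by blast
qed

section \<open>Torsion-free abelian groups\<close>

text \<open>Integer multiples, built from the same iterated sums that express torsionlessness of the
  grading monoid; at most one of the two sums is nonempty. They make the group a module over the
  integers, whose subspaces are the subgroups.\<close>

definition zm :: "int \<Rightarrow> 'g::ab_group_add \<Rightarrow> 'g" where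
  "zm k x = (\<Sum>i<nat k. x) - (\<Sum>i<nat (- k). x)"

lemma sum_const_add: "(\<Sum>i<m + n. x) = (\<Sum>i<m. x) + (\<Sum>i<n::nat. x :: 'g::ab_group_add)"
  by (induction n) (auto simp: add_ac)

lemma zm_int_diff: "zm (int p - int q) x = (\<Sum>i<p. x) - (\<Sum>i<q. x)"
proof (cases "q \<le> p")
  case True
  then obtain r where "p = q + r" using le_Suc_ex by blast
  then show ?thesis by (simp add: zm_def sum_const_add)
next
  case False
  then obtain r where "q = p + r" using le_Suc_ex[of p q] by auto
  then show ?thesis by (simp add: zm_def sum_const_add)
qed

lemma zm_int: "zm (int n) x = (\<Sum>i<n. x)"
  using zm_int_diff[of n 0 x] by simp

lemma zm_add: "zm (a + b) x = zm a x + zm b x"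
proof -
  obtain p q where a: "a = int p - int q" by (rule int_diff_cases)
  obtain r s where b: "b = int r - int s" by (rule int_diff_cases)
  have "a + b = int (p + r) - int (q + s)" by (simp add: a b)
  then have "zm (a + b) x = (\<Sum>i<p + r. x) - (\<Sum>i<q + s. x)" by (simp only: zm_int_diff)
  then show ?thesis by (simp add: a b zm_int_diff sum_const_add)
qed

interpretation zm: module "zm :: int \<Rightarrow> 'g::ab_group_add \<Rightarrow> 'g"
proof
  fix a b :: int and x y :: 'g
  obtain p q where a: "a = int p - int q" by (rule int_diff_cases)
  show "zm a (x + y) = zm a x + zm a y" by (simp add: a zm_int_diff sum.distrib)
  show "zm (a + b) x = zm a x + zm b x" by (rule zm_add)
  show "zm 1 x = x" by (simp add: zm_def)
  have zero: "zm 0 x = 0" by (simp add: zm_def)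
  have nat: "(\<Sum>i<p. zm b x) = zm (int p * b) x" for p
    by (induction p) (simp_all add: zero zm_add distrib_right add.commute)
  have "zm (a * b + int q * b) x = zm (int p * b) x" by (simp add: a left_diff_distrib)
  then have "zm (a * b) x = zm (int p * b) x - zm (int q * b) x" by (simp add: zm_add algebra_simps)
  then show "zm a (zm b x) = zm (a * b) x" by (simp add: a zm_int_diff nat)
qed

definition torsion_free :: "'g::ab_group_add itself \<Rightarrow> bool" where
  "torsion_free _ \<longleftrightarrow> (\<forall>k (x::'g). k \<noteq> 0 \<longrightarrow> zm k x = 0 \<longrightarrow> x = 0)"

text \<open>The additive form of the unique product property. It is all that the component arguments
  use of an ordering of the degrees.\<close>

definition unique_sums :: "'g::ab_group_add itself \<Rightarrow> bool" where
  "unique_sums _ \<longleftrightarrow> (\<forall>A B :: 'g set. finite A \<longrightarrow> finite B \<longrightarrow> A \<noteq> {} \<longrightarrow> B \<noteq> {} \<longrightarrow>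
     (\<exists>a\<in>A. \<exists>b\<in>B. \<forall>a'\<in>A. \<forall>b'\<in>B. a' + b' = a + b \<longrightarrow> a' = a \<and> b' = b))"

text \<open>The nonnegative part of a translation-invariant partial order.\<close>

definition cone :: "'g::ab_group_add set \<Rightarrow> bool" where
  "cone P \<longleftrightarrow> 0 \<in> P \<and> (\<forall>x\<in>P. \<forall>y\<in>P. x + y \<in> P) \<and> (\<forall>x\<in>P. - x \<in> P \<longrightarrow> x = 0)"

lemma cone_zm: "cone P \<Longrightarrow> x \<in> P \<Longrightarrow> 0 \<le> k \<Longrightarrow> zm k x \<in> P"
proof -
  assume P: "cone P" "x \<in> P" and "0 \<le> k"
  from this(3) show "zm k x \<in> P"
  proof (induction k rule: int_ge_induct)
    case (step i)
    then have "zm i x + x \<in> P" using P unfolding cone_def by blast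
    then show ?case by (simp add: zm.scale_left_distrib)
  qed (use P in \<open>simp add: cone_def\<close>)
qed

text \<open>Otherwise \<open>P\<close> plus the nonnegative multiples of \<open>x\<close> would be a
  larger cone. If \<open>y\<close> and \<open>- y\<close> both lie in it, adding them puts
  \<open>- zm (k + l) x\<close> into \<open>P\<close>, which leaves only \<open>k = l = 0\<close>,
  and then antisymmetry of \<open>P\<close> applies.\<close>

lemma maximal_cone_absorbs:
  assumes P: "cone P" and max: "\<And>Q. cone Q \<Longrightarrow> P \<subseteq> Q \<Longrightarrow> Q = P" and x: "x \<notin> P"
  shows "\<exists>k>0. - zm k x \<in> P"
proof (rule ccontr)
  assume neg: "\<not> (\<exists>k>0. - zm k x \<in> P)"
  define Q where "Q = {p + zm k x | p k. p \<in> P \<and> 0 \<le> k}"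
  have memI: "p + zm k x \<in> Q" if "p \<in> P" "0 \<le> k" for p k using that by (auto simp: Q_def)
  have "cone Q" unfolding cone_def
  proof (intro conjI ballI impI)
    show "0 \<in> Q" using memI[of 0 0] P by (simp add: cone_def)
    fix y assume "y \<in> Q"
    then obtain p k where y: "y = p + zm k x" "p \<in> P" "0 \<le> k" by (auto simp: Q_def)
    {
      fix z assume "z \<in> Q"
      then obtain q l where z: "z = q + zm l x" "q \<in> P" "0 \<le> l" by (auto simp: Q_def)
      have "p + q + zm (k + l) x \<in> Q" using y z P by (intro memI) (auto simp: cone_def)
      then show "y + z \<in> Q" by (simp add: y z zm.scale_left_distrib add_ac)
    }
    assume "- y \<in> Q"
    then obtain q l where z: "- y = q + zm l x" "q \<in> P" "0 \<le> l" by (auto simp: Q_def)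
    have "(p + q) + zm (k + l) x = y + - y" by (simp only: z(1)) (simp add: y zm.scale_left_distrib add_ac)
    then have "- zm (k + l) x = p + q" by (simp add: eq_neg_iff_add_eq_0[symmetric] neg_eq_iff_add_eq_0 add_ac)
    moreover have "p + q \<in> P" using P y z by (auto simp: cone_def)
    ultimately have "k + l \<le> 0" using neg by (metis not_le)
    then have "k = 0" "l = 0" using y z by auto
    then have "y = p" "- y = q" using y(1) z(1) by auto
    then show "y = 0" using P y z by (auto simp: cone_def)
  qed
  moreover have "P \<subseteq> Q" using memI[of _ 0] by auto
  ultimately have "Q = P" by (rule max)
  then show False using memI[of 0 1] x P by (simp add: cone_def)
qed

text \<open>Levi's theorem: in a torsion-free group a maximal cone, provided by Zorn's lemma, is a
  total order. The sum of the two largest elements then has only one representation.\<close>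

lemma torsion_free_unique_sums:
  assumes tf: "torsion_free TYPE('g::ab_group_add)"
  shows "unique_sums TYPE('g)"
proof -
  have "\<exists>P::'g set. P \<in> Collect cone \<and> (\<forall>Q\<in>Collect cone. P \<subseteq> Q \<longrightarrow> Q = P)"
    unfolding Bex_def[symmetric]
  proof (rule subset_Zorn_nonempty)
    show "Collect cone \<noteq> {}" by (auto intro!: exI[of _ "{0}"] simp: cone_def)
    fix C :: "'g set set" assume C: "C \<noteq> {}" "subset.chain (Collect cone) C"
    then have cone: "cone P" if "P \<in> C" for P using that by (auto simp: subset.chain_def)
    have two: "\<exists>R\<in>C. x \<in> R \<and> y \<in> R" if "x \<in> \<Union>C" "y \<in> \<Union>C" for x y
    proof -
      obtain X Y where "X \<in> C" "Y \<in> C" "x \<in> X" "y \<in> Y"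
        using \<open>x \<in> \<Union>C\<close> \<open>y \<in> \<Union>C\<close> by blast
      moreover have "X \<subseteq> Y \<or> Y \<subseteq> X"
        using C(2) calculation unfolding subset.chain_def by blast
      ultimately show ?thesis by blast
    qed
    show "\<Union>C \<in> Collect cone" unfolding cone_def mem_Collect_eq
    proof (intro conjI ballI impI)
      show "0 \<in> \<Union>C" using C(1) cone by (auto simp: cone_def)
      show "x + y \<in> \<Union>C" if "x \<in> \<Union>C" "y \<in> \<Union>C" for x y
        using two[OF that] cone by (auto simp: cone_def)
      show "x = 0" if "x \<in> \<Union>C" "- x \<in> \<Union>C" for x
        using two[OF that] cone by (auto simp: cone_def)
    qed
  qed
  then obtain P :: "'g set" where P: "cone P" and max: "\<And>Q. cone Q \<Longrightarrow> P \<subseteq> Q \<Longrightarrow> Q = P" by blast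
  have total: "x \<in> P \<or> - x \<in> P" for x
  proof (rule ccontr)
    assume x: "\<not> (x \<in> P \<or> - x \<in> P)"
    obtain k l where k: "k > 0" "- zm k x \<in> P" and l: "l > 0" "- zm l (- x) \<in> P"
      using maximal_cone_absorbs[OF P max] x by blast
    \<comment> \<open>Both absorbed multiples are raised to the common factor \<open>k * l\<close>,
      which lands in \<open>P\<close> with both signs.\<close>
    have "zm k (zm l x) \<in> P" "zm l (- zm k x) \<in> P"
      using cone_zm[OF P, of "zm l x" k] cone_zm[OF P, of "- zm k x" l] k l by auto
    then have "zm (k * l) x \<in> P" "- zm (k * l) x \<in> P" by (simp_all add: mult.commute)
    then have "zm (k * l) x = 0" using P by (auto simp: cone_def)
    moreover have "k * l \<noteq> 0" using k l by simp
    ultimately have "x = 0" using tf unfolding torsion_free_def by blast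
    then show False using x P by (simp add: cone_def)
  qed
  have top: "\<exists>a\<in>A. \<forall>a'\<in>A. a - a' \<in> P" if "finite A" "A \<noteq> {}" for A
    using that
  proof (induction A rule: finite_ne_induct)
    case (singleton x)
    then show ?case using P by (simp add: cone_def)
  next
    case (insert x F)
    then obtain a where a: "a \<in> F" "\<And>a'. a' \<in> F \<Longrightarrow> a - a' \<in> P" by blast
    consider "a - x \<in> P" | "x - a \<in> P" using total[of "a - x"] by auto
    then show ?case
    proof cases
      case 2
      have "x - a' \<in> P" if "a' \<in> F" for a'
        using 2 a(2)[OF that] P unfolding cone_def by (metis diff_add_cancel add_diff_eq)
      then show ?thesis using P by (auto simp: cone_def)
    qed (use a in auto)
  qed
  show ?thesis unfolding unique_sums_def
  proof (intro allI impI)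
    fix A B :: "'g set" assume "finite A" "finite B" "A \<noteq> {}" "B \<noteq> {}"
    then obtain a b where ab: "a \<in> A" "\<And>a'. a' \<in> A \<Longrightarrow> a - a' \<in> P"
      "b \<in> B" "\<And>b'. b' \<in> B \<Longrightarrow> b - b' \<in> P" using top by metis
    have "a' = a \<and> b' = b" if "a' \<in> A" "b' \<in> B" "a' + b' = a + b" for a' b'
    proof -
      \<comment> \<open>The two differences are nonnegative and opposite to each other, so they
        vanish.\<close>
      have "b - b' = - (a - a')" using that(3) by (simp add: algebra_simps)
      then have "a - a' = 0" using ab(2)[OF that(1)] ab(4)[OF that(2)] P by (auto simp: cone_def)
      then show ?thesis using that(3) by simp
    qed
    then show "\<exists>a\<in>A. \<exists>b\<in>B. \<forall>a'\<in>A. \<forall>b'\<in>B. a' + b' = a + b \<longrightarrow> a' = a \<and> b' = b"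
      using ab by blast
  qed
qed

section \<open>Graded fields\<close>

lemma sum_decomposition:
  assumes "finite A" "A \<subseteq> I" "\<And>\<alpha>. \<alpha> \<in> A \<Longrightarrow> c \<alpha> \<in> G \<alpha>" "\<And>\<alpha>. \<alpha> \<in> I \<Longrightarrow> 0 \<in> G \<alpha>"
  shows "decomposition I G (sum c A) (\<lambda>\<alpha>. if \<alpha> \<in> A then c \<alpha> else 0)"
proof -
  have "sum c A = (\<Sum>\<alpha> | (if \<alpha> \<in> A then c \<alpha> else 0) \<noteq> 0. if \<alpha> \<in> A then c \<alpha> else 0)"
    using assms(1) by (intro sum.mono_neutral_cong_right) auto
  moreover have "finite {\<alpha>. (if \<alpha> \<in> A then c \<alpha> else 0) \<noteq> 0}"
    using assms(1) by (rule finite_subset[rotated]) auto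
  ultimately show ?thesis using assms(2-) by (auto simp: decomposition_def)
qed

text \<open>Only homogeneous nonzero elements are required to be invertible; 0 has every degree, and
  \<open>inverse 0 = 0\<close> keeps the axiom on inverses uniform. The group stays arbitrary
  because the locale serves both the given grading and the integer grading of a Laurent
  ring.\<close>

locale graded_field =
  fixes K :: "'g::ab_group_add \<Rightarrow> 'k::field set"
  assumes K_zero: "0 \<in> K \<alpha>"
    and K_diff: "x \<in> K \<alpha> \<Longrightarrow> y \<in> K \<alpha> \<Longrightarrow> x - y \<in> K \<alpha>"
    and K_one: "1 \<in> K 0"
    and K_mult: "x \<in> K \<alpha> \<Longrightarrow> y \<in> K \<beta> \<Longrightarrow> x * y \<in> K (\<alpha> + \<beta>)"
    and K_inverse: "x \<in> K \<alpha> \<Longrightarrow> inverse x \<in> K (- \<alpha>)"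
    and K_independent: "finite A \<Longrightarrow> (\<And>\<alpha>. \<alpha> \<in> A \<Longrightarrow> c \<alpha> \<in> K \<alpha>) \<Longrightarrow> sum c A = 0 \<Longrightarrow> \<alpha> \<in> A \<Longrightarrow> c \<alpha> = 0"
    and unique_sums: "unique_sums TYPE('g)"
begin

definition whole :: "'k set" where
  "whole = {x. \<exists>c. decomposition UNIV K x c}"

definition comp :: "'k \<Rightarrow> 'g \<Rightarrow> 'k" where
  "comp x = (THE c. decomposition UNIV K x c)"

definition supp :: "'k \<Rightarrow> 'g set" where
  "supp x = {\<alpha>. comp x \<alpha> \<noteq> 0}"

definition hom :: "'k \<Rightarrow> bool" where
  "hom x \<longleftrightarrow> (\<exists>\<alpha>. x \<in> K \<alpha>)"

lemma K_add: "x \<in> K \<alpha> \<Longrightarrow> y \<in> K \<alpha> \<Longrightarrow> x + y \<in> K \<alpha>"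
  using K_diff[of x \<alpha> "0 - y"] K_diff[of 0 \<alpha> y] K_zero[of \<alpha>] by simp

lemma K_power: "x \<in> K \<alpha> \<Longrightarrow> x ^ n \<in> K (zm (int n) \<alpha>)"
  by (induction n) (auto simp: K_one zm.scale_left_distrib K_mult)

lemma decomposition_unique:
  assumes "decomposition UNIV K x c" "decomposition UNIV K x d"
  shows "c = d"
proof
  fix \<alpha>
  let ?A = "insert \<alpha> ({\<alpha>. c \<alpha> \<noteq> 0} \<union> {\<alpha>. d \<alpha> \<noteq> 0})"
  have fin: "finite ?A" using assms by (auto simp: decomposition_def)
  have "sum c ?A = sum c {\<alpha>. c \<alpha> \<noteq> 0}" "sum d ?A = sum d {\<alpha>. d \<alpha> \<noteq> 0}"
    by (intro sum.mono_neutral_right[OF fin]; blast)+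
  then have "sum c ?A = x" "sum d ?A = x"
    using assms by (simp_all add: decomposition_def)
  then have "(\<Sum>\<beta>\<in>?A. c \<beta> - d \<beta>) = 0" by (simp add: sum_subtractf)
  moreover have "c \<beta> - d \<beta> \<in> K \<beta>" for \<beta> using assms K_diff by (auto simp: decomposition_def)
  ultimately have "c \<alpha> - d \<alpha> = 0"
    using K_independent[of ?A "\<lambda>\<beta>. c \<beta> - d \<beta>" \<alpha>] fin by blast
  then show "c \<alpha> = d \<alpha>" by simp
qed

lemma comp_eqI: "decomposition UNIV K x c \<Longrightarrow> comp x = c"
  unfolding comp_def by (rule the_equality) (auto dest: decomposition_unique)

lemma sum_in_whole:
  "finite A \<Longrightarrow> (\<And>\<alpha>. \<alpha> \<in> A \<Longrightarrow> c \<alpha> \<in> K \<alpha>) \<Longrightarrow> sum c A \<in> whole"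
  unfolding whole_def by (rule CollectI, rule exI, rule sum_decomposition) (auto simp: K_zero)

lemma comp_sum_K:
  "finite A \<Longrightarrow> (\<And>\<alpha>. \<alpha> \<in> A \<Longrightarrow> c \<alpha> \<in> K \<alpha>) \<Longrightarrow>
    comp (sum c A) \<alpha> = (if \<alpha> \<in> A then c \<alpha> else 0)"
  by (subst comp_eqI[OF sum_decomposition]) (auto simp: K_zero)

lemma decomposition_comp: "x \<in> whole \<Longrightarrow> decomposition UNIV K x (comp x)"
  using comp_eqI by (auto simp: whole_def)

lemma comp_in_K: "x \<in> whole \<Longrightarrow> comp x \<alpha> \<in> K \<alpha>"
  and finite_supp: "x \<in> whole \<Longrightarrow> finite (supp x)"
  and sum_comp: "x \<in> whole \<Longrightarrow> sum (comp x) (supp x) = x"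
  using decomposition_comp[of x] by (auto simp: decomposition_def supp_def)

lemma sum_comp_superset: "x \<in> whole \<Longrightarrow> finite A \<Longrightarrow> supp x \<subseteq> A \<Longrightarrow> sum (comp x) A = x"
  by (subst (3) sum_comp[symmetric]) (auto intro!: sum.mono_neutral_right simp: supp_def)

lemma K_whole: "x \<in> K \<alpha> \<Longrightarrow> x \<in> whole"
  using sum_in_whole[of "{\<alpha>}" "\<lambda>_. x"] by simp

lemma comp_K: "x \<in> K \<alpha> \<Longrightarrow> comp x \<beta> = (if \<beta> = \<alpha> then x else 0)"
  using comp_sum_K[of "{\<alpha>}" "\<lambda>_. x" \<beta>] by simp

lemma whole_add: "x \<in> whole \<Longrightarrow> y \<in> whole \<Longrightarrow> x + y \<in> whole"
  and comp_add: "x \<in> whole \<Longrightarrow> y \<in> whole \<Longrightarrow> comp (x + y) \<alpha> = comp x \<alpha> + comp y \<alpha>"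
proof -
  assume xy: "x \<in> whole" "y \<in> whole"
  let ?A = "supp x \<union> supp y"
  have fin: "finite ?A" using xy finite_supp by auto
  have eq: "x + y = (\<Sum>\<alpha>\<in>?A. comp x \<alpha> + comp y \<alpha>)"
    using xy fin by (simp add: sum.distrib sum_comp_superset)
  have K: "comp x \<alpha> + comp y \<alpha> \<in> K \<alpha>" for \<alpha> using xy by (intro K_add comp_in_K)
  show "x + y \<in> whole" unfolding eq using fin K by (rule sum_in_whole)
  show "comp (x + y) \<alpha> = comp x \<alpha> + comp y \<alpha>"
    unfolding eq by (subst comp_sum_K[OF fin K]) (auto simp: supp_def)
qed

lemma comp_mult_hom:
  assumes h: "h \<in> K \<beta>" and x: "x \<in> whole"
  shows "h * x \<in> whole" "comp (h * x) \<alpha> = h * comp x (\<alpha> - \<beta>)"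
proof -
  let ?A = "(+) \<beta> ` supp x"
  have fin: "finite ?A" using x finite_supp by auto
  have eq: "h * x = (\<Sum>\<alpha>\<in>?A. h * comp x (\<alpha> - \<beta>))"
    by (subst (1) sum_comp[OF x, symmetric]) (simp add: sum_distrib_left sum.reindex)
  have K: "h * comp x (\<alpha> - \<beta>) \<in> K \<alpha>" for \<alpha>
    using K_mult[OF h comp_in_K[OF x, of "\<alpha> - \<beta>"]] by simp
  show "h * x \<in> whole" unfolding eq using fin K by (rule sum_in_whole)
  have "\<alpha> \<in> ?A \<longleftrightarrow> \<alpha> - \<beta> \<in> supp x" by (force simp: image_iff)
  then show "comp (h * x) \<alpha> = h * comp x (\<alpha> - \<beta>)"
    unfolding eq by (subst comp_sum_K[OF fin K]) (auto simp: supp_def)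
qed

lemma whole_uminus: "x \<in> whole \<Longrightarrow> - x \<in> whole"
  and comp_uminus: "x \<in> whole \<Longrightarrow> comp (- x) \<alpha> = - comp x \<alpha>"
  using comp_mult_hom[of "- 1" 0 x] K_diff[OF K_zero K_one] by simp_all

lemma whole_diff: "x \<in> whole \<Longrightarrow> y \<in> whole \<Longrightarrow> x - y \<in> whole"
  and comp_diff: "x \<in> whole \<Longrightarrow> y \<in> whole \<Longrightarrow> comp (x - y) \<alpha> = comp x \<alpha> - comp y \<alpha>"
  using whole_add[of x "- y"] comp_add[of x "- y"] by (simp_all add: whole_uminus comp_uminus)

lemma whole_0: "0 \<in> whole" and comp_0: "comp 0 \<alpha> = 0"
  using K_whole[OF K_zero] comp_K[OF K_zero, of \<alpha> \<alpha>] by simp_all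

lemma whole_sum: "(\<And>i. i \<in> I \<Longrightarrow> f i \<in> whole) \<Longrightarrow> sum f I \<in> whole"
  by (induction I rule: infinite_finite_induct) (auto simp: whole_0 whole_add)

lemma comp_sum: "(\<And>i. i \<in> I \<Longrightarrow> f i \<in> whole) \<Longrightarrow> comp (sum f I) \<alpha> = (\<Sum>i\<in>I. comp (f i) \<alpha>)"
  by (induction I rule: infinite_finite_induct) (auto simp: comp_0 comp_add whole_sum)

lemma whole_mult: "x \<in> whole \<Longrightarrow> y \<in> whole \<Longrightarrow> x * y \<in> whole"
  and comp_mult: "x \<in> whole \<Longrightarrow> y \<in> whole \<Longrightarrow>
    comp (x * y) \<alpha> = (\<Sum>\<beta>\<in>supp x. comp x \<beta> * comp y (\<alpha> - \<beta>))"
proof -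
  assume xy: "x \<in> whole" "y \<in> whole"
  have eq: "x * y = (\<Sum>\<beta>\<in>supp x. comp x \<beta> * y)"
    by (subst (1) sum_comp[OF xy(1), symmetric]) (simp add: sum_distrib_right)
  have W: "comp x \<beta> * y \<in> whole" for \<beta> using comp_mult_hom comp_in_K xy by blast
  show "x * y \<in> whole" unfolding eq using W by (rule whole_sum)
  show "comp (x * y) \<alpha> = (\<Sum>\<beta>\<in>supp x. comp x \<beta> * comp y (\<alpha> - \<beta>))"
    unfolding eq by (subst comp_sum[OF W]) (simp add: comp_mult_hom[OF comp_in_K[OF xy(1)] xy(2)])
qed

lemma subring_whole: "is_subring whole"
  using K_whole[OF K_one] by (auto simp: is_subring_def whole_diff whole_mult)

lemma hom_whole: "hom x \<Longrightarrow> x \<in> whole"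
  by (auto simp: hom_def K_whole)

lemma hom_comp: "x \<in> whole \<Longrightarrow> hom (comp x \<alpha>)"
  using comp_in_K by (auto simp: hom_def)

lemma hom_mult: "hom x \<Longrightarrow> hom y \<Longrightarrow> hom (x * y)"
  unfolding hom_def using K_mult by blast

lemma hom_1: "hom 1" using K_one by (auto simp: hom_def)

lemma hom_inverse: "hom x \<Longrightarrow> hom (inverse x)"
  using K_inverse by (auto simp: hom_def)

lemma hom_divide: "hom x \<Longrightarrow> hom y \<Longrightarrow> hom (x / y)"
  by (simp add: divide_inverse hom_mult hom_inverse)

lemma supp_eq_empty_iff: "x \<in> whole \<Longrightarrow> supp x = {} \<longleftrightarrow> x = 0"
  using sum_comp[of x] by (auto simp: supp_def comp_0)

text \<open>Asked of arbitrary subsets, so that it covers overrings, fractional ideals and multiples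
  \<open>b R\<close> alike.\<close>

definition graded :: "'k set \<Rightarrow> bool" where
  "graded M \<longleftrightarrow> M \<subseteq> whole \<and> (\<forall>x\<in>M. \<forall>\<alpha>. comp x \<alpha> \<in> M)"

definition comps :: "'k set \<Rightarrow> 'k set" where
  "comps X = (\<Union>x\<in>X. comp x ` supp x)"

lemma finite_comps: "finite X \<Longrightarrow> X \<subseteq> whole \<Longrightarrow> finite (comps X)"
  by (auto simp: comps_def finite_supp)

lemma comps_hom: "X \<subseteq> whole \<Longrightarrow> x \<in> comps X \<Longrightarrow> hom x"
  by (auto simp: comps_def hom_comp)

lemma comps_nonzero: "X \<subseteq> whole \<Longrightarrow> \<not> X \<subseteq> {0} \<Longrightarrow> \<not> comps X \<subseteq> {0}"
  using supp_eq_empty_iff by (fastforce simp: comps_def supp_def)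

lemma comps_subset: "graded M \<Longrightarrow> X \<subseteq> M \<Longrightarrow> comps X \<subseteq> M"
  by (auto simp: comps_def graded_def)

text \<open>A weak Dedekind--Mertens lemma. At a degree with a unique representation the component of the
  product is a single product of components, which allows removing a component from \<open>z\<close> or \<open>j\<close>.\<close>

lemma component_power_mult:
  assumes M: "graded M" and diff: "\<And>x y. x \<in> M \<Longrightarrow> y \<in> M \<Longrightarrow> x - y \<in> M" and M0: "0 \<in> M"
    and "j \<in> whole" "z \<in> whole" "z * j \<in> M"
    and "\<And>\<alpha> m. m \<in> M \<Longrightarrow> comp j \<alpha> * m \<in> M"
  shows "\<exists>n. comp j \<gamma> ^ n * z \<in> M"
  using assms(4-)
proof (induction "card (supp j) + card (supp z)" arbitrary: j z rule: less_induct)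
  case less
  have add: "x + y \<in> M" if "x \<in> M" "y \<in> M" for x y
    using diff[OF that(1) diff[OF M0 that(2)]] by simp
  have sum: "sum f I \<in> M" if "\<And>i. i \<in> I \<Longrightarrow> f i \<in> M" for f and I :: "'g set"
    using that by (induction I rule: infinite_finite_induct) (auto simp: M0 add)
  have pow: "comp j \<alpha> ^ n * m \<in> M" if "m \<in> M" for \<alpha> n m
    using less.prems(4) that by (induction n) (auto simp: mult.assoc)
  show ?case
  proof (cases "j = 0 \<or> z = 0")
    case True
    then show ?thesis using M0 by (auto simp: comp_0 intro: exI[of _ "1 :: nat"])
  next
    case False
    note fin = finite_supp[OF less.prems(1)] finite_supp[OF less.prems(2)]
    have "supp z \<noteq> {}" "supp j \<noteq> {}" using False supp_eq_empty_iff less.prems by auto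
    then obtain \<mu> \<nu> where \<mu>: "\<mu> \<in> supp z" and \<nu>: "\<nu> \<in> supp j"
      and uniq: "\<And>a b. a \<in> supp z \<Longrightarrow> b \<in> supp j \<Longrightarrow> a + b = \<mu> + \<nu> \<Longrightarrow> a = \<mu> \<and> b = \<nu>"
      using unique_sums fin unfolding unique_sums_def by metis
    let ?u = "comp j \<nu>" and ?a = "comp z \<mu>"
    have uK: "?u \<in> K \<nu>" and aK: "?a \<in> K \<mu>" using less.prems comp_in_K by auto
    have "comp (z * j) (\<mu> + \<nu>) = (\<Sum>\<beta>\<in>supp z. comp z \<beta> * comp j (\<mu> + \<nu> - \<beta>))"
      using less.prems by (simp add: comp_mult)
    also have "\<dots> = (\<Sum>\<beta>\<in>{\<mu>}. comp z \<beta> * comp j (\<mu> + \<nu> - \<beta>))"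
      using fin \<mu> uniq by (intro sum.mono_neutral_right) (force simp: supp_def)+
    finally have "?a * ?u = comp (z * j) (\<mu> + \<nu>)" by simp
    then have au: "?a * ?u \<in> M" using M less.prems(3) by (simp add: graded_def)
    \<comment> \<open>\<open>z'\<close> loses the component of \<open>z\<close> at
      \<open>\<mu>\<close> at the cost of a factor \<open>?u\<close>. The correction term
      \<open>?a * ?u * j\<close> lies in \<open>M\<close> because \<open>?a * ?u\<close>
      does.\<close>
    define z' where "z' = ?u * (z - ?a)"
    define j' where "j' = j - ?u"
    have za: "z - ?a \<in> whole" using less.prems aK K_whole whole_diff by blast
    have z': "z' \<in> whole" unfolding z'_def using comp_mult_hom[OF uK za] by simp
    have j': "j' \<in> whole" unfolding j'_def using less.prems uK K_whole whole_diff by blast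
    have "supp z' \<subseteq> (\<lambda>\<alpha>. \<alpha> + \<nu>) ` (supp z - {\<mu>})"
    proof
      fix \<alpha> assume "\<alpha> \<in> supp z'"
      then have "comp (z - ?a) (\<alpha> - \<nu>) \<noteq> 0" by (auto simp: supp_def z'_def comp_mult_hom[OF uK za])
      then have "\<alpha> - \<nu> \<in> supp z - {\<mu>}"
        using less.prems(2) comp_diff[OF _ K_whole[OF aK]] comp_K[OF aK]
        by (auto simp: supp_def split: if_splits)
      then show "\<alpha> \<in> (\<lambda>\<alpha>. \<alpha> + \<nu>) ` (supp z - {\<mu>})" by (rule rev_image_eqI) simp
    qed
    then have "card (supp z') \<le> card (supp z - {\<mu>})"
      using fin by (meson card_image_le card_mono finite_Diff finite_imageI le_trans)
    then have cz: "card (supp z') < card (supp z)" using \<mu> fin by (meson card_Diff1_less le_less_trans)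
    have compj': "comp j' \<alpha> = (if \<alpha> = \<nu> then 0 else comp j \<alpha>)" for \<alpha>
      unfolding j'_def using comp_diff[OF less.prems(1) K_whole[OF uK]] comp_K[OF uK] by simp
    then have "supp j' = supp j - {\<nu>}" by (auto simp: supp_def)
    then have cj: "card (supp j') < card (supp j)" using \<nu> fin by (metis card_Diff1_less)
    have "?u * (z * j) \<in> M" using less.prems by blast
    moreover have "(?a * ?u) * j = (\<Sum>\<alpha>\<in>supp j. comp j \<alpha> * (?a * ?u))"
      unfolding sum_distrib_right[symmetric] sum_comp[OF less.prems(1)] by (rule mult.commute)
    then have "(?a * ?u) * j \<in> M" using less.prems(4)[OF au] by (auto intro!: sum)
    ultimately have "?u * (z * j) - ?a * ?u * j \<in> M" by (rule diff)
    then have "z' * j \<in> M" by (simp add: z'_def algebra_simps)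
    then obtain n where "comp j \<gamma> ^ n * z' \<in> M"
      using less.hyps[of j z'] less.prems z' cz by auto
    then have "comp j \<gamma> ^ n * z' + comp j \<gamma> ^ n * (?a * ?u) \<in> M" using pow[OF au] by (rule add)
    then have uz: "comp j \<gamma> ^ n * (?u * z) \<in> M" by (simp add: z'_def algebra_simps)
    \<comment> \<open>For \<open>\<gamma> = \<nu>\<close> the factor \<open>?u\<close> only raises
      the exponent. Otherwise the membership just found allows subtracting \<open>?u\<close> from
      \<open>j\<close>, which leaves the component at \<open>\<gamma>\<close> unchanged and costs a
      power of that component on \<open>z\<close>.\<close>
    show ?thesis
    proof (cases "\<gamma> = \<nu>")
      case True
      then show ?thesis using uz by (auto simp: mult_ac intro!: exI[of _ "Suc n"])
    next
      case False
      let ?w = "comp j \<gamma> ^ n"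
      have wK: "?w \<in> K (zm (int n) \<gamma>)" using less.prems comp_in_K K_power by blast
      note wz = comp_mult_hom[OF wK less.prems(2)]
      have "?w * z * j - ?w * (?u * z) \<in> M"
        using pow[OF less.prems(3), of \<gamma> n] uz by (auto simp: mult.assoc intro: diff)
      then have wzj: "?w * z * j' \<in> M" by (simp add: j'_def algebra_simps)
      have "supp (?w * z) \<subseteq> (\<lambda>\<alpha>. \<alpha> + zm (int n) \<gamma>) ` supp z"
      proof
        fix \<alpha> assume "\<alpha> \<in> supp (?w * z)"
        then have "\<alpha> - zm (int n) \<gamma> \<in> supp z" by (auto simp: supp_def wz)
        then show "\<alpha> \<in> (\<lambda>\<alpha>. \<alpha> + zm (int n) \<gamma>) ` supp z" by (rule rev_image_eqI) simp
      qed
      then have "card (supp (?w * z)) \<le> card (supp z)"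
        using fin by (meson card_image_le card_mono finite_imageI le_trans)
      then have "\<exists>m. comp j' \<gamma> ^ m * (?w * z) \<in> M"
        using less.hyps[of j' "?w * z"] cj j' wz(1) wzj less.prems(4) M0 by (auto simp: compj')
      then obtain m where "comp j \<gamma> ^ m * (?w * z) \<in> M" using False by (auto simp: compj')
      then have "comp j \<gamma> ^ (m + n) * z \<in> M" by (simp add: power_add mult.assoc)
      then show ?thesis by blast
    qed
  qed
qed

end

section \<open>Graded subrings of graded fields\<close>

text \<open>The axiom \<open>denominators\<close> makes \<open>whole\<close> the localization of
  \<open>R\<close> at its nonzero homogeneous elements.\<close>

locale graded_subring = graded_field K for K :: "'g::ab_group_add \<Rightarrow> 'k::field set" +
  fixes R :: "'k set"
  assumes subring: "is_subring R"
    and R_graded: "graded R"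
    and denominators: "x \<in> whole \<Longrightarrow> \<exists>h. hom h \<and> h \<noteq> 0 \<and> h \<in> R \<and> h * x \<in> R"
begin

lemma R_whole: "x \<in> R \<Longrightarrow> x \<in> whole"
  and R_comp: "x \<in> R \<Longrightarrow> comp x \<alpha> \<in> R"
  using R_graded by (auto simp: graded_def)

lemma hom_mult_whole:
  assumes "hom a" "a \<noteq> 0" "a * z \<in> whole"
  shows "z \<in> whole"
proof -
  have "inverse a * (a * z) \<in> whole"
    using assms whole_mult hom_whole hom_inverse by blast
  then show ?thesis using assms(2) by (simp flip: mult.assoc)
qed

text \<open>One nonzero homogeneous element of \<open>X\<close> forces the inverse into
  \<open>whole\<close>, so that components exist; multiplication by a homogeneous element then only
  shifts degrees.\<close>

lemma frac_inv_graded: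
  assumes X: "\<And>x. x \<in> X \<Longrightarrow> hom x" "\<not> X \<subseteq> {0}"
  shows "graded (frac_inv R X)"
proof -
  obtain x0 where x0: "x0 \<in> X" "x0 \<noteq> 0" using X by auto
  have W: "z \<in> whole" if "z \<in> frac_inv R X" for z
    using that x0 X(1) hom_mult_whole[of x0 z] R_whole by (auto simp: frac_inv_def mult.commute)
  moreover have "comp z \<alpha> \<in> frac_inv R X" if z: "z \<in> frac_inv R X" for z \<alpha>
    unfolding frac_inv_def
  proof (safe)
    fix a assume a: "a \<in> X"
    then obtain \<beta> where \<beta>: "a \<in> K \<beta>" using X by (auto simp: hom_def)
    have "comp (a * z) (\<alpha> + \<beta>) = a * comp z \<alpha>" using comp_mult_hom[OF \<beta> W[OF z]] by simp
    moreover have "a * z \<in> R" using z a by (auto simp: frac_inv_def mult.commute)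
    ultimately show "comp z \<alpha> * a \<in> R" using R_comp by (metis mult.commute)
  qed
  ultimately show ?thesis by (auto simp: graded_def)
qed

lemma comps_mult_mem:
  assumes "x \<in> whole" "\<And>c. c \<in> comps {x} \<Longrightarrow> z * c \<in> R"
  shows "z * x \<in> R"
proof -
  have "z * x = (\<Sum>\<alpha>\<in>supp x. z * comp x \<alpha>)"
    by (subst (1) sum_comp[OF assms(1), symmetric]) (simp add: sum_distrib_left)
  also have "\<dots> \<in> R" using assms(2) by (intro subring_sum[OF subring]) (auto simp: comps_def)
  finally show ?thesis .
qed

text \<open>Each element is the sum of its components. The opposite inclusion is the hard one;
  \<open>content_mult_mem\<close> supplies it within \<open>whole\<close>.\<close>

lemma frac_inv_comps:
  assumes "X \<subseteq> whole"
  shows "frac_inv R (comps X) \<subseteq> frac_inv R X"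
proof
  fix z assume z: "z \<in> frac_inv R (comps X)"
  have "z * x \<in> R" if "x \<in> X" for x
  proof (rule comps_mult_mem)
    show "x \<in> whole" using that assms by blast
    show "z * c \<in> R" if "c \<in> comps {x}" for c
      using z that \<open>x \<in> X\<close> by (auto simp: frac_inv_def comps_def)
  qed
  then show "z \<in> frac_inv R X" by (simp add: frac_inv_def)
qed

lemma graded_hull:
  assumes "X \<subseteq> whole" "\<And>x \<alpha>. x \<in> X \<Longrightarrow> comp x \<alpha> \<in> submod R hull X"
  shows "graded (submod R hull X)"
proof -
  define M where "M = submod R hull X"
  have sub: "submod R M" unfolding M_def by (rule submod_hull)
  have "M \<subseteq> {x \<in> whole. \<forall>\<alpha>. comp x \<alpha> \<in> M}"
    unfolding M_def
  proof (rule hull_minimal)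
    show "submod R {x \<in> whole. \<forall>\<alpha>. comp x \<alpha> \<in> submod R hull X}"
      unfolding M_def[symmetric] submod_def using sub R_whole R_comp
      by (auto simp: whole_0 comp_0 whole_add comp_add whole_mult comp_mult
          intro!: submod_0 submod_add submod_sum submod_mult)
  qed (use assms in auto)
  then show ?thesis by (auto simp: graded_def M_def)
qed

text \<open>Splitting \<open>B\<close> into components stays inside the graded inverse of
  \<open>A\<close> and enlarges the ideal generated by the products, so the inverse of the products
  can only shrink.\<close>

lemma hom_tinvE:
  assumes A: "tinv R A" "\<And>a. a \<in> A \<Longrightarrow> hom a" "\<not> A \<subseteq> {0}"
  obtains B where "finite B" "\<And>b. b \<in> B \<Longrightarrow> hom b" "B \<subseteq> frac_inv R A" "frac_inv R (products A B) \<subseteq> R"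
proof -
  obtain B where B: "finite B" "B \<subseteq> frac_inv R A" "frac_inv R (products A B) \<subseteq> R"
    using A(1) by (auto simp: tinv_def)
  note g = frac_inv_graded[OF A(2,3)]
  then have W: "B \<subseteq> whole" using B(2) by (auto simp: graded_def)
  have "frac_inv R (products A (comps B)) \<subseteq> frac_inv R (products A B)"
  proof
    fix z assume "z \<in> frac_inv R (products A (comps B))"
    then have "z * a * c \<in> R" if "a \<in> A" "b \<in> B" "c \<in> comps {b}" for a b c
      using that by (auto simp: frac_inv_products_iff comps_def)
    then show "z \<in> frac_inv R (products A B)"
      using W comps_mult_mem unfolding frac_inv_products_iff by blast
  qed
  then show ?thesis
    using that[of "comps B"] B finite_comps comps_hom W comps_subset[OF g B(2)] by blast
qed

definition hom_tinv :: bool where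
  "hom_tinv \<longleftrightarrow> (\<forall>A. finite A \<and> (\<forall>a\<in>A. hom a) \<and> \<not> A \<subseteq> {0} \<longrightarrow> tinv R A)"

text \<open>Take a homogeneous witness \<open>B\<close> for the set of components of
  \<open>f\<close>. A power of each product \<open>b * comp f \<delta>\<close> multiplies
  \<open>x * comp f \<gamma>\<close> into \<open>R\<close>, and the set of these products has
  trivial inverse.\<close>

lemma content_mult_mem:
  assumes "hom_tinv" and x: "x \<in> whole" and f: "f \<in> whole" and xf: "x * f \<in> R"
  shows "x * comp f \<gamma> \<in> R"
proof (cases "f = 0")
  case False
  let ?A = "comps {f}"
  have A: "finite ?A" "\<And>a. a \<in> ?A \<Longrightarrow> hom a" "\<not> ?A \<subseteq> {0}"
    using f False by (auto simp: finite_comps comps_nonzero intro: comps_hom[of "{f}"])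
  then have "tinv R ?A" using assms(1) unfolding hom_tinv_def by blast
  then obtain B where B: "finite B" "\<And>b. b \<in> B \<Longrightarrow> hom b" "B \<subseteq> frac_inv R ?A"
    "frac_inv R (products ?A B) \<subseteq> R"
    using hom_tinvE A(2,3) by metis
  have bf: "b * comp f \<delta> \<in> R" if "b \<in> B" for b \<delta>
    using B(3) that subring_0[OF subring]
    by (cases "\<delta> \<in> supp f") (auto simp: frac_inv_def comps_def supp_def)
  have "\<exists>n. (a * b) ^ n * (x * comp f \<gamma>) \<in> R" if a: "a \<in> ?A" and b: "b \<in> B" for a b
  proof -
    obtain \<delta> where \<delta>: "a = comp f \<delta>" using a by (auto simp: comps_def)
    obtain \<beta> where \<beta>: "b \<in> K \<beta>" using B(2)[OF b] by (auto simp: hom_def)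
    \<comment> \<open>The choice of \<open>b R\<close> instead of \<open>R\<close> gains a factor
      \<open>b\<close>, which turns \<open>comp f \<gamma>\<close>, possibly outside
      \<open>R\<close>, into \<open>b * comp f \<gamma>\<close>, which lies in
      \<open>R\<close>.\<close>
    let ?M = "(*) b ` R"
    note bW = comp_mult_hom[OF \<beta>]
    have "\<exists>n. comp (b * f) (\<delta> + \<beta>) ^ n * x \<in> ?M"
    proof (rule component_power_mult)
      show "graded ?M" using bW R_whole R_comp by (auto simp: graded_def)
      show "u - v \<in> ?M" if "u \<in> ?M" "v \<in> ?M" for u v
        using that subring_diff[OF subring] by (auto simp: image_iff simp flip: right_diff_distrib)
      show "0 \<in> ?M" using subring_0[OF subring] by (auto simp: image_iff)
      show "b * f \<in> whole" "x \<in> whole" using bW f x by auto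
      show "x * (b * f) \<in> ?M" using xf by (auto simp: image_iff mult_ac)
      show "comp (b * f) \<alpha> * m \<in> ?M" if "m \<in> ?M" for \<alpha> m
      proof -
        obtain r where r: "r \<in> R" "m = b * r" using \<open>m \<in> ?M\<close> by blast
        have "b * comp f (\<alpha> - \<beta>) * r \<in> R" using bf[OF b] r(1) by (rule subring_mult[OF subring])
        then show ?thesis using r bW(2)[OF f] by (auto simp: image_iff mult_ac)
      qed
    qed
    then obtain n r where n: "(b * comp f \<delta>) ^ n * x = b * r" "r \<in> R"
      using bW(2)[OF f] by auto
    have "(a * b) ^ n * (x * comp f \<gamma>) = (b * comp f \<gamma>) * r"
      using n(1) by (simp add: \<delta> mult_ac)
    then show ?thesis using subring_mult[OF subring bf[OF b] n(2)] by metis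
  qed
  then have "\<forall>y\<in>products ?A B. \<exists>n. y ^ n * (x * comp f \<gamma>) \<in> R" by (auto simp: products_def)
  then show ?thesis
    using frac_inv_powers[OF subring _ _ B(4)] finite_products[OF A(1) B(1)] B(3)
      products_subset_iff by blast
qed (simp add: comp_0 subring_0[OF subring])

text \<open>Invertibility over \<open>whole\<close> reduces the problem to a set whose inverse lies in \<open>whole\<close>, and such
  an inverse only depends on homogeneous components.\<close>

lemma hom_tinv_imp_all_tinv:
  assumes "hom_tinv" "all_tinv whole"
  shows "all_tinv R"
  unfolding all_tinv_def
proof (intro allI impI, elim conjE)
  fix A assume A: "finite A" "A \<subseteq> R" "\<not> A \<subseteq> {0}"
  then have "tinv whole A" using assms(2) R_whole by (auto simp: all_tinv_def)
  then obtain B where B: "finite B" "B \<subseteq> frac_inv whole A" "frac_inv whole (products A B) \<subseteq> whole"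
    and E0: "\<not> products A B \<subseteq> {0}"
    using tinvE[OF subring_whole _ A(3)] by blast
  let ?E = "products A B"
  have E: "finite ?E" "?E \<subseteq> whole"
    using finite_products[OF A(1) B(1)] B(2) products_subset_iff by blast+
  let ?C = "comps ?E"
  have C: "finite ?C" "\<And>c. c \<in> ?C \<Longrightarrow> hom c" "\<not> ?C \<subseteq> {0}"
    using E E0 finite_comps comps_hom comps_nonzero by blast+
  then have "tinv R ?C" using assms(1) unfolding hom_tinv_def by blast
  then obtain B1 where B1: "finite B1" "\<And>b. b \<in> B1 \<Longrightarrow> hom b" "B1 \<subseteq> frac_inv R ?C"
    "frac_inv R (products ?C B1) \<subseteq> R"
    using hom_tinvE C(2,3) by metis
  have cb: "e * b \<in> R" if "e \<in> ?E" "b \<in> B1" for e b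
  proof -
    have "b * c \<in> R" if "c \<in> comps {e}" for c
      using that \<open>e \<in> ?E\<close> \<open>b \<in> B1\<close> B1(3) by (auto simp: frac_inv_def comps_def)
    then have "b * e \<in> R" using comps_mult_mem[of e b] that E(2) by blast
    then show ?thesis by (simp add: mult.commute)
  qed
  \<comment> \<open>This is the witness for \<open>A\<close>: its products with \<open>A\<close> are
    the products of \<open>?E\<close> with \<open>B1\<close>.\<close>
  have "products B B1 \<subseteq> frac_inv R A"
  proof -
    have "b * b1 * a \<in> R" if "a \<in> A" "b \<in> B" "b1 \<in> B1" for a b b1
      using cb[OF products_memI[OF that(1,2)] that(3)] by (simp add: mult_ac)
    then show ?thesis by (auto simp: products_def frac_inv_def)
  qed
  moreover have "frac_inv R (products A (products B B1)) \<subseteq> R"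
  proof
    fix x assume "x \<in> frac_inv R (products A (products B B1))"
    then have x: "x * b * e \<in> R" if "e \<in> ?E" "b \<in> B1" for e b
    proof -
      obtain a b0 where e: "e = a * b0" "a \<in> A" "b0 \<in> B"
        using \<open>e \<in> ?E\<close> by (auto simp: products_def)
      then have "x * a * (b0 * b) \<in> R"
        using \<open>x \<in> _\<close> \<open>b \<in> B1\<close> products_memI[of b0 B b B1] by (auto simp: frac_inv_products_iff)
      then show ?thesis by (simp add: e mult_ac)
    qed
    \<comment> \<open>Invertibility over \<open>whole\<close> is used here: \<open>x * b\<close>
      multiplies \<open>?E\<close> into \<open>R\<close>, and the inverse of \<open>?E\<close> over
      \<open>whole\<close> is trivial. Only now can the components of \<open>?E\<close> be
      separated.\<close>
    have "x * b \<in> whole" if "b \<in> B1" for b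
    proof -
      have "x * b \<in> frac_inv whole ?E" using x[OF _ that] R_whole by (auto simp: frac_inv_def)
      then show ?thesis using B(3) by blast
    qed
    then have "x * b * comp e \<gamma> \<in> R" if "e \<in> ?E" "b \<in> B1" for e b \<gamma>
      using content_mult_mem[OF assms(1), of "x * b" e] x that E by blast
    then have "x \<in> frac_inv R (products ?C B1)"
      by (auto simp: frac_inv_products_iff comps_def mult_ac)
    then show "x \<in> R" using B1(4) by blast
  qed
  ultimately show "tinv R A" unfolding tinv_def using finite_products[OF B(1) B1(1)] by blast
qed

end

section \<open>Laurent polynomials over a field\<close>

definition subfield :: "'k::field set \<Rightarrow> bool" where
  "subfield F \<longleftrightarrow> is_subring F \<and> (\<forall>x\<in>F. inverse x \<in> F)"

lemma subfield_all_tinv: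
  assumes "subfield F"
  shows "all_tinv F"
  unfolding all_tinv_def
proof (intro allI impI, elim conjE)
  fix A assume A: "finite A" "A \<subseteq> F" "\<not> A \<subseteq> {0}"
  have F: "is_subring F" "\<And>x. x \<in> F \<Longrightarrow> inverse x \<in> F" using assms by (auto simp: subfield_def)
  obtain a where a: "a \<in> A" "a \<noteq> 0" using A by auto
  have "{inverse a} \<subseteq> frac_inv F A"
    using a A F by (auto simp: frac_inv_def intro!: subring_mult)
  moreover have "frac_inv F (products A {inverse a}) \<subseteq> F"
  proof
    fix z assume "z \<in> frac_inv F (products A {inverse a})"
    then have "z * a * inverse a \<in> F" using a unfolding frac_inv_products_iff by blast
    then show "z \<in> F" using a by (simp add: mult.assoc)
  qed
  ultimately show "tinv F A" unfolding tinv_def by blast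
qed

definition coeffs_in :: "'k::field set \<Rightarrow> 'k poly \<Rightarrow> bool" where
  "coeffs_in F p \<longleftrightarrow> (\<forall>i. coeff p i \<in> F)"

lemma coeffs_in_add: "is_subring F \<Longrightarrow> coeffs_in F p \<Longrightarrow> coeffs_in F q \<Longrightarrow> coeffs_in F (p + q)"
  and coeffs_in_diff: "is_subring F \<Longrightarrow> coeffs_in F p \<Longrightarrow> coeffs_in F q \<Longrightarrow> coeffs_in F (p - q)"
  and coeffs_in_mult: "is_subring F \<Longrightarrow> coeffs_in F p \<Longrightarrow> coeffs_in F q \<Longrightarrow> coeffs_in F (p * q)"
  and coeffs_in_monom: "is_subring F \<Longrightarrow> c \<in> F \<Longrightarrow> coeffs_in F (monom c n)"
  by (auto simp: coeffs_in_def coeff_mult intro!: subring_add subring_diff subring_sum subring_mult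
      subring_0)

text \<open>Repeated cancellation of the leading term, which needs only inverses in
  \<open>F\<close>; the coefficients thus stay in \<open>F\<close> although the polynomials range
  over the larger field.\<close>

lemma coeffs_in_division:
  assumes F: "subfield F" and q: "coeffs_in F q" "q \<noteq> 0" and p: "coeffs_in F p"
  shows "\<exists>s r. coeffs_in F s \<and> coeffs_in F r \<and> p = q * s + r \<and> (r = 0 \<or> degree r < degree q)"
proof -
  have subF: "is_subring F" using F by (simp add: subfield_def)
  have "\<exists>s r. coeffs_in F s \<and> coeffs_in F r \<and> p = q * s + r \<and> (r = 0 \<or> degree r < degree q)"
    if "coeffs_in F p" "degree p < n" for p n
    using that
  proof (induction n arbitrary: p)
    case (Suc n)
    have zero: "coeffs_in F 0" using subF by (simp add: coeffs_in_def subring_0)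
    show ?case
    proof (cases "p = 0 \<or> degree p < degree q")
      case True
      then show ?thesis using Suc.prems zero by (intro exI[of _ 0] exI[of _ p]) auto
    next
      case False
      define m where "m = monom (lead_coeff p * inverse (lead_coeff q)) (degree p - degree q)"
      have m: "coeffs_in F m" unfolding m_def
        using F Suc.prems q subF by (intro coeffs_in_monom subring_mult) (auto simp: subfield_def coeffs_in_def)
      have m0: "m \<noteq> 0" using False q by (simp add: m_def monom_eq_0_iff)
      define p' where "p' = p - q * m"
      have p': "coeffs_in F p'" unfolding p'_def by (intro coeffs_in_diff coeffs_in_mult subF m q Suc.prems)
      have deg: "degree (q * m) = degree p" using False q m0
        by (simp add: degree_mult_eq) (simp add: m_def degree_monom_eq)
      moreover have "lead_coeff (q * m) = lead_coeff p"
        using False q by (simp add: lead_coeff_mult) (simp add: m_def degree_monom_eq)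
      ultimately have "coeff p' (degree p) = 0" by (simp add: p'_def)
      moreover have "degree p' \<le> degree p" unfolding p'_def using deg by (intro degree_diff_le) auto
      ultimately have "p' = 0 \<or> degree p' < degree p" by (metis leading_coeff_0_iff le_neq_implies_less)
      then have "\<exists>s r. coeffs_in F s \<and> coeffs_in F r \<and> p' = q * s + r \<and> (r = 0 \<or> degree r < degree q)"
      proof
        assume "p' = 0"
        then show ?thesis using zero by (intro exI[of _ 0]) auto
      next
        assume "degree p' < degree p"
        then show ?thesis using Suc.prems by (intro Suc.IH p') auto
      qed
      then obtain s r where "coeffs_in F s" "coeffs_in F r" "p' = q * s + r" "r = 0 \<or> degree r < degree q"
        by blast
      moreover from this have "coeffs_in F (s + m)" "p = q * (s + m) + r"
        using coeffs_in_add[OF subF, of s m] m by (simp_all add: p'_def algebra_simps)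
      ultimately show ?thesis by blast
    qed
  qed simp
  then show ?thesis using p by blast
qed

text \<open>Membership is tested by clearing a power of \<open>u\<close>, which leaves ordinary
  polynomials for Euclidean division.\<close>

definition laurent :: "'k::field set \<Rightarrow> 'k \<Rightarrow> 'k set" where
  "laurent F u = {x. \<exists>p m. coeffs_in F p \<and> x * u ^ m = poly p u}"

lemma laurent_poly: "coeffs_in F p \<Longrightarrow> poly p u \<in> laurent F u"
  unfolding laurent_def by (auto intro!: exI[of _ p] exI[of _ "0 :: nat"])

lemma laurent_power_cancel:
  assumes "x * u ^ n \<in> laurent F u"
  shows "x \<in> laurent F u"
proof -
  obtain p m where "coeffs_in F p" "x * u ^ n * u ^ m = poly p u"
    using assms by (auto simp: laurent_def)
  then show ?thesis unfolding laurent_def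
    by (auto intro!: exI[of _ p] exI[of _ "n + m"] simp: power_add mult.assoc)
qed

lemma subring_laurent:
  assumes F: "is_subring F"
  shows "is_subring (laurent F u)"
  unfolding is_subring_def
proof (intro conjI ballI)
  show "1 \<in> laurent F u" using laurent_poly[of F "monom 1 0" u] coeffs_in_monom[OF F subring_1[OF F], of 0]
    by (simp add: poly_monom)
  fix x y assume "x \<in> laurent F u" "y \<in> laurent F u"
  then obtain p m q n where p: "coeffs_in F p" "x * u ^ m = poly p u"
    and q: "coeffs_in F q" "y * u ^ n = poly q u" by (auto simp: laurent_def)
  have mon: "coeffs_in F (monom 1 k)" for k using F by (simp add: coeffs_in_monom subring_1)
  have "coeffs_in F (p * monom 1 n - q * monom 1 m)"
    using F p q mon by (intro coeffs_in_diff coeffs_in_mult)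
  moreover have "(x - y) * u ^ (m + n) = poly (p * monom 1 n - q * monom 1 m) u"
    unfolding poly_diff poly_mult poly_monom p(2)[symmetric] q(2)[symmetric]
    by (simp add: power_add algebra_simps)
  ultimately show "x - y \<in> laurent F u" unfolding laurent_def by blast
  have "coeffs_in F (p * q)" "x * y * u ^ (m + n) = poly (p * q) u"
    using F p q by (simp_all add: coeffs_in_mult power_add mult_ac flip: p(2) q(2))
  then show "x * y \<in> laurent F u" unfolding laurent_def by blast
qed

text \<open>Division with remainder shows that the ideal is principal, generated by the value of a
  polynomial of least degree, and the inverse of a nonzero generator is a witness.\<close>

lemma laurent_all_tinv:
  assumes F: "subfield F" and u: "u \<noteq> 0"
  shows "all_tinv (laurent F u)"
  unfolding all_tinv_def
proof (intro allI impI, elim conjE)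
  let ?L = "laurent F u"
  fix A assume A: "finite A" "A \<subseteq> ?L" "\<not> A \<subseteq> {0}"
  have subF: "is_subring F" using F by (simp add: subfield_def)
  note L = subring_laurent[OF subF, of u]
  define I where "I = submod ?L hull A"
  have I: "submod ?L I" "A \<subseteq> I" by (simp_all add: I_def submod_hull hull_subset)
  have IL: "I \<subseteq> ?L" unfolding I_def using L A(2) by (rule hull_subset_ring)
  \<comment> \<open>The value at \<open>u\<close>, not only the polynomial, has to be nonzero:
    different polynomials may agree at \<open>u\<close>.\<close>
  define good where "good p \<longleftrightarrow> coeffs_in F p \<and> poly p u \<in> I \<and> poly p u \<noteq> 0" for p
  obtain a where a: "a \<in> A" "a \<noteq> 0" using A by auto
  have upow: "u ^ m \<in> ?L" for m
    using laurent_poly[of F "monom 1 m" u] subF by (simp add: coeffs_in_monom poly_monom subring_1)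
  have "a \<in> ?L" using A a by blast
  then obtain p0 m where p0: "coeffs_in F p0" "a * u ^ m = poly p0 u"
    by (auto simp: laurent_def)
  have "u ^ m * a \<in> I" using submod_mult[OF I(1) upow] a I(2) by blast
  then have "good p0" using p0 a u unfolding good_def
    by (metis mult.commute mult_eq_0_iff power_not_zero)
  then obtain p where p: "good p" and min: "\<And>q. good q \<Longrightarrow> degree p \<le> degree q"
    using ex_has_least_nat[of good p0 degree] by blast
  define h where "h = poly p u"
  have h: "h \<in> I" "h \<noteq> 0" using p by (auto simp: h_def good_def)
  have div: "b * inverse h \<in> ?L" if "b \<in> I" for b
  proof -
    obtain q m where q: "coeffs_in F q" "b * u ^ m = poly q u"
      using \<open>b \<in> I\<close> IL by (auto simp: laurent_def)
    have "p \<noteq> 0" using p by (auto simp: good_def)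
    then obtain s r where s: "coeffs_in F s" and r: "coeffs_in F r" "r = 0 \<or> degree r < degree p"
      and q_eq: "q = p * s + r"
      using coeffs_in_division[OF F _ _ q(1), of p] p by (auto simp: good_def)
    have "poly r u = u ^ m * b + - poly s u * h"
      using q by (simp add: q_eq h_def algebra_simps)
    also have "\<dots> \<in> I"
      using laurent_poly[OF s] upow that h(1) L
      by (intro submod_add[OF I(1)] submod_mult[OF I(1)] subring_uminus) auto
    finally have "poly r u \<in> I" .
    then have "poly r u = 0" using r min[of r] unfolding good_def by (metis not_le poly_0)
    then have "b * inverse h * u ^ m = poly s u"
      using q h by (simp add: q_eq flip: h_def) (simp add: field_simps)
    then show ?thesis using s by (auto simp: laurent_def)
  qed
  have "{inverse h} \<subseteq> frac_inv ?L A"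
    using div I(2) by (auto simp: frac_inv_def mult.commute)
  moreover have "frac_inv ?L (products A {inverse h}) \<subseteq> ?L"
  proof
    fix z assume "z \<in> frac_inv ?L (products A {inverse h})"
    then have "z * a * inverse h \<in> ?L" if "a \<in> A" for a
      using that unfolding frac_inv_products_iff by blast
    then have "z * inverse h \<in> frac_inv ?L A" by (simp add: frac_inv_def mult_ac)
    then have "z * inverse h \<in> frac_inv ?L I" by (simp add: I_def frac_inv_hull[OF L])
    then have "z * inverse h * h \<in> ?L" using h by (auto simp: frac_inv_def)
    then show "z \<in> ?L" using h by (simp add: mult.assoc)
  qed
  ultimately show "tinv ?L A" unfolding tinv_def by blast
qed

lemma unique_sums_int: "unique_sums TYPE(int)"
proof (rule torsion_free_unique_sums)
  have "zm (int n) x = int n * x" for n and x :: int by (simp add: zm_int)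
  then have "zm k x = k * x" for k x :: int
    by (cases k rule: int_diff_cases) (simp only: zm_int_diff flip: zm_int, simp add: left_diff_distrib)
  then show "torsion_free TYPE(int)" by (simp add: torsion_free_def)
qed

section \<open>Graded fields have invertible finitely generated ideals\<close>

text \<open>Euclid's algorithm on the coefficients of a relation, with the sum of their absolute
  values as measure. When one nonzero coefficient is left, torsion-freeness kills its generator.
  This is how freeness of finitely generated torsion-free groups enters.\<close>

lemma span_reduce:
  fixes x :: "nat \<Rightarrow> 'g::ab_group_add"
  assumes tf: "torsion_free TYPE('g)"
    and "(\<Sum>i<Suc n. zm (a i) (x i)) = 0" and "\<exists>i<Suc n. a i \<noteq> 0"
  shows "\<exists>y. zm.span (y ` {..<n}) = zm.span (x ` {..<Suc n})"
  using assms(2,3)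
proof (induction "nat (\<Sum>i<Suc n. \<bar>a i\<bar>)" arbitrary: a x rule: less_induct)
  case less
  obtain i where i: "i < Suc n" "a i \<noteq> 0" using less.prems by blast
  show ?case
  proof (cases "\<exists>j<Suc n. j \<noteq> i \<and> a j \<noteq> 0")
    case False
    have "zm (a j) (x j) = (if j = i then zm (a i) (x i) else 0)" if "j < Suc n" for j
      using False that by auto
    then have "(\<Sum>j<Suc n. zm (a j) (x j)) = (\<Sum>j<Suc n. if j = i then zm (a i) (x i) else 0)"
      by (intro sum.cong) auto
    then have "zm (a i) (x i) = 0"
      using less.prems(1) i by (simp add: sum.delta del: sum.lessThan_Suc)
    then have xi: "x i = 0" using tf i unfolding torsion_free_def by blast
    \<comment> \<open>The last generator takes the place of the vanishing \<open>x i\<close>; for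
      \<open>i = n\<close> the update falls outside the range and \<open>x n\<close> itself is
      dropped.\<close>
    have "insert 0 ((x(i := x n)) ` {..<n}) = x ` {..<Suc n}"
      using i(1) xi by (auto simp: less_Suc_eq image_iff)
    then have "zm.span (x ` {..<Suc n}) = zm.span (insert 0 ((x(i := x n)) ` {..<n}))" by simp
    also have "\<dots> = zm.span ((x(i := x n)) ` {..<n})"
      unfolding zm.span_insert by simp
    finally show ?thesis by metis
  next
    case True
    then obtain j where j: "j < Suc n" "j \<noteq> i" "a j \<noteq> 0" by blast
    have *: ?thesis if ij: "i < Suc n" "j < Suc n" "i \<noteq> j" "a i \<noteq> 0" "a j \<noteq> 0" "\<bar>a j\<bar> \<le> \<bar>a i\<bar>" for i j
    proof -
      \<comment> \<open>The relation is rewritten by a_i x_i + a_j x_j = (a_i - \<sigma> a_j) x_i +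
        a_j (x_j + \<sigma> x_i), with the sign chosen so that the first coefficient
        shrinks.\<close>
      define \<sigma> where "\<sigma> = sgn (a i) * sgn (a j)"
      define a' where "a' = a(i := a i - \<sigma> * a j)"
      define x' where "x' = x(j := x j + zm \<sigma> (x i))"
      have abs: "\<bar>a i - \<sigma> * a j\<bar> < \<bar>a i\<bar>"
        using ij(4-6) by (cases "a i > 0"; cases "a j > 0") (auto simp: \<sigma>_def sgn_if)
      have "(\<Sum>k<Suc n. \<bar>a' k\<bar>) < (\<Sum>k<Suc n. \<bar>a k\<bar>)"
      proof (rule sum_strict_mono_ex1)
        show "\<forall>k\<in>{..<Suc n}. \<bar>a' k\<bar> \<le> \<bar>a k\<bar>" using abs by (simp add: a'_def)
        show "\<exists>k\<in>{..<Suc n}. \<bar>a' k\<bar> < \<bar>a k\<bar>"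
          using abs ij(1) by (intro bexI[of _ i]) (simp_all add: a'_def)
      qed simp
      moreover have "0 \<le> (\<Sum>k<Suc n. \<bar>a' k\<bar>)" by (intro sum_nonneg) auto
      ultimately have less': "nat (\<Sum>k<Suc n. \<bar>a' k\<bar>) < nat (\<Sum>k<Suc n. \<bar>a k\<bar>)" by linarith
      let ?w = "zm (\<sigma> * a j) (x i)"
      have "zm (a' k) (x' k) = zm (a k) (x k) + ((if k = j then ?w else 0) - (if k = i then ?w else 0))" for k
        using ij by (auto simp: a'_def x'_def zm.scale_left_diff_distrib zm.scale_right_distrib mult.commute)
      then have "(\<Sum>k<Suc n. zm (a' k) (x' k)) = (\<Sum>k<Suc n. zm (a k) (x k)) +
          ((\<Sum>k<Suc n. if k = j then ?w else 0) - (\<Sum>k<Suc n. if k = i then ?w else 0))"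
        by (simp only: sum.distrib sum_subtractf)
      also have "\<dots> = 0" using ij less.prems(1) by (simp only: sum.delta finite_lessThan) simp
      finally have rel: "(\<Sum>k<Suc n. zm (a' k) (x' k)) = 0" .
      have nz: "\<exists>k<Suc n. a' k \<noteq> 0" using ij by (auto simp: a'_def intro!: exI[of _ j])
      have "zm.span (x' ` {..<Suc n}) = zm.span (x ` {..<Suc n})"
      proof (rule antisym; rule zm.span_minimal)
        have mem: "x k \<in> zm.span (x ` {..<Suc n})" "x' k \<in> zm.span (x' ` {..<Suc n})" if "k < Suc n" for k
          using that by (auto intro!: zm.span_base)
        show "x' ` {..<Suc n} \<subseteq> zm.span (x ` {..<Suc n})"
          using mem(1) ij by (auto simp: x'_def intro!: zm.span_add zm.span_scale)
        have "x j = x' j - zm \<sigma> (x' i)" using ij by (simp add: x'_def)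
        also have "\<dots> \<in> zm.span (x' ` {..<Suc n})" using ij mem(2) by (intro zm.span_diff zm.span_scale) auto
        finally have xj: "x j \<in> zm.span (x' ` {..<Suc n})" .
        have "x k \<in> zm.span (x' ` {..<Suc n})" if "k < Suc n" for k
          using xj mem(2)[OF that] by (cases "k = j") (auto simp: x'_def)
        then show "x ` {..<Suc n} \<subseteq> zm.span (x' ` {..<Suc n})" by blast
      qed (rule zm.subspace_span)+
      then show ?thesis using less.hyps[OF less' rel nz] by (simp only:)
    qed
    show ?thesis
    proof (cases "\<bar>a j\<bar> \<le> \<bar>a i\<bar>")
      case True
      then show ?thesis using i j by (intro *[of i j]) (simp_all only: not_False_eq_True)
    next
      case False
      then have "\<bar>a i\<bar> \<le> \<bar>a j\<bar>" by linarith
      then show ?thesis using i j(1,3) j(2)[symmetric] by (intro *[of j i]) (simp_all only: not_False_eq_True)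
    qed
  qed
qed

lemma span_image_coefficients:
  fixes x :: "nat \<Rightarrow> 'g::ab_group_add"
  assumes "y \<in> zm.span (x ` {..<n})"
  shows "\<exists>a. y = (\<Sum>i<n. zm (a i) (x i))"
proof -
  let ?U = "{y. \<exists>a. y = (\<Sum>i<n. zm (a i) (x i))}"
  have "zm.span (x ` {..<n}) \<subseteq> ?U"
  proof (rule zm.span_minimal)
    show "x ` {..<n} \<subseteq> ?U"
    proof (safe)
      fix i assume "i < n"
      have "zm (if k = i then 1 else 0) (x k) = (if k = i then x i else 0)" for k by simp
      then have "x i = (\<Sum>k<n. zm (if k = i then 1 else 0) (x k))" using \<open>i < n\<close> by simp
      then show "\<exists>a. x i = (\<Sum>k<n. zm (a k) (x k))" by (rule exI[of _ "\<lambda>k. if k = i then 1 else 0"])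
    qed
    show "zm.subspace ?U" unfolding zm.subspace_def
    proof (safe)
      show "\<exists>a. 0 = (\<Sum>i<n. zm (a i) (x i))" by (rule exI[of _ "\<lambda>_. 0"]) simp
      show "\<exists>c. (\<Sum>i<n. zm (a i) (x i)) + (\<Sum>i<n. zm (b i) (x i)) = (\<Sum>i<n. zm (c i) (x i))" for a b
        by (rule exI[of _ "\<lambda>i. a i + b i"]) (simp add: zm.scale_left_distrib sum.distrib)
      show "\<exists>b. zm c (\<Sum>i<n. zm (a i) (x i)) = (\<Sum>i<n. zm (b i) (x i))" for c a
        by (rule exI[of _ "\<lambda>i. c * a i"]) (simp add: zm.scale_sum_right)
    qed
  qed
  then show ?thesis using assms by blast
qed

section \<open>Restriction of a graded field to a subgroup of degrees\<close>

context graded_field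
begin

definition support_ring :: "'g set \<Rightarrow> 'k set" where
  "support_ring X = {f \<in> whole. supp f \<subseteq> X}"

lemma support_ring_mono: "X \<subseteq> Y \<Longrightarrow> support_ring X \<subseteq> support_ring Y"
  by (auto simp: support_ring_def)

lemma support_ring_UNIV: "support_ring UNIV = whole"
  by (auto simp: support_ring_def)

lemma K_support_ring: "h \<in> K \<alpha> \<Longrightarrow> \<alpha> \<in> X \<Longrightarrow> h \<in> support_ring X"
  by (auto simp: support_ring_def supp_def K_whole comp_K split: if_splits)

lemma subring_support_ring:
  assumes X: "zm.subspace X"
  shows "is_subring (support_ring X)"
  unfolding is_subring_def
proof (intro conjI ballI)
  show "1 \<in> support_ring X" using K_support_ring[OF K_one] zm.subspace_0[OF X] by blast
  fix f g assume f: "f \<in> support_ring X" and g: "g \<in> support_ring X"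
  then have "supp (f - g) \<subseteq> supp f \<union> supp g" by (auto simp: support_ring_def supp_def comp_diff)
  then show "f - g \<in> support_ring X"
    using f g whole_diff by (auto simp: support_ring_def)
  show "f * g \<in> support_ring X"
    unfolding support_ring_def
  proof (intro CollectI conjI subsetI)
    show "f * g \<in> whole" using f g by (auto simp: support_ring_def whole_mult)
    fix \<alpha> assume "\<alpha> \<in> supp (f * g)"
    then have "(\<Sum>\<beta>\<in>supp f. comp f \<beta> * comp g (\<alpha> - \<beta>)) \<noteq> 0"
      using f g by (simp add: supp_def support_ring_def comp_mult)
    then obtain \<beta> where "\<beta> \<in> supp f" "comp f \<beta> * comp g (\<alpha> - \<beta>) \<noteq> 0"
      by (rule sum.not_neutral_contains_not_neutral)
    then have "\<beta> \<in> X" "\<alpha> - \<beta> \<in> X" using f g by (auto simp: support_ring_def supp_def)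
    then show "\<alpha> \<in> X" using zm.subspace_add[OF X, of \<beta> "\<alpha> - \<beta>"] by simp
  qed
qed

definition coset_part :: "'g set \<Rightarrow> 'g \<Rightarrow> 'k \<Rightarrow> 'k" where
  "coset_part X \<gamma> f = (\<Sum>\<alpha> | \<alpha> \<in> supp f \<and> \<alpha> - \<gamma> \<in> X. comp f \<alpha>)"

lemma coset_part_whole: "f \<in> whole \<Longrightarrow> coset_part X \<gamma> f \<in> whole"
  and comp_coset_part: "f \<in> whole \<Longrightarrow>
    comp (coset_part X \<gamma> f) \<alpha> = (if \<alpha> - \<gamma> \<in> X then comp f \<alpha> else 0)"
proof -
  assume f: "f \<in> whole"
  have fin: "finite {\<alpha>. \<alpha> \<in> supp f \<and> \<alpha> - \<gamma> \<in> X}" using finite_supp[OF f] by simp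
  show "coset_part X \<gamma> f \<in> whole"
    unfolding coset_part_def using fin comp_in_K[OF f] by (rule sum_in_whole)
  show "comp (coset_part X \<gamma> f) \<alpha> = (if \<alpha> - \<gamma> \<in> X then comp f \<alpha> else 0)"
    unfolding coset_part_def by (subst comp_sum_K[OF fin comp_in_K[OF f]]) (auto simp: supp_def)
qed

lemma whole_eqI: "x \<in> whole \<Longrightarrow> y \<in> whole \<Longrightarrow> (\<And>\<alpha>. comp x \<alpha> = comp y \<alpha>) \<Longrightarrow> x = y"
  using supp_eq_empty_iff[OF whole_diff] by (auto simp: supp_def comp_diff)

text \<open>Degrees in \<open>X\<close> do not move cosets of \<open>X\<close>, so the projection
  onto a coset is linear over \<open>support_ring X\<close>.\<close>

lemma coset_part_mult:
  assumes X: "zm.subspace X" and e: "e \<in> support_ring X" and f: "f \<in> whole"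
  shows "coset_part X \<gamma> (e * f) = e * coset_part X \<gamma> f"
proof (rule whole_eqI)
  have eW: "e \<in> whole" using e by (simp add: support_ring_def)
  note W = whole_mult[OF eW f] coset_part_whole[OF f]
  show "coset_part X \<gamma> (e * f) \<in> whole" using W by (simp add: coset_part_whole)
  show "e * coset_part X \<gamma> f \<in> whole" using W eW by (simp add: whole_mult)
  fix \<alpha>
  have "\<alpha> - \<beta> - \<gamma> \<in> X \<longleftrightarrow> \<alpha> - \<gamma> \<in> X" if "\<beta> \<in> supp e" for \<beta>
  proof -
    have "\<beta> \<in> X" using that e by (auto simp: support_ring_def)
    then show ?thesis
      using zm.subspace_add[OF X, of "\<alpha> - \<beta> - \<gamma>" \<beta>] zm.subspace_diff[OF X, of "\<alpha> - \<gamma>" \<beta>]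
      by (auto simp: algebra_simps)
  qed
  then show "comp (coset_part X \<gamma> (e * f)) \<alpha> = comp (e * coset_part X \<gamma> f) \<alpha>"
    using W eW f by (simp add: comp_coset_part comp_mult)
qed

text \<open>\<open>support_ring Y\<close> is a free module over \<open>support_ring X\<close> on a choice of homogeneous elements,
  one for each coset.\<close>

lemma support_ring_frac_inv:
  assumes X: "zm.subspace X" and Y: "zm.subspace Y" and XY: "X \<subseteq> Y"
    and E: "E \<subseteq> support_ring X" "\<not> E \<subseteq> {0}" "frac_inv (support_ring X) E \<subseteq> support_ring X"
  shows "frac_inv (support_ring Y) E \<subseteq> support_ring Y"
proof
  let ?D = "support_ring X" and ?T = "support_ring Y"
  note D = subring_support_ring[OF X] and T = subring_support_ring[OF Y]
  have DT: "?D \<subseteq> ?T" using XY by (rule support_ring_mono)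
  have TW: "f \<in> whole" if "f \<in> ?T" for f using that by (simp add: support_ring_def)
  obtain c where c: "c \<in> E" "c \<noteq> 0" using E by auto
  have cD: "c \<in> ?D" using c E by blast
  \<comment> \<open>The claim is applied to \<open>s = z * c\<close>, which lies in
    \<open>?T\<close> and has a finite support for the induction; \<open>z\<close> itself is not yet
    known to lie in \<open>whole\<close>.\<close>
  have main: "inverse c * s \<in> ?T" if "s \<in> ?T" "\<forall>e\<in>E. \<exists>t\<in>?T. e * s = c * t" for s
    using that
  proof (induction "card (supp s)" arbitrary: s rule: less_induct)
    case less
    note sW = TW[OF less.prems(1)]
    show ?case
    proof (cases "s = 0")
      case True
      then show ?thesis using T by (simp add: subring_0)
    next
      case False
      then obtain \<gamma> where \<gamma>: "\<gamma> \<in> supp s" using supp_eq_empty_iff[OF sW] by blast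
      \<comment> \<open>The homogeneous unit \<open>v\<close> carries the part of \<open>s\<close>
        in the coset of \<open>\<gamma>\<close> back into \<open>support_ring X\<close>, where the
        hypothesis on \<open>E\<close> applies. Removing that part shrinks the support.\<close>
      define v where "v = comp s \<gamma>"
      define r where "r = coset_part X \<gamma> s"
      have vK: "v \<in> K \<gamma>" "v \<noteq> 0" using comp_in_K[OF sW] \<gamma> by (auto simp: v_def supp_def)
      have \<gamma>Y: "\<gamma> \<in> Y" using \<gamma> less.prems(1) by (auto simp: support_ring_def)
      have part: "coset_part X \<gamma> f \<in> ?T" if "f \<in> ?T" for f
        using that by (auto simp: support_ring_def supp_def coset_part_whole comp_coset_part)
      have quot: "inverse v * coset_part X \<gamma> f \<in> ?D" if "f \<in> ?T" for f
      proof -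
        note m = comp_mult_hom[OF K_inverse[OF vK(1)] coset_part_whole[OF TW[OF that], of X \<gamma>]]
        have "comp (inverse v * coset_part X \<gamma> f) \<alpha> = 0" if "\<alpha> \<notin> X" for \<alpha>
          using \<open>\<alpha> \<notin> X\<close> by (simp add: m(2) comp_coset_part[OF TW[OF \<open>f \<in> ?T\<close>]])
        then show ?thesis using m(1) unfolding support_ring_def supp_def by blast
      qed
      have re: "\<exists>t\<in>?T. e * r = c * coset_part X \<gamma> t \<and> e * s = c * t" if "e \<in> E" for e
      proof -
        obtain t where t: "t \<in> ?T" "e * s = c * t" using less.prems(2) \<open>e \<in> E\<close> by blast
        have "e * r = coset_part X \<gamma> (e * s)"
          unfolding r_def using subsetD[OF E(1) that] sW by (rule coset_part_mult[OF X, symmetric])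
        also have "\<dots> = c * coset_part X \<gamma> t"
          unfolding t(2) using cD TW[OF t(1)] by (rule coset_part_mult[OF X])
        finally show ?thesis using t by blast
      qed
      have "inverse v * inverse c * r \<in> frac_inv ?D E" unfolding frac_inv_def
      proof (safe)
        fix e assume "e \<in> E"
        then obtain t where t: "t \<in> ?T" "e * r = c * coset_part X \<gamma> t" using re by blast
        have "inverse v * inverse c * r * e = inverse v * coset_part X \<gamma> t"
        proof -
          have "inverse v * inverse c * r * e = inverse v * (inverse c * (e * r))" by (simp add: mult_ac)
          then show ?thesis unfolding t(2) using c by (simp flip: mult.assoc)
        qed
        then show "inverse v * inverse c * r * e \<in> ?D" using quot[OF t(1)] by (simp only:)
      qed
      then have "inverse v * inverse c * r \<in> ?T" using E(3) DT by blast
      then have "v * (inverse v * inverse c * r) \<in> ?T"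
        using subring_mult[OF T K_support_ring[OF vK(1) \<gamma>Y]] by blast
      moreover have "v * (inverse v * inverse c * r) = (v * inverse v) * (inverse c * r)"
        by (simp only: mult_ac)
      ultimately have r1: "inverse c * r \<in> ?T" using vK by simp
      have rT: "r \<in> ?T" unfolding r_def using less.prems(1) by (rule part)
      have "inverse c * (s - r) \<in> ?T"
      proof (rule less.hyps)
        have "supp (s - r) \<subseteq> supp s - {\<gamma>}"
          using sW zm.subspace_0[OF X]
          by (auto simp: r_def supp_def comp_diff coset_part_whole comp_coset_part split: if_splits)
        then show "card (supp (s - r)) < card (supp s)"
          using \<gamma> finite_supp[OF sW] by (meson card_Diff1_less card_mono finite_Diff le_less_trans)
        show "s - r \<in> ?T" using T less.prems(1) rT by (rule subring_diff)
        show "\<forall>e\<in>E. \<exists>t\<in>?T. e * (s - r) = c * t"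
        proof
          fix e assume "e \<in> E"
          then obtain t where t: "t \<in> ?T" "e * r = c * coset_part X \<gamma> t" "e * s = c * t" using re by blast
          then show "\<exists>t\<in>?T. e * (s - r) = c * t"
            using subring_diff[OF T t(1) part[OF t(1)]]
            by (intro bexI[of _ "t - coset_part X \<gamma> t"]) (auto simp: right_diff_distrib)
        qed
      qed
      then have "inverse c * (s - r) + inverse c * r \<in> ?T" using r1 by (rule subring_add[OF T])
      then show ?thesis by (simp add: algebra_simps)
    qed
  qed
  fix z assume z: "z \<in> frac_inv ?T E"
  have "inverse c * (z * c) \<in> ?T"
  proof (rule main)
    show "z * c \<in> ?T" using z c by (auto simp: frac_inv_def)
    show "\<forall>e\<in>E. \<exists>t\<in>?T. e * (z * c) = c * t"
      using z by (auto simp: frac_inv_def mult_ac)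
  qed
  moreover have "inverse c * (z * c) = z" using c by simp
  ultimately show "z \<in> ?T" by simp
qed

lemma K_power_int: "x \<in> K \<alpha> \<Longrightarrow> x powi k \<in> K (zm k \<alpha>)"
proof (cases "k \<ge> 0")
  case False
  assume x: "x \<in> K \<alpha>"
  have "inverse x ^ nat (- k) \<in> K (zm (int (nat (- k))) (- \<alpha>))" using K_inverse[OF x] by (rule K_power)
  then show ?thesis using False by (simp add: power_int_def)
qed (use K_power[of x \<alpha> "nat k"] in \<open>auto simp: power_int_def\<close>)


text \<open>The hypothesis on \<open>x\<close> makes the sum of \<open>X\<close> and the multiples
  of \<open>x\<close> direct. Hence the powers of \<open>u\<close> are independent over the quotient
  field of \<open>support_ring X\<close>, and the exponent of \<open>u\<close> is a degree.\<close>

lemma all_tinv_support_ring_extend: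
  assumes X: "zm.subspace X" and x: "\<And>k. zm k x \<in> X \<Longrightarrow> k = 0"
    and u: "u \<in> K x" "u \<noteq> 0" and tinv: "all_tinv (support_ring X)"
  shows "all_tinv (support_ring {y. \<exists>k. y - zm k x \<in> X})"
proof -
  define Y where "Y = {y. \<exists>k. y - zm k x \<in> X}"
  have "Y = zm.span (insert x X)"
    unfolding Y_def zm.span_insert zm.span_eq_iff[THEN iffD2, OF X] ..
  then have Y: "zm.subspace Y" by simp
  have XY: "X \<subseteq> Y" unfolding Y_def by (auto intro: exI[of _ 0])
  have zmY: "zm k x \<in> Y" for k unfolding Y_def using zm.subspace_0[OF X] by (auto intro: exI[of _ k])
  define D where "D = support_ring X"
  define R where "R = support_ring Y"
  have D: "is_subring D" and R: "is_subring R" and DR: "D \<subseteq> R"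
    using X Y XY by (simp_all add: D_def R_def subring_support_ring support_ring_mono)
  have DW: "d \<in> whole" if "d \<in> D" for d using that by (simp add: D_def support_ring_def)
  define F where "F = localization D (D - {0})"
  have F_iff: "z \<in> F \<longleftrightarrow> (\<exists>b\<in>D - {0}. b * z \<in> D)" for z by (simp add: F_def localization_iff)
  have mult0: "a * b \<in> D - {0}" if "a \<in> D - {0}" "b \<in> D - {0}" for a b
    using that subring_mult[OF D] by auto
  have one0: "1 \<in> D - {0}" using D by (simp add: subring_1)
  have den: "\<exists>b\<in>D - {0}. \<forall>z\<in>Z. b * z \<in> D" if "finite Z" "Z \<subseteq> F" for Z
  proof (rule common_denominator[OF mult0 one0 D _ that(1)])
    show "\<forall>z\<in>Z. \<exists>b\<in>D - {0}. b * z \<in> D" using that(2) unfolding F_iff[symmetric] by blast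
  qed auto
  have subF: "is_subring F" and DF: "D \<subseteq> F"
    unfolding F_def using subring_localization[OF D one0 _ _ mult0] by auto
  have F: "subfield F" unfolding subfield_def
  proof (intro conjI ballI subF)
    fix z assume "z \<in> F"
    then obtain b where b: "b \<in> D - {0}" "b * z \<in> D" by (auto simp: F_iff)
    show "inverse z \<in> F"
    proof (cases "z = 0")
      case True
      then show ?thesis using subring_0[OF subF] by simp
    next
      case False
      then show ?thesis unfolding F_iff using b by (intro bexI[of _ "b * z"]) (auto simp: mult.assoc)
    qed
  qed
  \<comment> \<open>\<open>L k\<close> is \<open>F\<close> times the k-th power of \<open>u\<close>,
    with \<open>F\<close> the quotient field of \<open>D\<close>.\<close>
  define L where "L k = {z. z * u powi (- k) \<in> F}" for k :: int
  have uK: "u powi k \<in> K (zm k x)" for k using u(1) by (rule K_power_int)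
  have u0: "u powi k \<noteq> 0" for k using u(2) by simp
  have cancel: "z * u powi (- k) * u powi k = z" for z k using u(2) by (simp add: power_int_minus mult.assoc)
  have shift: "m = n" if "\<beta> \<in> X" "\<beta> + zm m x - zm n x \<in> X" for \<beta> m n
  proof -
    have "zm (m - n) x = (\<beta> + zm m x - zm n x) - \<beta>" by (simp add: zm.scale_left_diff_distrib)
    also have "\<dots> \<in> X" using that(2,1) by (rule zm.subspace_diff[OF X])
    finally show ?thesis using x by fastforce
  qed
  \<comment> \<open>After clearing denominators the coefficients lie in \<open>D\<close>. Distinct
    powers of \<open>u\<close> shift \<open>X\<close> to disjoint cosets, so the component at
    \<open>\<beta> + zm m x\<close> sees a single term.\<close>
  have indep: "c m = 0" if A: "finite A" "\<And>n. n \<in> A \<Longrightarrow> c n \<in> L n" "sum c A = 0" "m \<in> A"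
    for A and c :: "int \<Rightarrow> 'k" and m
  proof -
    have "(\<lambda>n. c n * u powi (- n)) ` A \<subseteq> F" using A(2) by (auto simp: L_def)
    then obtain b where b: "b \<in> D - {0}" "\<And>n. n \<in> A \<Longrightarrow> b * (c n * u powi (- n)) \<in> D"
      using den[of "(\<lambda>n. c n * u powi (- n)) ` A"] A(1) by auto
    define d where "d n = b * (c n * u powi (- n))" for n
    have dD: "d n \<in> D" if "n \<in> A" for n using b(2)[OF that] by (simp add: d_def)
    have ud: "u powi n * d n = b * c n" for n
    proof -
      have "u powi n * d n = b * (c n * u powi (- n) * u powi n)" by (simp add: d_def mult_ac)
      then show ?thesis unfolding cancel .
    qed
    have "(\<Sum>n\<in>A. u powi n * d n) = 0" unfolding ud using A(3) by (simp flip: sum_distrib_left)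
    have "comp (d m) \<beta> = 0" for \<beta>
    proof (cases "\<beta> \<in> X")
      case True
      have W: "u powi n * d n \<in> whole" if "n \<in> A" for n
        using comp_mult_hom(1)[OF uK DW[OF dD[OF that]]] .
      have "0 = comp (\<Sum>n\<in>A. u powi n * d n) (\<beta> + zm m x)"
        using \<open>(\<Sum>n\<in>A. u powi n * d n) = 0\<close> by (simp add: comp_0)
      also have "\<dots> = (\<Sum>n\<in>A. comp (u powi n * d n) (\<beta> + zm m x))" using W by (rule comp_sum)
      also have "\<dots> = (\<Sum>n\<in>A. if n = m then u powi m * comp (d m) \<beta> else 0)"
      proof (rule sum.cong[OF refl])
        fix n assume n: "n \<in> A"
        have "comp (u powi n * d n) (\<beta> + zm m x) = u powi n * comp (d n) (\<beta> + zm m x - zm n x)"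
          using comp_mult_hom(2)[OF uK DW[OF dD[OF n]]] .
        moreover have "comp (d n) (\<beta> + zm m x - zm n x) = 0" if "n \<noteq> m"
          using shift[OF True, of m n] that dD[OF n] by (auto simp: D_def support_ring_def supp_def)
        ultimately show "comp (u powi n * d n) (\<beta> + zm m x) = (if n = m then u powi m * comp (d m) \<beta> else 0)"
          by simp
      qed
      also have "\<dots> = u powi m * comp (d m) \<beta>" using A(1,4) by simp
      finally show ?thesis using u(2) by simp
    next
      case False
      then show ?thesis using dD[OF A(4)] by (auto simp: D_def support_ring_def supp_def)
    qed
    then have "d m = 0" using supp_eq_empty_iff[OF DW[OF dD[OF A(4)]]] by (simp add: supp_def)
    then show ?thesis using b(1) u(2) by (simp add: d_def)
  qed
  interpret L: graded_field L
  proof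
    fix z w k l
    show "0 \<in> L k" using subring_0[OF subF] by (simp add: L_def)
    show "1 \<in> L 0" using subring_1[OF subF] by (simp add: L_def)
    show "z - w \<in> L k" if "z \<in> L k" "w \<in> L k"
      using that subring_diff[OF subF] by (simp add: L_def left_diff_distrib)
    show "z * w \<in> L (k + l)" if "z \<in> L k" "w \<in> L l"
    proof -
      have "z * w * u powi (- (k + l)) = (z * u powi (- k)) * (w * u powi (- l))"
        using u(2) by (simp add: power_int_diff power_int_minus divide_inverse mult_ac)
      then show ?thesis using that subring_mult[OF subF] by (simp only: L_def mem_Collect_eq)
    qed
    show "inverse z \<in> L (- k)" if "z \<in> L k"
    proof -
      have "inverse z * u powi (- (- k)) = inverse (z * u powi (- k))"
        by (simp add: power_int_minus)
      then show ?thesis using that F by (simp only: L_def mem_Collect_eq subfield_def)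
    qed
    show "c m = 0" if "finite A" "\<And>n. n \<in> A \<Longrightarrow> c n \<in> L n" "sum c A = 0" "m \<in> A"
      for A and c :: "int \<Rightarrow> 'k" and m
      using that by (rule indep)
    show "unique_sums TYPE(int)" by (rule unique_sums_int)
  qed
  have FL: "q * u powi k \<in> L k" if "q \<in> F" for q k
    using that u(2) by (simp add: L_def power_int_minus mult.assoc)
  have whole_eq: "L.whole = laurent F u"
  proof
    note lsub = subring_laurent[OF subF, of u]
    have "L k \<subseteq> laurent F u" for k
    proof
      fix z assume z: "z \<in> L k"
      then have q: "z * u powi (- k) \<in> F" by (simp add: L_def)
      show "z \<in> laurent F u"
      proof (cases "k \<ge> 0")
        case True
        then have "z = poly (monom (z * u powi (- k)) (nat k)) u"
          using cancel[of z k] by (simp add: poly_monom power_int_def)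
        then show ?thesis using laurent_poly[OF coeffs_in_monom[OF subF q], of "nat k" u] by simp
      next
        case False
        then have "z * u ^ nat (- k) = poly (monom (z * u powi (- k)) 0) u"
          by (simp add: poly_monom power_int_def)
        then show ?thesis
          using laurent_poly[OF coeffs_in_monom[OF subF q], of 0 u] laurent_power_cancel by metis
      qed
    qed
    then show "L.whole \<subseteq> laurent F u"
      using L.sum_comp L.comp_in_K subring_sum[OF lsub] by (metis subset_iff)
    show "laurent F u \<subseteq> L.whole"
    proof
      fix z assume "z \<in> laurent F u"
      then obtain p m where p: "coeffs_in F p" "z * u ^ m = poly p u" by (auto simp: laurent_def)
      have "coeff p i * u ^ i \<in> L.whole" for i
        using FL[of "coeff p i" "int i"] p(1) L.K_whole by (auto simp: coeffs_in_def)
      then have "z * u ^ m \<in> L.whole" unfolding p(2) poly_altdef by (intro L.whole_sum)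
      moreover have "u powi (- int m) \<in> L.whole"
        using FL[OF subring_1[OF subF], of "- int m"] L.K_whole by simp
      ultimately have "z * u ^ m * u powi (- int m) \<in> L.whole" by (rule L.whole_mult)
      then show "z \<in> L.whole" using u(2) by (simp add: power_int_minus mult.assoc)
    qed
  qed
  \<comment> \<open>\<open>\<kappa>\<close> turns a degree in \<open>Y\<close> into the exponent of
    \<open>u\<close>, that is, into the degree for the grading \<open>L\<close>.\<close>
  define \<kappa> where "\<kappa> \<gamma> = (SOME k. \<gamma> - zm k x \<in> X)" for \<gamma>
  have \<kappa>: "\<gamma> - zm (\<kappa> \<gamma>) x \<in> X" if "\<gamma> \<in> Y" for \<gamma>
    using that unfolding \<kappa>_def Y_def by (auto intro: someI_ex)
  have uR: "u powi k \<in> R" for k unfolding R_def using uK zmY by (rule K_support_ring)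
  interpret LR: graded_subring L R
  proof
    show "is_subring R" by (rule R)
    have RL: "f \<in> L.whole \<and> L.comp f n \<in> R" if f: "f \<in> R" for f n
    proof -
      have fW: "f \<in> whole" and fY: "supp f \<subseteq> Y" using f by (auto simp: R_def support_ring_def)
      have cL: "comp f \<gamma> \<in> L (\<kappa> \<gamma>)" if "\<gamma> \<in> supp f" for \<gamma>
      proof -
        have "comp f \<gamma> * u powi (- \<kappa> \<gamma>) \<in> K (\<gamma> + zm (- \<kappa> \<gamma>) x)"
          using comp_in_K[OF fW] uK by (rule K_mult)
        moreover have "\<gamma> + zm (- \<kappa> \<gamma>) x \<in> X" using \<kappa>[of \<gamma>] that fY by auto
        ultimately show ?thesis using K_support_ring DF unfolding L_def D_def by blast
      qed
      note eq = sum_comp[OF fW]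
      have "sum (comp f) (supp f) \<in> L.whole" using cL by (intro L.whole_sum L.K_whole)
      moreover have "L.comp (sum (comp f) (supp f)) n \<in> R"
      proof -
        have "L.comp (sum (comp f) (supp f)) n = (\<Sum>\<gamma>\<in>supp f. L.comp (comp f \<gamma>) n)"
          using cL by (intro L.comp_sum L.K_whole)
        also have "\<dots> \<in> R"
        proof (rule subring_sum[OF R])
          fix \<gamma> assume \<gamma>: "\<gamma> \<in> supp f"
          have "comp f \<gamma> \<in> R" unfolding R_def using comp_in_K[OF fW] \<gamma> fY by (blast intro: K_support_ring)
          then show "L.comp (comp f \<gamma>) n \<in> R" using L.comp_K[OF cL[OF \<gamma>]] subring_0[OF R] by simp
        qed
        finally show ?thesis .
      qed
      ultimately show ?thesis unfolding eq ..
    qed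
    show "L.graded R" unfolding L.graded_def using RL by blast
    fix z assume z: "z \<in> L.whole"
    let ?q = "\<lambda>n. L.comp z n * u powi (- n)"
    have "?q ` L.supp z \<subseteq> F" using L.comp_in_K[OF z] by (auto simp: L_def)
    then obtain b where b: "b \<in> D - {0}" "\<And>n. n \<in> L.supp z \<Longrightarrow> b * ?q n \<in> D"
      using den[of "?q ` L.supp z"] L.finite_supp[OF z] by auto
    have "b * z = (\<Sum>n\<in>L.supp z. b * L.comp z n)"
      using L.sum_comp[OF z] by (simp flip: sum_distrib_left)
    also have "\<dots> = (\<Sum>n\<in>L.supp z. (b * ?q n) * u powi n)"
      unfolding mult.assoc[of b] cancel ..
    also have "\<dots> \<in> R"
      using subring_mult[OF R subsetD[OF DR b(2)] uR] by (intro subring_sum[OF R])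
    finally have "b * z \<in> R" .
    moreover have "L.hom b" using FL[of b 0] b DF by (auto simp: L.hom_def)
    ultimately show "\<exists>h. L.hom h \<and> h \<noteq> 0 \<and> h \<in> R \<and> h * z \<in> R" using b(1) DR by auto
  qed
  \<comment> \<open>A homogeneous \<open>a\<close> is an element \<open>q a\<close> of
    \<open>F\<close> times a power of \<open>u\<close>, which is a unit of \<open>R\<close>. So
    invertibility of the set of all \<open>q a\<close> over \<open>D\<close> has to be carried over
    to \<open>R\<close>.\<close>
  have "LR.hom_tinv" unfolding LR.hom_tinv_def
  proof (intro allI impI, elim conjE)
    fix A assume A: "finite A" "\<forall>a\<in>A. L.hom a" "\<not> A \<subseteq> {0}"
    then obtain k where k: "\<And>a. a \<in> A \<Longrightarrow> a \<in> L (k a)" unfolding L.hom_def by metis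
    define q where "q a = a * u powi (- k a)" for a
    have q: "finite (q ` A)" "q ` A \<subseteq> F" "\<not> q ` A \<subseteq> {0}"
      using A k u(2) by (auto simp: q_def L_def)
    obtain b where b: "b \<in> D - {0}" "\<forall>z\<in>q ` A. b * z \<in> D" using den[OF q(1,2)] by blast
    have "tinv D ((*) b ` q ` A)"
    proof -
      have "(*) b ` q ` A \<subseteq> D" "finite ((*) b ` q ` A)" using b(2) q(1) by blast+
      moreover have "\<not> (*) b ` q ` A \<subseteq> {0}"
      proof -
        obtain z where "z \<in> q ` A" "z \<noteq> 0" using q(3) by blast
        then have "b * z \<in> (*) b ` q ` A" "b * z \<noteq> 0" using b(1) by simp_all
        then show ?thesis by blast
      qed
      ultimately show ?thesis using tinv unfolding all_tinv_def D_def[symmetric] by blast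
    qed
    then have "tinv D (q ` A)" using b(1) tinv_scale[of b D "q ` A"] by blast
    then obtain B where B: "finite B" "B \<subseteq> frac_inv D (q ` A)" "frac_inv D (products (q ` A) B) \<subseteq> D"
      and qB: "\<not> products (q ` A) B \<subseteq> {0}"
      using tinvE[OF D _ q(3)] by blast
    \<comment> \<open>Twisting \<open>b\<close> by the exponent of each \<open>a\<close> makes every
      \<open>q a * b\<close> a product of \<open>a\<close> with a member of
      \<open>?B\<close>.\<close>
    let ?B = "(\<lambda>(a, b). b * u powi (- k a)) ` (A \<times> B)"
    have qb: "q a * b \<in> D" if "a \<in> A" "b \<in> B" for a b
      using B(2) that by (auto simp: frac_inv_def mult.commute)
    have aq: "a = q a * u powi k a" for a unfolding q_def cancel ..
    have "b * u powi (- k a') * a \<in> R" if "a \<in> A" "a' \<in> A" "b \<in> B" for a a' b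
    proof -
      have "b * u powi (- k a') * a = (q a * b) * (u powi k a * u powi (- k a'))"
        by (subst aq[of a]) (simp only: mult_ac)
      also have "\<dots> \<in> R"
        using subring_mult[OF R subsetD[OF DR qb[OF that(1,3)]] subring_mult[OF R uR uR]] .
      finally show ?thesis .
    qed
    then have "?B \<subseteq> frac_inv R A" by (auto simp: frac_inv_def)
    moreover have "frac_inv R (products A ?B) \<subseteq> R"
    proof -
      \<comment> \<open>Freeness of \<open>R\<close> over \<open>D\<close> keeps the inverse
        trivial.\<close>
      have "frac_inv R (products (q ` A) B) \<subseteq> R"
        unfolding R_def
      proof (rule support_ring_frac_inv[OF X Y XY _ qB])
        show "products (q ` A) B \<subseteq> support_ring X"
          using B(2) unfolding D_def[symmetric] products_subset_iff .
        show "frac_inv (support_ring X) (products (q ` A) B) \<subseteq> support_ring X"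
          using B(3) unfolding D_def .
      qed
      moreover have "frac_inv R (products A ?B) \<subseteq> frac_inv R (products (q ` A) B)"
      proof
        fix z assume z: "z \<in> frac_inv R (products A ?B)"
        have "z * q a * b \<in> R" if "a \<in> A" "b \<in> B" for a b
        proof -
          have "z * a * (b * u powi (- k a)) \<in> R"
            using z that unfolding frac_inv_products_iff by (auto simp: image_iff)
          then show ?thesis by (simp add: q_def mult_ac)
        qed
        then show "z \<in> frac_inv R (products (q ` A) B)" by (auto simp: frac_inv_products_iff)
      qed
      ultimately show ?thesis by blast
    qed
    moreover have "finite ?B" using A(1) B(1) by simp
    ultimately show "tinv R A" unfolding tinv_def by blast
  qed
  moreover have "all_tinv L.whole" unfolding whole_eq using F u(2) by (rule laurent_all_tinv)
  ultimately have "all_tinv R" by (rule LR.hom_tinv_imp_all_tinv)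
  then show ?thesis by (simp add: R_def Y_def)
qed

lemma support_ring_zero: "subfield (support_ring {0})"
  unfolding subfield_def
proof (intro conjI ballI)
  show "is_subring (support_ring {0})" by (rule subring_support_ring) (rule zm.subspace_single_0)
  fix f assume f: "f \<in> support_ring {0}"
  then have "f = sum (comp f) {0}"
    using sum_comp_superset[of f "{0}"] by (auto simp: support_ring_def)
  then have "f \<in> K 0" using comp_in_K[of f 0] f by (simp add: support_ring_def)
  then have "inverse f \<in> K 0" using K_inverse by fastforce
  then show "inverse f \<in> support_ring {0}" by (rule K_support_ring) simp
qed

text \<open>A finite set has its degrees in a finitely generated subgroup, which allows induction on
  the number of generators. A trivial inverse over the ring of that subgroup stays trivial over
  \<open>whole\<close> by freeness.\<close>

lemma all_tinv_whole:
  assumes tf: "torsion_free TYPE('g)" and K: "\<And>\<alpha>. K \<alpha> \<noteq> {0}"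
  shows "all_tinv whole"
proof -
  have K': "\<exists>u. u \<in> K \<alpha> \<and> u \<noteq> 0" for \<alpha> using K[of \<alpha>] K_zero[of \<alpha>] by blast
  have span: "all_tinv (support_ring (zm.span (x ` {..<n})))" for n and x :: "nat \<Rightarrow> 'g"
  proof (induction n arbitrary: x)
    case 0
    then show ?case using subfield_all_tinv[OF support_ring_zero] by simp
  next
    case (Suc n)
    show ?case
    proof (cases "\<exists>k. k \<noteq> 0 \<and> zm k (x n) \<in> zm.span (x ` {..<n})")
      case False
      obtain u where u: "u \<in> K (x n)" "u \<noteq> 0" using K' by blast
      have "all_tinv (support_ring {y. \<exists>k. y - zm k (x n) \<in> zm.span (x ` {..<n})})"
        using False u Suc.IH by (intro all_tinv_support_ring_extend[where u = u]) auto
      moreover have "x ` {..<Suc n} = insert (x n) (x ` {..<n})" by (simp add: lessThan_Suc)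
      ultimately show ?thesis by (simp only: zm.span_insert)
    next
      \<comment> \<open>Some multiple of the new generator depends on the others, so
        \<open>span_reduce\<close> saves one generator. It may change all of them, which is why the
        induction is over arbitrary \<open>x\<close>.\<close>
      case True
      then obtain k a where k: "k \<noteq> 0" "zm k (x n) = (\<Sum>i<n. zm (a i) (x i))"
        using span_image_coefficients by metis
      have "(\<Sum>i<n. zm ((a(n := - k)) i) (x i)) = (\<Sum>i<n. zm (a i) (x i))" by (intro sum.cong) auto
      then have "(\<Sum>i<Suc n. zm ((a(n := - k)) i) (x i)) = 0" using k(2) by simp
      moreover have "\<exists>i<Suc n. (a(n := - k)) i \<noteq> 0" using k(1) by (intro exI[of _ n]) simp
      ultimately obtain y where "zm.span (y ` {..<n}) = zm.span (x ` {..<Suc n})"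
        using span_reduce[OF tf] by blast
      then show ?thesis using Suc.IH[of y] by (simp only:)
    qed
  qed
  show ?thesis unfolding all_tinv_def
  proof (intro allI impI, elim conjE)
    fix A assume A: "finite A" "A \<subseteq> whole" "\<not> A \<subseteq> {0}"
    have "finite (\<Union>(supp ` A))" using A finite_supp by auto
    then obtain n and x :: "nat \<Rightarrow> 'g" where x: "\<Union>(supp ` A) = x ` {i. i < n}"
      using finite_imp_nat_seg_image_inj_on by metis
    define X where "X = zm.span (x ` {..<n})"
    have X: "zm.subspace X" by (simp add: X_def)
    have "supp a \<subseteq> X" if "a \<in> A" for a
      using that x zm.span_superset[of "x ` {..<n}"] unfolding X_def lessThan_def by blast
    then have "A \<subseteq> support_ring X" using A(2) by (auto simp: support_ring_def)
    then have "tinv (support_ring X) A"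
      using span[where n = n and x = x] A(1,3) unfolding X_def[symmetric] all_tinv_def by blast
    then obtain B where B: "finite B" "B \<subseteq> frac_inv (support_ring X) A"
      "frac_inv (support_ring X) (products A B) \<subseteq> support_ring X" "\<not> products A B \<subseteq> {0}"
      using tinvE[OF subring_support_ring[OF X] _ A(3)] by blast
    have XW: "support_ring X \<subseteq> whole" by (auto simp: support_ring_def)
    have "frac_inv (support_ring UNIV) (products A B) \<subseteq> support_ring UNIV"
      using support_ring_frac_inv[OF X zm.subspace_UNIV subset_UNIV _ B(4,3)] B(2)
      by (simp add: products_subset_iff)
    then show "tinv whole A" using B(1,2) XW unfolding tinv_def support_ring_UNIV
      by (intro exI[of _ B]) (auto simp: frac_inv_def)
  qed
qed

end

section \<open>Graded integral domains\<close>

locale graded_integral_domain =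
  fixes \<Gamma> :: "'g::ab_group_add set" and G :: "'g \<Rightarrow> 'k::field set" and R :: "'k set"
  assumes graded_domain: "graded_domain \<Gamma> G R"
begin

lemma \<Gamma>_0: "0 \<in> \<Gamma>"
  and \<Gamma>_add: "\<alpha> \<in> \<Gamma> \<Longrightarrow> \<beta> \<in> \<Gamma> \<Longrightarrow> \<alpha> + \<beta> \<in> \<Gamma>"
  and \<Gamma>_diff: "\<exists>\<alpha>\<in>\<Gamma>. \<exists>\<beta>\<in>\<Gamma>. \<gamma> = \<alpha> - \<beta>"
  and R_subring: "is_subring R"
  and R_qf: "domain_in_qf R"
  and G_0: "\<alpha> \<in> \<Gamma> \<Longrightarrow> 0 \<in> G \<alpha>"
  and G_diff: "\<alpha> \<in> \<Gamma> \<Longrightarrow> x \<in> G \<alpha> \<Longrightarrow> y \<in> G \<alpha> \<Longrightarrow> x - y \<in> G \<alpha>"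
  and G_mult: "\<alpha> \<in> \<Gamma> \<Longrightarrow> \<beta> \<in> \<Gamma> \<Longrightarrow> x \<in> G \<alpha> \<Longrightarrow> y \<in> G \<beta> \<Longrightarrow> x * y \<in> G (\<alpha> + \<beta>)"
  and R_eq: "R = {x. \<exists>c. decomposition \<Gamma> G x c}"
  and R_unique: "x \<in> R \<Longrightarrow> \<exists>!c. decomposition \<Gamma> G x c"
  using graded_domain
  by (auto simp: graded_domain_def grading_monoid_def graded_ring_def internal_direct_sum_def)

lemma G_nonzero: "\<alpha> \<in> \<Gamma> \<Longrightarrow> \<exists>a\<in>G \<alpha>. a \<noteq> 0"
  using graded_domain G_0[of \<alpha>] by (auto simp: graded_domain_def)

lemma torsion_free: "torsion_free TYPE('g)"
  unfolding torsion_free_def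
proof (intro allI impI)
  fix k and x :: 'g assume k: "k \<noteq> 0" and kx: "zm k x = 0"
  obtain \<alpha> \<beta> where x: "\<alpha> \<in> \<Gamma>" "\<beta> \<in> \<Gamma>" "x = \<alpha> - \<beta>" using \<Gamma>_diff by blast
  define n where "n = nat \<bar>k\<bar>"
  have "zm (int n) x = 0" using kx by (cases "k \<ge> 0") (auto simp: n_def)
  then have "(\<Sum>i<n. \<alpha>) = (\<Sum>i<n. \<beta>)" by (simp add: zm_int x(3) sum_subtractf)
  moreover have "n \<ge> 1" using k by (simp add: n_def)
  ultimately have "\<alpha> = \<beta>"
    using graded_domain x(1,2) unfolding graded_domain_def grading_monoid_def by blast
  then show "x = 0" using x(3) by simp
qed

abbreviation K :: "'g \<Rightarrow> 'k set" where "K \<equiv> quot_grading \<Gamma> G"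

lemma K_memI: "\<beta> \<in> \<Gamma> \<Longrightarrow> \<gamma> \<in> \<Gamma> \<Longrightarrow> a \<in> G \<beta> \<Longrightarrow> b \<in> G \<gamma> \<Longrightarrow> b \<noteq> 0 \<Longrightarrow> \<alpha> = \<beta> - \<gamma> \<Longrightarrow> a / b \<in> K \<alpha>"
  unfolding quot_grading_def by blast

lemma K_memE:
  assumes "x \<in> K \<alpha>"
  obtains a b \<beta> \<gamma> where "\<beta> \<in> \<Gamma>" "\<gamma> \<in> \<Gamma>" "a \<in> G \<beta>" "b \<in> G \<gamma>" "b \<noteq> 0" "\<alpha> = \<beta> - \<gamma>" "x = a / b"
  using assms unfolding quot_grading_def by blast

lemma G_subset_K:
  assumes "\<alpha> \<in> \<Gamma>"
  shows "G \<alpha> \<subseteq> K \<alpha>"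
proof
  fix a assume a: "a \<in> G \<alpha>"
  obtain b where b: "b \<in> G 0" "b \<noteq> 0" using G_nonzero[OF \<Gamma>_0] by blast
  have "a * b / b \<in> K \<alpha>"
    using a b assms \<Gamma>_0 G_mult[of \<alpha> 0 a b] by (intro K_memI[of \<alpha> 0]) auto
  then show "a \<in> K \<alpha>" using b by simp
qed

lemma G_subset_R:
  assumes "\<alpha> \<in> \<Gamma>"
  shows "G \<alpha> \<subseteq> R"
proof
  fix x assume "x \<in> G \<alpha>"
  then have "decomposition \<Gamma> G (\<Sum>\<beta>\<in>{\<alpha>}. x) (\<lambda>\<beta>. if \<beta> \<in> {\<alpha>} then x else 0)"
    using assms by (intro sum_decomposition) (auto simp: G_0)
  then show "x \<in> R" unfolding R_eq by auto
qed

lemma G_independent: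
  assumes "finite A" "A \<subseteq> \<Gamma>" "\<And>\<alpha>. \<alpha> \<in> A \<Longrightarrow> c \<alpha> \<in> G \<alpha>" "sum c A = 0" "\<alpha> \<in> A"
  shows "c \<alpha> = 0"
proof -
  have "decomposition \<Gamma> G (sum c A) (\<lambda>\<alpha>. if \<alpha> \<in> A then c \<alpha> else 0)"
    using assms(1-3) G_0 by (rule sum_decomposition)
  then have "decomposition \<Gamma> G 0 (\<lambda>\<alpha>. if \<alpha> \<in> A then c \<alpha> else 0)" by (simp only: assms(4))
  moreover have "decomposition \<Gamma> G 0 (\<lambda>_. 0)" using G_0 by (simp add: decomposition_def)
  ultimately have "(\<lambda>\<alpha>. if \<alpha> \<in> A then c \<alpha> else 0) = (\<lambda>_. 0)"
    using R_unique[OF subring_0[OF R_subring]] by blast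
  then show ?thesis using assms(5) by metis
qed

text \<open>A product of homogeneous denominators serves all elements. Its degree
  \<open>\<gamma>\<close> is recorded because the shift by it carries the degrees injectively into
  \<open>\<Gamma>\<close>, which reduces independence of the quotient grading to that of
  \<open>G\<close>.\<close>

lemma K_common_denominator:
  assumes "finite A" "\<And>\<alpha>. \<alpha> \<in> A \<Longrightarrow> c \<alpha> \<in> K \<alpha>"
  shows "\<exists>\<gamma>\<in>\<Gamma>. \<exists>h\<in>G \<gamma>. h \<noteq> 0 \<and> (\<forall>\<alpha>\<in>A. \<alpha> + \<gamma> \<in> \<Gamma> \<and> h * c \<alpha> \<in> G (\<alpha> + \<gamma>))"
  using assms
proof (induction A)
  case empty
  then show ?case using \<Gamma>_0 G_nonzero by auto
next
  case (insert \<alpha> A)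
  then obtain \<gamma> h where h: "\<gamma> \<in> \<Gamma>" "h \<in> G \<gamma>" "h \<noteq> 0"
    "\<forall>\<alpha>\<in>A. \<alpha> + \<gamma> \<in> \<Gamma> \<and> h * c \<alpha> \<in> G (\<alpha> + \<gamma>)" by auto
  obtain a b \<beta> \<delta> where ab: "\<beta> \<in> \<Gamma>" "\<delta> \<in> \<Gamma>" "a \<in> G \<beta>" "b \<in> G \<delta>" "b \<noteq> 0" "\<alpha> = \<beta> - \<delta>" "c \<alpha> = a / b"
    using insert.prems[of \<alpha>] by (auto elim: K_memE)
  have "\<alpha> + (\<gamma> + \<delta>) = \<gamma> + \<beta>" "h * b * c \<alpha> = h * a" using ab by simp_all
  then have "\<alpha> + (\<gamma> + \<delta>) \<in> \<Gamma> \<and> h * b * c \<alpha> \<in> G (\<alpha> + (\<gamma> + \<delta>))"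
    using G_mult[OF h(1) ab(1) h(2) ab(3)] \<Gamma>_add[OF h(1) ab(1)] by (simp only: conj_absorb simp_thms)
  moreover have "\<alpha>' + (\<gamma> + \<delta>) \<in> \<Gamma> \<and> h * b * c \<alpha>' \<in> G (\<alpha>' + (\<gamma> + \<delta>))" if "\<alpha>' \<in> A" for \<alpha>'
  proof -
    have "\<alpha>' + (\<gamma> + \<delta>) = (\<alpha>' + \<gamma>) + \<delta>" "h * b * c \<alpha>' = h * c \<alpha>' * b" by (simp_all add: ac_simps)
    then show ?thesis
      using h(4) that G_mult[OF _ ab(2) _ ab(4), of "\<alpha>' + \<gamma>"] \<Gamma>_add[OF _ ab(2), of "\<alpha>' + \<gamma>"]
      by (simp only: simp_thms)
  qed
  ultimately have "\<forall>\<alpha>'\<in>insert \<alpha> A. \<alpha>' + (\<gamma> + \<delta>) \<in> \<Gamma> \<and> h * b * c \<alpha>' \<in> G (\<alpha>' + (\<gamma> + \<delta>))" by blast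
  moreover have "\<gamma> + \<delta> \<in> \<Gamma>" "h * b \<in> G (\<gamma> + \<delta>)" "h * b \<noteq> 0"
    using h ab \<Gamma>_add G_mult by simp_all
  ultimately show ?case by blast
qed

lemma K_nonzero: "K \<alpha> \<noteq> {0}"
proof -
  obtain \<beta> \<gamma> where bg: "\<beta> \<in> \<Gamma>" "\<gamma> \<in> \<Gamma>" "\<alpha> = \<beta> - \<gamma>" using \<Gamma>_diff by blast
  obtain a b where "a \<in> G \<beta>" "a \<noteq> 0" "b \<in> G \<gamma>" "b \<noteq> 0" using G_nonzero bg by blast
  then have "a / b \<in> K \<alpha>" "a / b \<noteq> 0" using bg by (auto intro: K_memI)
  then show ?thesis by blast
qed

sublocale graded_field K
proof
  fix x y \<alpha> \<beta>
  show zero: "0 \<in> K \<alpha>" for \<alpha>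
  proof -
    obtain \<beta> \<gamma> where bg: "\<beta> \<in> \<Gamma>" "\<gamma> \<in> \<Gamma>" "\<alpha> = \<beta> - \<gamma>" using \<Gamma>_diff by blast
    obtain b where "b \<in> G \<gamma>" "b \<noteq> 0" using G_nonzero bg by blast
    then have "0 / b \<in> K \<alpha>" using bg G_0 by (intro K_memI)
    then show ?thesis by simp
  qed
  show "x - y \<in> K \<alpha>" if "x \<in> K \<alpha>" "y \<in> K \<alpha>"
  proof -
    obtain a b \<beta> \<gamma> where x: "\<beta> \<in> \<Gamma>" "\<gamma> \<in> \<Gamma>" "a \<in> G \<beta>" "b \<in> G \<gamma>" "b \<noteq> 0" "\<alpha> = \<beta> - \<gamma>" "x = a / b"
      using \<open>x \<in> K \<alpha>\<close> by (blast elim: K_memE)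
    obtain c d \<delta> \<epsilon> where y: "\<delta> \<in> \<Gamma>" "\<epsilon> \<in> \<Gamma>" "c \<in> G \<delta>" "d \<in> G \<epsilon>" "d \<noteq> 0" "\<alpha> = \<delta> - \<epsilon>" "y = c / d"
      using \<open>y \<in> K \<alpha>\<close> by (blast elim: K_memE)
    have eq: "\<delta> + \<gamma> = \<beta> + \<epsilon>" using x(6) y(6) by (simp add: algebra_simps)
    have "a * d \<in> G (\<beta> + \<epsilon>)" "c * b \<in> G (\<beta> + \<epsilon>)"
      using G_mult[of \<beta> \<epsilon> a d] G_mult[of \<delta> \<gamma> c b] x y unfolding eq by simp_all
    then have "(a * d - c * b) / (b * d) \<in> K \<alpha>"
      using x y G_mult[of \<gamma> \<epsilon> b d] \<Gamma>_add G_diff by (intro K_memI[of "\<beta> + \<epsilon>" "\<gamma> + \<epsilon>"]) auto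
    moreover have "x - y = (a * d - c * b) / (b * d)" using x y by (simp add: field_simps)
    ultimately show ?thesis by simp
  qed
  obtain b where b: "b \<in> G 0" "b \<noteq> 0" using G_nonzero[OF \<Gamma>_0] by blast
  then have "b / b \<in> K 0" using \<Gamma>_0 by (intro K_memI[of 0 0]) auto
  then show "1 \<in> K 0" using b by simp
  show "x * y \<in> K (\<alpha> + \<beta>)" if "x \<in> K \<alpha>" "y \<in> K \<beta>"
  proof -
    obtain a b \<beta>' \<gamma> where x: "\<beta>' \<in> \<Gamma>" "\<gamma> \<in> \<Gamma>" "a \<in> G \<beta>'" "b \<in> G \<gamma>" "b \<noteq> 0" "\<alpha> = \<beta>' - \<gamma>" "x = a / b"
      using \<open>x \<in> K \<alpha>\<close> by (blast elim: K_memE)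
    obtain c d \<delta> \<epsilon> where y: "\<delta> \<in> \<Gamma>" "\<epsilon> \<in> \<Gamma>" "c \<in> G \<delta>" "d \<in> G \<epsilon>" "d \<noteq> 0" "\<beta> = \<delta> - \<epsilon>" "y = c / d"
      using \<open>y \<in> K \<beta>\<close> by (blast elim: K_memE)
    have "(a * c) / (b * d) \<in> K (\<alpha> + \<beta>)"
      using x y \<Gamma>_add G_mult by (intro K_memI[of "\<beta>' + \<delta>" "\<gamma> + \<epsilon>"]) auto
    then show ?thesis using x(7) y(7) by simp
  qed
  show "inverse x \<in> K (- \<alpha>)" if "x \<in> K \<alpha>"
  proof (cases "x = 0")
    case False
    obtain a b \<beta>' \<gamma> where x: "\<beta>' \<in> \<Gamma>" "\<gamma> \<in> \<Gamma>" "a \<in> G \<beta>'" "b \<in> G \<gamma>" "b \<noteq> 0" "\<alpha> = \<beta>' - \<gamma>" "x = a / b"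
      using \<open>x \<in> K \<alpha>\<close> by (blast elim: K_memE)
    then have "b / a \<in> K (- \<alpha>)" using False by (intro K_memI[of \<gamma> \<beta>']) auto
    then show ?thesis using x(7) by simp
  qed (simp add: zero)
  show "c \<alpha> = 0" if A: "finite A" "\<And>\<alpha>. \<alpha> \<in> A \<Longrightarrow> c \<alpha> \<in> K \<alpha>" "sum c A = 0" "\<alpha> \<in> A" for A c \<alpha>
  proof -
    obtain \<gamma> h where h: "\<gamma> \<in> \<Gamma>" "h \<in> G \<gamma>" "h \<noteq> 0" "\<forall>\<alpha>\<in>A. \<alpha> + \<gamma> \<in> \<Gamma> \<and> h * c \<alpha> \<in> G (\<alpha> + \<gamma>)"
      using K_common_denominator[OF A(1,2)] by blast
    have "h * c (\<alpha> + \<gamma> - \<gamma>) = 0"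
    proof (rule G_independent[of "(\<lambda>\<alpha>. \<alpha> + \<gamma>) ` A" "\<lambda>\<beta>. h * c (\<beta> - \<gamma>)"])
      have "(\<Sum>\<beta>\<in>(\<lambda>\<alpha>. \<alpha> + \<gamma>) ` A. h * c (\<beta> - \<gamma>)) = (\<Sum>\<alpha>\<in>A. h * c \<alpha>)"
        by (simp add: sum.reindex)
      then show "(\<Sum>\<beta>\<in>(\<lambda>\<alpha>. \<alpha> + \<gamma>) ` A. h * c (\<beta> - \<gamma>)) = 0"
        using A(3) by (simp flip: sum_distrib_left)
    qed (use A h in auto)
    then show ?thesis using h(3) by simp
  qed
  show "unique_sums TYPE('g)" by (rule torsion_free_unique_sums[OF torsion_free])
qed

lemma comp_decomposition:
  assumes "decomposition \<Gamma> G x c"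
  shows "decomposition UNIV K x c"
proof -
  have "c \<alpha> \<in> K \<alpha>" for \<alpha>
  proof (cases "c \<alpha> = 0")
    case False
    then show ?thesis using assms G_subset_K[of \<alpha>] by (auto simp: decomposition_def)
  qed (simp add: K_zero)
  then show ?thesis using assms by (auto simp: decomposition_def)
qed

lemma R_decomposition:
  assumes "x \<in> R"
  shows "decomposition \<Gamma> G x (comp x)" "x \<in> whole"
proof -
  obtain c where c: "decomposition \<Gamma> G x c" using assms R_eq by blast
  have "comp x = c" using c by (intro comp_eqI comp_decomposition)
  then show "decomposition \<Gamma> G x (comp x)" using c by simp
  show "x \<in> whole" unfolding whole_def using comp_decomposition[OF c] by blast
qed

lemma R_hom:
  assumes "x \<in> R" "x \<in> K \<alpha>" "x \<noteq> 0"
  shows "\<alpha> \<in> \<Gamma>" "x \<in> G \<alpha>"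
proof -
  have "comp x \<alpha> = x" using comp_K[OF assms(2)] by simp
  then show "\<alpha> \<in> \<Gamma>" "x \<in> G \<alpha>"
    using R_decomposition(1)[OF assms(1)] assms(3) by (auto simp: decomposition_def dest!: subsetD[of _ \<Gamma> \<alpha>])
qed

lemma homs_eq: "homs \<Gamma> G = {x \<in> R. hom x \<and> x \<noteq> 0}"
proof
  show "homs \<Gamma> G \<subseteq> {x \<in> R. hom x \<and> x \<noteq> 0}"
    unfolding homs_def hom_def using G_subset_R G_subset_K by blast
  show "{x \<in> R. hom x \<and> x \<noteq> 0} \<subseteq> homs \<Gamma> G"
    unfolding homs_def hom_def using R_hom by blast
qed

sublocale graded_subring K R
proof
  show "is_subring R" by (rule R_subring)
  show "graded R" unfolding graded_def
  proof (intro conjI ballI allI subsetI)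
    fix x \<alpha> assume x: "x \<in> R"
    show "x \<in> whole" by (rule R_decomposition[OF x])
    show "comp x \<alpha> \<in> R"
    proof (cases "comp x \<alpha> = 0")
      case True
      then show ?thesis using subring_0[OF R_subring] by simp
    next
      case False
      then have "\<alpha> \<in> \<Gamma>" "comp x \<alpha> \<in> G \<alpha>"
        using R_decomposition(1)[OF x] by (auto simp: decomposition_def)
      then show ?thesis using G_subset_R by blast
    qed
  qed
  fix x assume x: "x \<in> whole"
  obtain \<gamma> h where h: "\<gamma> \<in> \<Gamma>" "h \<in> G \<gamma>" "h \<noteq> 0"
    "\<forall>\<alpha>\<in>supp x. \<alpha> + \<gamma> \<in> \<Gamma> \<and> h * comp x \<alpha> \<in> G (\<alpha> + \<gamma>)"
    using K_common_denominator[of "supp x" "comp x"] finite_supp[OF x] comp_in_K[OF x] by blast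
  have "h * x = (\<Sum>\<alpha>\<in>supp x. h * comp x \<alpha>)"
    using sum_comp[OF x] by (simp flip: sum_distrib_left)
  also have "\<dots> \<in> R" using h(4) G_subset_R by (intro subring_sum[OF R_subring]) blast
  finally have "h * x \<in> R" .
  moreover have "hom h" "h \<in> R" using h(1,2) G_subset_K G_subset_R by (auto simp: hom_def)
  ultimately show "\<exists>h. hom h \<and> h \<noteq> 0 \<and> h \<in> R \<and> h * x \<in> R" using h(3) by blast
qed

lemma PvMD_if_hom_tinv: "hom_tinv \<Longrightarrow> PvMD R"
  using hom_tinv_imp_all_tinv all_tinv_whole[OF torsion_free K_nonzero] R_qf by (simp add: PvMD_iff)

abbreviation H :: "'k set" where "H \<equiv> homs \<Gamma> G"

lemma H_iff: "x \<in> H \<longleftrightarrow> x \<in> R \<and> hom x \<and> x \<noteq> 0" by (simp add: homs_eq)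

lemma H_mult: "x \<in> H \<Longrightarrow> y \<in> H \<Longrightarrow> x * y \<in> H"
  using subring_mult[OF R_subring] hom_mult by (simp add: H_iff)

lemma H_1: "1 \<in> H" using subring_1[OF R_subring] hom_1 by (simp add: H_iff)

lemma whole_iff: "x \<in> whole \<longleftrightarrow> (\<exists>h\<in>H. h * x \<in> R)"
proof
  show "x \<in> whole \<Longrightarrow> \<exists>h\<in>H. h * x \<in> R" using denominators[of x] unfolding Bex_def H_iff by blast
  show "\<exists>h\<in>H. h * x \<in> R \<Longrightarrow> x \<in> whole"
    using hom_mult_whole R_whole unfolding Bex_def H_iff by blast
qed

lemma localization_H: "localization R H = whole"
proof -
  have "0 \<notin> H" by (simp add: H_iff)
  then show ?thesis by (simp add: set_eq_iff localization_iff whole_iff)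
qed

lemma graded_ring_iff:
  assumes "is_subring T" "graded T"
  shows "graded_ring UNIV (\<lambda>\<alpha>. T \<inter> K \<alpha>) T"
proof -
  have dec: "decomposition UNIV (\<lambda>\<alpha>. T \<inter> K \<alpha>) x c \<Longrightarrow> decomposition UNIV K x c" for x c
    by (auto simp: decomposition_def)
  have comp: "decomposition UNIV (\<lambda>\<alpha>. T \<inter> K \<alpha>) x (comp x)" if "x \<in> T" for x
  proof -
    have "x \<in> whole" "\<And>\<alpha>. comp x \<alpha> \<in> T" using assms(2) that by (auto simp: graded_def)
    then show ?thesis using decomposition_comp[of x] by (simp add: decomposition_def)
  qed
  have sum: "x \<in> T" if "decomposition UNIV (\<lambda>\<alpha>. T \<inter> K \<alpha>) x c" for x c
  proof -
    have "x = (\<Sum>\<alpha> | c \<alpha> \<noteq> 0. c \<alpha>)" "\<And>\<alpha>. c \<alpha> \<in> T" using that by (auto simp: decomposition_def)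
    then show ?thesis using subring_sum[OF assms(1)] by metis
  qed
  have "\<exists>!c. decomposition UNIV (\<lambda>\<alpha>. T \<inter> K \<alpha>) x c" if "x \<in> T" for x
    using comp[OF that] dec decomposition_unique by blast
  moreover have "T = {x. \<exists>c. decomposition UNIV (\<lambda>\<alpha>. T \<inter> K \<alpha>) x c}" using comp sum by blast
  ultimately have "internal_direct_sum UNIV (\<lambda>\<alpha>. T \<inter> K \<alpha>) T"
    unfolding internal_direct_sum_def
    using subring_0[OF assms(1)] subring_diff[OF assms(1)] K_zero K_diff by blast
  then show ?thesis
    unfolding graded_ring_def using assms(1) subring_mult[OF assms(1)] K_mult by blast
qed

lemma homogeneous_overringI:
  "is_subring T \<Longrightarrow> graded T \<Longrightarrow> R \<subseteq> T \<Longrightarrow> homogeneous_overring \<Gamma> G R T"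
  unfolding homogeneous_overring_def localization_H using graded_ring_iff by (auto simp: graded_def)

lemma homogeneous_ideal_iff: "homogeneous_ideal \<Gamma> G R A \<longleftrightarrow> is_ideal R A \<and> graded A"
proof
  assume "homogeneous_ideal \<Gamma> G R A"
  then obtain S where S: "S \<subseteq> H" "A = submod R hull S" and A: "is_ideal R A"
    by (auto simp: homogeneous_ideal_def)
  have "graded A" unfolding S(2)
  proof (rule graded_hull)
    fix x \<alpha> assume x: "x \<in> S"
    obtain \<beta> where \<beta>: "x \<in> K \<beta>" using subsetD[OF S(1) x] by (auto simp: H_iff hom_def)
    show "comp x \<alpha> \<in> submod R hull S"
      using x comp_K[OF \<beta>] submod_0[OF submod_hull] by (auto intro: hull_inc)
  qed (use S(1) hom_whole in \<open>auto simp: H_iff\<close>)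
  then show "is_ideal R A \<and> graded A" using A by simp
next
  assume A: "is_ideal R A \<and> graded A"
  then have sub: "submod R A" and AR: "A \<subseteq> R" by (auto simp: is_ideal_def)
  have "A = submod R hull (A \<inter> H)"
  proof
    show "submod R hull (A \<inter> H) \<subseteq> A" using sub by (intro hull_minimal) auto
    show "A \<subseteq> submod R hull (A \<inter> H)"
    proof
      fix x assume x: "x \<in> A"
      then have W: "x \<in> whole" using AR R_whole by blast
      have "comp x \<alpha> \<in> A \<inter> H" if "\<alpha> \<in> supp x" for \<alpha>
        using that x A AR hom_comp[OF W] by (auto simp: supp_def graded_def H_iff)
      then have "sum (comp x) (supp x) \<in> submod R hull (A \<inter> H)"
        by (intro submod_sum[OF submod_hull] hull_inc)
      then show "x \<in> submod R hull (A \<inter> H)" using sum_comp[OF W] by simp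
    qed
  qed
  then show "homogeneous_ideal \<Gamma> G R A"
    unfolding homogeneous_ideal_def using A by (intro conjI exI[of _ "A \<inter> H"]) auto
qed

lemma graded_sum_mem: "graded M \<Longrightarrow> submod R M \<Longrightarrow> x \<in> whole \<Longrightarrow> (\<And>\<alpha>. comp x \<alpha> \<in> M) \<Longrightarrow> x \<in> M"
  by (subst sum_comp[symmetric]) (auto intro: submod_sum)


lemma H_common_denominator:
  assumes "finite X" "X \<subseteq> whole"
  shows "\<exists>h\<in>H. \<forall>x\<in>X. h * x \<in> R"
proof (rule common_denominator[OF H_mult H_1 R_subring _ assms(1)])
  show "\<forall>x\<in>X. \<exists>h\<in>H. h * x \<in> R" using assms(2) whole_iff by blast
qed (auto simp: H_iff)

text \<open>A homogeneous common denominator moves a fractional set into \<open>R\<close>, and 0 may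
  be discarded because it affects no inverse.\<close>

lemma hom_tinvI:
  assumes "\<And>A. finite A \<Longrightarrow> A \<subseteq> H \<Longrightarrow> A \<noteq> {} \<Longrightarrow> tinv R A"
  shows hom_tinv
  unfolding hom_tinv_def
proof (intro allI impI, elim conjE)
  fix A assume A: "finite A" "\<forall>a\<in>A. hom a" "\<not> A \<subseteq> {0}"
  let ?A = "A - {0}"
  obtain h where h: "h \<in> H" "\<forall>x\<in>?A. h * x \<in> R"
    using H_common_denominator[of ?A] A hom_whole by auto
  then have "(*) h ` ?A \<subseteq> H" using A(2) hom_mult by (auto simp: H_iff)
  then have "tinv R ((*) h ` ?A)" using A by (intro assms) auto
  then have "tinv R ?A" using h(1) tinv_scale[of h R ?A] by (simp add: H_iff)
  then obtain B where B: "finite B" "B \<subseteq> frac_inv R ?A" "frac_inv R (products ?A B) \<subseteq> R"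
    unfolding tinv_def by blast
  have "frac_inv R ?A \<subseteq> frac_inv R A" using subring_0[OF R_subring] by (auto simp: frac_inv_def)
  moreover have "frac_inv R (products A B) \<subseteq> frac_inv R (products ?A B)"
    by (rule frac_inv_antimono) (auto simp: products_def)
  ultimately show "tinv R A" unfolding tinv_def using B by blast
qed

section \<open>Homogeneous maximal t-ideals\<close>

lemma t_idealI:
  assumes "is_ideal R A" "A \<noteq> {0}"
    and "\<And>X. finite X \<Longrightarrow> X \<subseteq> A \<Longrightarrow> \<not> X \<subseteq> {0} \<Longrightarrow> v_op R X \<subseteq> A"
  shows "t_ideal R A"
proof -
  have sub: "submod R A" using assms(1) by (simp add: is_ideal_def)
  have "t_op R A \<subseteq> A" using assms(3) unfolding subset_iff t_op_iff[OF R_subring sub] by blast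
  then have "t_op R A = A" using subset_t_op[OF R_subring sub assms(2)] by blast
  then show ?thesis using assms(1,2) by (simp add: t_ideal_def)
qed

lemma t_idealD:
  assumes "t_ideal R A" "finite X" "X \<subseteq> A" "\<not> X \<subseteq> {0}"
  shows "v_op R X \<subseteq> A"
proof
  have sub: "submod R A" and eq: "t_op R A = A" using assms(1) by (auto simp: t_ideal_def is_ideal_def)
  fix x assume "x \<in> v_op R X"
  then have "x \<in> t_op R A" unfolding t_op_iff[OF R_subring sub] using assms by blast
  then show "x \<in> A" using eq by simp
qed

abbreviation max_t :: "'k set \<Rightarrow> bool" where
  "max_t \<equiv> homogeneous_max_t_ideal \<Gamma> G R"

lemma max_t_ideal:
  assumes "max_t Q"
  shows "is_ideal R Q" "submod R Q" "Q \<subseteq> R" "graded Q" "t_ideal R Q" "1 \<notin> Q" "0 \<in> Q"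
proof -
  show Q: "is_ideal R Q" "graded Q" "t_ideal R Q"
    using assms by (auto simp: homogeneous_max_t_ideal_def homogeneous_ideal_iff)
  then show sub: "submod R Q" "Q \<subseteq> R" by (auto simp: is_ideal_def)
  show "1 \<notin> Q"
  proof
    assume "1 \<in> Q"
    then have "R \<subseteq> Q" using submod_mult[OF sub(1), of _ 1] by auto
    then show False using sub(2) assms by (auto simp: homogeneous_max_t_ideal_def)
  qed
  show "0 \<in> Q" using submod_0[OF sub(1)] .
qed

lemma max_t_not_superset:
  assumes Q: "max_t Q" and X: "finite X" "frac_inv R X \<subseteq> R"
  shows "\<not> X \<subseteq> Q"
proof
  note mt = max_t_ideal[OF Q]
  assume XQ: "X \<subseteq> Q"
  \<comment> \<open>A nonzero \<open>q\<close> is added since \<open>X\<close> might contain nothing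
    but 0, where the t-ideal property gives no information.\<close>
  obtain q where q: "q \<in> Q" "q \<noteq> 0" using mt(5) mt(7) by (auto simp: t_ideal_def)
  have "frac_inv R (insert q X) \<subseteq> R" using X(2) frac_inv_antimono[of X "insert q X" R] by blast
  then have "1 \<in> v_op R (insert q X)" by (simp add: one_in_v_op_iff)
  moreover have "v_op R (insert q X) \<subseteq> Q" using q XQ X(1) by (intro t_idealD[OF mt(5)]) auto
  ultimately show False using mt(6) by blast
qed

text \<open>For homogeneous \<open>a\<close> outside \<open>Q\<close> the colon ideal
  \<open>(Q : a)\<close> is again a proper homogeneous t-ideal containing \<open>Q\<close>, so
  maximality makes it equal to \<open>Q\<close>.\<close>

lemma max_t_hom_prime:
  assumes Q: "max_t Q" and a: "a \<in> R" "hom a" and b: "b \<in> R" "hom b" and ab: "a * b \<in> Q"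
  shows "a \<in> Q \<or> b \<in> Q"
proof (rule ccontr)
  note mt = max_t_ideal[OF Q]
  assume neg: "\<not> (a \<in> Q \<or> b \<in> Q)"
  define P where "P = {x \<in> R. a * x \<in> Q}"
  have QP: "Q \<subseteq> P" using mt(3) submod_mult[OF mt(2) a(1)] by (auto simp: P_def)
  have ideal: "is_ideal R P"
    using mt(2) subring_closed[OF R_subring]
    by (auto simp: P_def is_ideal_def submod_def distrib_left mult.left_commute)
  obtain \<beta> where \<beta>: "a \<in> K \<beta>" using a by (auto simp: hom_def)
  have "graded P" unfolding graded_def
  proof (intro conjI ballI allI subsetI)
    fix x \<alpha> assume x: "x \<in> P"
    then show xW: "x \<in> whole" by (simp add: P_def R_whole)
    have "comp (a * x) (\<alpha> + \<beta>) \<in> Q" using x mt(4) by (auto simp: P_def graded_def)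
    then show "comp x \<alpha> \<in> P"
      using x R_comp by (simp add: comp_mult_hom(2)[OF \<beta> xW] P_def)
  qed
  then have hom: "homogeneous_ideal \<Gamma> G R P" using ideal by (simp add: homogeneous_ideal_iff)
  have P0: "P \<noteq> {0}" using QP mt(5,7) by (auto simp: t_ideal_def)
  have "t_ideal R P"
  proof (rule t_idealI[OF ideal P0])
    fix X assume X: "finite X" "X \<subseteq> P" "\<not> X \<subseteq> {0}"
    show "v_op R X \<subseteq> P"
    proof
      fix x assume x: "x \<in> v_op R X"
      have "v_op R X \<subseteq> R" using X(2) by (intro v_op_subset_ring[OF R_subring]) (auto simp: P_def)
      then have xR: "x \<in> R" using x by blast
      have "a \<noteq> 0" using neg mt(7) by auto
      have "a * x \<in> v_op R ((*) a ` X)" unfolding v_op_iff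
      proof
        fix z assume "z \<in> frac_inv R ((*) a ` X)"
        then have "a * z \<in> frac_inv R X" by (simp add: frac_inv_def mult_ac)
        then have "x * (a * z) \<in> R" using x unfolding v_op_iff by blast
        then show "a * x * z \<in> R" by (simp add: mult_ac)
      qed
      moreover have "v_op R ((*) a ` X) \<subseteq> Q"
      proof (rule t_idealD[OF mt(5)])
        show "\<not> (*) a ` X \<subseteq> {0}" using X(3) \<open>a \<noteq> 0\<close> by auto
      qed (use X in \<open>auto simp: P_def\<close>)
      ultimately show "x \<in> P" using xR by (auto simp: P_def)
    qed
  qed
  moreover have "1 \<notin> P" using neg by (simp add: P_def)
  then have "P \<noteq> R" using subring_1[OF R_subring] by blast
  ultimately have "P = Q" using Q hom QP by (auto simp: homogeneous_max_t_ideal_def)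
  moreover have "b \<in> P" using b ab by (simp add: P_def)
  ultimately show False using neg by blast
qed

lemma max_t_H_mult:
  assumes "max_t Q" "a \<in> H - Q" "b \<in> H - Q"
  shows "a * b \<in> H - Q"
  using assms max_t_hom_prime[OF assms(1), of a b] H_mult[of a b] by (auto simp: H_iff)

lemma max_t_H_power:
  assumes "max_t Q" "a \<in> H - Q"
  shows "a ^ n \<in> H - Q"
  using max_t_H_mult[OF assms(1)] assms max_t_ideal(6)[OF assms(1)] H_1 by (induction n) auto

lemma max_t_component:
  assumes "max_t Q" "f \<in> R" "f \<notin> Q"
  obtains \<gamma> where "comp f \<gamma> \<in> H - Q"
proof -
  note mt = max_t_ideal[OF assms(1)]
  obtain \<gamma> where \<gamma>: "comp f \<gamma> \<notin> Q"
    using graded_sum_mem[OF mt(4,2) R_whole[OF assms(2)]] assms(3) by blast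
  then have "comp f \<gamma> \<noteq> 0" using mt(7) by auto
  then have "comp f \<gamma> \<in> H - Q"
    using \<gamma> R_comp[OF assms(2)] hom_comp[OF R_whole[OF assms(2)]] by (simp add: H_iff)
  then show ?thesis by (rule that)
qed

text \<open>Some component of \<open>f\<close> is outside \<open>Q\<close>, and a power of it
  multiplies \<open>g\<close> into \<open>Q\<close>. Taking components leaves products of
  homogeneous elements, where primality is known.\<close>

lemma max_t_prime:
  assumes Q: "max_t Q" and f: "f \<in> R" "f \<notin> Q" and g: "g \<in> R" and fg: "g * f \<in> Q"
  shows "g \<in> Q"
proof -
  note mt = max_t_ideal[OF Q]
  obtain \<gamma> where \<gamma>: "comp f \<gamma> \<in> H - Q" using max_t_component[OF Q f] by blast
  have "\<exists>n. comp f \<gamma> ^ n * g \<in> Q"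
  proof (rule component_power_mult[OF mt(4)])
    show "x - y \<in> Q" if "x \<in> Q" "y \<in> Q" for x y
      using submod_add[OF mt(2) that(1) submod_mult[OF mt(2) _ that(2), of "- 1"]]
        subring_uminus[OF R_subring subring_1[OF R_subring]] by simp
    show "comp f \<alpha> * m \<in> Q" if "m \<in> Q" for \<alpha> m
      using submod_mult[OF mt(2) R_comp[OF f(1)] that] .
  qed (use mt f g fg R_whole in auto)
  then obtain n where n: "comp f \<gamma> ^ n * g \<in> Q" by blast
  have p: "comp f \<gamma> ^ n \<in> H - Q" using max_t_H_power[OF Q \<gamma>] .
  then obtain \<delta> where \<delta>: "comp f \<gamma> ^ n \<in> K \<delta>" by (auto simp: H_iff hom_def)
  have gW: "g \<in> whole" using R_whole[OF g] .
  have "comp g \<beta> \<in> Q" for \<beta>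
  proof -
    have "comp (comp f \<gamma> ^ n * g) (\<beta> + \<delta>) \<in> Q" using n mt(4) by (auto simp: graded_def)
    then have "comp f \<gamma> ^ n * comp g \<beta> \<in> Q" by (simp add: comp_mult_hom(2)[OF \<delta> gW])
    then show ?thesis
      using max_t_hom_prime[OF Q _ _ R_comp[OF g] hom_comp[OF gW]] p by (auto simp: H_iff)
  qed
  then show ?thesis using graded_sum_mem[OF mt(4,2) gW] by blast
qed

text \<open>Zorn's lemma is applied to the homogeneous ideals above \<open>J\<close> with proper
  t-closure. A maximal one equals its t-closure because the t-closure belongs to the same
  family.\<close>

lemma max_t_exists:
  assumes J: "is_ideal R J" "graded J" "J \<noteq> {0}"
    and proper: "\<And>X. finite X \<Longrightarrow> X \<subseteq> J \<Longrightarrow> \<not> X \<subseteq> {0} \<Longrightarrow> \<not> frac_inv R X \<subseteq> R"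
  obtains Q where "max_t Q" "J \<subseteq> Q"
proof -
  define \<A> where "\<A> = {P. is_ideal R P \<and> graded P \<and> J \<subseteq> P \<and>
    (\<forall>X. finite X \<and> X \<subseteq> P \<and> \<not> X \<subseteq> {0} \<longrightarrow> \<not> frac_inv R X \<subseteq> R)}"
  have "\<exists>M\<in>\<A>. \<forall>P\<in>\<A>. M \<subseteq> P \<longrightarrow> P = M"
  proof (rule subset_Zorn_nonempty)
    have "J \<in> \<A>" unfolding \<A>_def using J proper by blast
    then show "\<A> \<noteq> {}" by blast
    fix C assume C: "C \<noteq> {}" "subset.chain \<A> C"
    have CA: "P \<in> \<A>" if "P \<in> C" for P using C(2) that by (auto simp: subset.chain_def)
    have Csub: "submod R P" and CR: "P \<subseteq> R" and CJ: "J \<subseteq> P" and Cg: "graded P" if "P \<in> C" for P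
      using CA[OF that] by (simp_all add: \<A>_def is_ideal_def)
    have total: "P \<subseteq> P' \<or> P' \<subseteq> P" if "P \<in> C" "P' \<in> C" for P P'
      using C(2) that unfolding subset.chain_def by blast
    have cover: "\<exists>P\<in>C. X \<subseteq> P" if "finite X" "X \<subseteq> \<Union>C" for X
      using that
    proof (induction X)
      case empty
      then show ?case using C(1) by blast
    next
      case (insert x X)
      then obtain P P' where "P \<in> C" "X \<subseteq> P" "P' \<in> C" "x \<in> P'" by blast
      then show ?case using total[of P P'] by blast
    qed
    have "is_ideal R (\<Union>C)" unfolding is_ideal_def submod_def
    proof (intro conjI ballI)
      show "0 \<in> \<Union>C" using C(1) submod_0[OF Csub] by blast
      show "x + y \<in> \<Union>C" if "x \<in> \<Union>C" "y \<in> \<Union>C" for x y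
      proof -
        obtain P where "P \<in> C" "x \<in> P" "y \<in> P"
          using cover[of "{x, y}"] \<open>x \<in> \<Union>C\<close> \<open>y \<in> \<Union>C\<close> by auto
        then show ?thesis using submod_add[OF Csub] by blast
      qed
      show "r * x \<in> \<Union>C" if "r \<in> R" "x \<in> \<Union>C" for r x
        using that submod_mult[OF Csub] by blast
      show "\<Union>C \<subseteq> R" using CR by blast
    qed
    moreover have "graded (\<Union>C)" using Cg unfolding graded_def by blast
    moreover have "J \<subseteq> \<Union>C" using C(1) CJ by blast
    moreover have "\<not> frac_inv R X \<subseteq> R" if X: "finite X" "X \<subseteq> \<Union>C" "\<not> X \<subseteq> {0}" for X
    proof -
      obtain P where "P \<in> C" "X \<subseteq> P" using cover[OF X(1,2)] by blast
      then show ?thesis using CA[of P] X unfolding \<A>_def by blast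
    qed
    ultimately show "\<Union>C \<in> \<A>" by (simp add: \<A>_def)
  qed
  then obtain M where "M \<in> \<A>" and max: "\<And>P. P \<in> \<A> \<Longrightarrow> M \<subseteq> P \<Longrightarrow> P = M" by blast
  then have M: "is_ideal R M" "graded M" "J \<subseteq> M"
    and Mp: "\<And>X. finite X \<Longrightarrow> X \<subseteq> M \<Longrightarrow> \<not> X \<subseteq> {0} \<Longrightarrow> \<not> frac_inv R X \<subseteq> R"
    unfolding \<A>_def by blast+
  have sub: "submod R M" and MR: "M \<subseteq> R" using M(1) by (auto simp: is_ideal_def)
  note t_iff = t_op_iff[OF R_subring sub]
  obtain m where m: "m \<in> M" "m \<noteq> 0" using M(3) J(1,3) by (auto simp: is_ideal_def submod_def)
  define P where "P = t_op R M"
  have "M \<noteq> {0}" using m by blast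
  then have MP: "M \<subseteq> P" unfolding P_def by (rule subset_t_op[OF R_subring sub])
  have cover: "\<exists>Y. finite Y \<and> Y \<subseteq> M \<and> \<not> Y \<subseteq> {0} \<and> X \<subseteq> v_op R Y" if "finite X" "X \<subseteq> P" for X
    using that
  proof (induction X)
    case empty
    then show ?case using m by (intro exI[of _ "{m}"]) auto
  next
    case (insert x X)
    then obtain Y Z where "finite Y" "Y \<subseteq> M" "\<not> Y \<subseteq> {0}" "X \<subseteq> v_op R Y"
      "finite Z" "Z \<subseteq> M" "x \<in> v_op R Z" unfolding P_def t_iff insert_subset by blast
    moreover have "v_op R Y \<subseteq> v_op R (Y \<union> Z)" "v_op R Z \<subseteq> v_op R (Y \<union> Z)"
      by (auto intro!: v_op_mono)
    ultimately show ?case by (intro exI[of _ "Y \<union> Z"]) auto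
  qed
  have Pideal: "is_ideal R P" unfolding is_ideal_def submod_def
  proof (intro conjI ballI subsetI)
    show "0 \<in> P" using MP submod_0[OF sub] by blast
    show "x + y \<in> P" if xy: "x \<in> P" "y \<in> P" for x y
    proof -
      obtain Y where Y: "finite Y" "Y \<subseteq> M" "\<not> Y \<subseteq> {0}" "{x, y} \<subseteq> v_op R Y" using cover[of "{x, y}"] xy by auto
      then have "x + y \<in> v_op R Y" using submod_add[OF submod_v_op[OF R_subring]] by blast
      then show ?thesis unfolding P_def t_iff using Y by blast
    qed
    show "r * x \<in> P" if "r \<in> R" "x \<in> P" for r x
      using that submod_mult[OF submod_v_op[OF R_subring]] unfolding P_def t_iff by blast
    show "x \<in> R" if "x \<in> P" for x
      using that v_op_subset_ring[OF R_subring] MR unfolding P_def t_iff by blast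
  qed
  have "graded P" unfolding graded_def
  proof (intro conjI ballI allI subsetI)
    fix x \<alpha> assume x: "x \<in> P"
    then show "x \<in> whole" using Pideal R_whole by (auto simp: is_ideal_def)
    obtain Y where Y: "finite Y" "Y \<subseteq> M" "\<not> Y \<subseteq> {0}" "x \<in> v_op R Y"
      using x unfolding P_def t_iff by blast
    have YW: "Y \<subseteq> whole" using Y(2) MR R_whole by blast
    have cY: "finite (comps Y)" "comps Y \<subseteq> M" "\<not> comps Y \<subseteq> {0}"
      using finite_comps[OF Y(1) YW] comps_subset[OF M(2) Y(2)] comps_nonzero[OF YW Y(3)] by auto
    have hY: "hom y" if "y \<in> comps Y" for y using comps_hom[OF YW that] .
    have gr: "graded (frac_inv R (comps Y))" using hY cY(3) by (rule frac_inv_graded)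
    have xv: "x \<in> v_op R (comps Y)" using Y(4) frac_inv_comps[OF YW] unfolding v_op_iff by blast
    \<comment> \<open>Presenting the v-closure as the inverse of a set of homogeneous elements makes
      \<open>frac_inv_graded\<close> applicable, which yields homogeneity of the t-closure.\<close>
    have inv_comps: "v_op R (comps Y) = frac_inv R {z \<in> frac_inv R (comps Y). hom z}"
    proof
      show "v_op R (comps Y) \<subseteq> frac_inv R {z \<in> frac_inv R (comps Y). hom z}"
        unfolding v_op_def by (rule frac_inv_antimono) auto
      show "frac_inv R {z \<in> frac_inv R (comps Y). hom z} \<subseteq> v_op R (comps Y)"
      proof
        fix w assume w: "w \<in> frac_inv R {z \<in> frac_inv R (comps Y). hom z}"
        have "w * z \<in> R" if z: "z \<in> frac_inv R (comps Y)" for z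
        proof (rule comps_mult_mem)
          show "z \<in> whole" using z gr by (auto simp: graded_def)
          then show "w * c \<in> R" if "c \<in> comps {z}" for c
            using that w z gr hom_comp by (auto simp: comps_def frac_inv_def[of R "{z. _ z}"] graded_def)
        qed
        then show "w \<in> v_op R (comps Y)" unfolding v_op_iff by blast
      qed
    qed
    have "1 \<in> frac_inv R (comps Y)" using cY(2) MR by (auto simp: frac_inv_def)
    then have "\<not> {z \<in> frac_inv R (comps Y). hom z} \<subseteq> {0}" using hom_1 by auto
    then have "graded (v_op R (comps Y))" unfolding inv_comps by (intro frac_inv_graded) auto
    then have "comp x \<alpha> \<in> v_op R (comps Y)" using xv by (simp add: graded_def)
    then show "comp x \<alpha> \<in> P" unfolding P_def t_iff using cY by blast
  qed
  have "\<not> frac_inv R X \<subseteq> R" if X: "finite X" "X \<subseteq> P" for X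
  proof
    assume "frac_inv R X \<subseteq> R"
    obtain Y where Y: "finite Y" "Y \<subseteq> M" "\<not> Y \<subseteq> {0}" "X \<subseteq> v_op R Y" using cover[OF X] by blast
    have "frac_inv R Y \<subseteq> frac_inv R X"
      using frac_inv_antimono[OF Y(4), of R] by (simp add: frac_inv_v_op)
    then show False using \<open>frac_inv R X \<subseteq> R\<close> Mp[OF Y(1-3)] by blast
  qed
  then have "P \<in> \<A>" using Pideal \<open>graded P\<close> MP M(3) by (auto simp: \<A>_def)
  then have "P = M" using MP by (rule max)
  have "max_t M" unfolding homogeneous_max_t_ideal_def
  proof (intro conjI allI impI)
    show "homogeneous_ideal \<Gamma> G R M" using M by (simp add: homogeneous_ideal_iff)
    show "t_ideal R M" using \<open>P = M\<close> M m by (auto simp: t_ideal_def P_def)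
    show "M \<noteq> R"
    proof
      assume "M = R"
      then have "\<not> frac_inv R {1} \<subseteq> R" using Mp[of "{1}"] subring_1[OF R_subring] by simp
      then show False by (simp add: frac_inv_def)
    qed
    fix N assume N: "homogeneous_ideal \<Gamma> G R N \<and> t_ideal R N \<and> N \<noteq> R \<and> M \<subseteq> N"
    then have ideal: "is_ideal R N" and "graded N" by (auto simp: homogeneous_ideal_iff)
    have "1 \<notin> N"
    proof
      assume "1 \<in> N"
      then have "R \<subseteq> N" using ideal by (force simp: is_ideal_def submod_def)
      then show False using N ideal by (auto simp: is_ideal_def)
    qed
    have "\<not> frac_inv R X \<subseteq> R" if X: "finite X" "X \<subseteq> N" "\<not> X \<subseteq> {0}" for X
    proof
      assume "frac_inv R X \<subseteq> R"
      then have "1 \<in> v_op R X" by (simp add: one_in_v_op_iff)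
      then show False using t_idealD[of N X] N X \<open>1 \<notin> N\<close> by blast
    qed
    then have "N \<in> \<A>" using ideal \<open>graded N\<close> N M(3) by (auto simp: \<A>_def)
    then show "N = M" using N by (intro max) auto
  qed
  then show ?thesis using M(3) by (rule that)
qed


section \<open>Homogeneous localizations at maximal t-ideals\<close>

abbreviation V :: "'k set \<Rightarrow> 'k set" where "V Q \<equiv> localization R (H - Q)"

lemma V_iff: "x \<in> V Q \<longleftrightarrow> (\<exists>s\<in>H - Q. s * x \<in> R)"
  by (rule localization_iff) (simp add: H_iff)

lemma V_subring: "max_t Q \<Longrightarrow> is_subring (V Q)"
  and R_subset_V: "max_t Q \<Longrightarrow> R \<subseteq> V Q"
proof -
  assume Q: "max_t Q"
  have "1 \<in> H - Q" "0 \<notin> H - Q" "H - Q \<subseteq> R" using max_t_ideal(6)[OF Q] H_1 by (auto simp: H_iff)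
  note L = subring_localization[OF R_subring this max_t_H_mult[OF Q]]
  show "is_subring (V Q)" "R \<subseteq> V Q" by (rule L; assumption)+
qed

lemma V_graded: "graded (V Q)"
  unfolding graded_def
proof (intro conjI ballI allI subsetI)
  fix x \<alpha> assume "x \<in> V Q"
  then obtain s where s: "s \<in> H - Q" "s * x \<in> R" unfolding V_iff by blast
  then show xW: "x \<in> whole" using whole_iff by blast
  obtain \<beta> where \<beta>: "s \<in> K \<beta>" using s by (auto simp: H_iff hom_def)
  have "comp (s * x) (\<alpha> + \<beta>) \<in> R" using s(2) by (rule R_comp)
  then have "s * comp x \<alpha> \<in> R" by (simp add: comp_mult_hom(2)[OF \<beta> xW])
  then show "comp x \<alpha> \<in> V Q" unfolding V_iff using s(1) by blast
qed

lemma V_common_denominator: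
  assumes Q: "max_t Q" and X: "finite X" "X \<subseteq> V Q"
  shows "\<exists>s\<in>H - Q. \<forall>x\<in>X. s * x \<in> R"
proof (rule common_denominator[OF max_t_H_mult[OF Q] _ R_subring _ X(1)])
  show "\<forall>x\<in>X. \<exists>s\<in>H - Q. s * x \<in> R" using X(2) V_iff by blast
  show "1 \<in> H - Q" using max_t_ideal(6)[OF Q] H_1 by blast
qed (auto simp: H_iff)

lemma V_inverse:
  assumes "s \<in> H - Q"
  shows "inverse s \<in> V Q"
proof -
  have "s * inverse s = 1" using assms by (simp add: H_iff)
  then have "s * inverse s \<in> R" using subring_1[OF R_subring] by simp
  then show ?thesis unfolding V_iff using assms by blast
qed

text \<open>A nonzero homogeneous \<open>y\<close> is a quotient of two homogeneous elements of
  \<open>R\<close>, so comparing pairs in \<open>V Q\<close> amounts to testing single elements of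
  \<open>whole\<close>.\<close>

lemma graded_valuation_iff:
  assumes Q: "max_t Q"
  shows "graded_valuation_domain (\<lambda>\<alpha>. V Q \<inter> K \<alpha>) (V Q) \<longleftrightarrow>
    (\<forall>y. hom y \<longrightarrow> y \<noteq> 0 \<longrightarrow> y \<in> V Q \<or> inverse y \<in> V Q)"
proof -
  have homs: "homs UNIV (\<lambda>\<alpha>. V Q \<inter> K \<alpha>) = {x \<in> V Q. hom x \<and> x \<noteq> 0}"
    by (auto simp: homs_def hom_def)
  have 1: "a / b \<in> V Q \<or> b / a \<in> V Q"
    if "\<forall>y. hom y \<longrightarrow> y \<noteq> 0 \<longrightarrow> y \<in> V Q \<or> inverse y \<in> V Q" "hom a" "a \<noteq> 0" "hom b" "b \<noteq> 0" for a b
    using that(1)[rule_format, OF hom_divide[OF that(2,4)]] that(3,5) by simp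
  have 2: "y \<in> V Q \<or> inverse y \<in> V Q"
    if val: "\<forall>a\<in>homs UNIV (\<lambda>\<alpha>. V Q \<inter> K \<alpha>). \<forall>b\<in>homs UNIV (\<lambda>\<alpha>. V Q \<inter> K \<alpha>). a / b \<in> V Q \<or> b / a \<in> V Q"
      and y: "hom y" "y \<noteq> 0" for y
  proof -
    obtain h where h: "h \<in> H" "h * y \<in> R" using hom_whole[OF y(1)] unfolding whole_iff by blast
    have "h \<in> homs UNIV (\<lambda>\<alpha>. V Q \<inter> K \<alpha>)" "h * y \<in> homs UNIV (\<lambda>\<alpha>. V Q \<inter> K \<alpha>)"
      unfolding homs using h y hom_mult[OF _ y(1), of h] R_subset_V[OF Q] by (auto simp: H_iff)
    then have "h * y / h \<in> V Q \<or> h / (h * y) \<in> V Q" using val by blast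
    moreover have "h * y / h = y" "h / (h * y) = inverse y" using h(1) y by (simp_all add: H_iff field_simps)
    ultimately show ?thesis by simp
  qed
  have "graded_valuation_domain (\<lambda>\<alpha>. V Q \<inter> K \<alpha>) (V Q) \<longleftrightarrow>
    (\<forall>a\<in>homs UNIV (\<lambda>\<alpha>. V Q \<inter> K \<alpha>). \<forall>b\<in>homs UNIV (\<lambda>\<alpha>. V Q \<inter> K \<alpha>). a / b \<in> V Q \<or> b / a \<in> V Q)"
    unfolding graded_valuation_domain_def using graded_ring_iff[OF V_subring[OF Q] V_graded] by simp
  also have "\<dots> \<longleftrightarrow> (\<forall>y. hom y \<longrightarrow> y \<noteq> 0 \<longrightarrow> y \<in> V Q \<or> inverse y \<in> V Q)"
    using 1 2 unfolding homs by blast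
  finally show ?thesis .
qed

section \<open>Implications through the graded-valuation condition\<close>

definition all_graded_valuation :: bool where
  "all_graded_valuation \<longleftrightarrow> (\<forall>Q. max_t Q \<longrightarrow> graded_valuation_domain (\<lambda>\<alpha>. V Q \<inter> K \<alpha>) (V Q))"

lemma all_graded_valuationI:
  "(\<And>Q y. max_t Q \<Longrightarrow> hom y \<Longrightarrow> y \<noteq> 0 \<Longrightarrow> y \<in> V Q \<or> inverse y \<in> V Q) \<Longrightarrow> all_graded_valuation"
  unfolding all_graded_valuation_def using graded_valuation_iff by blast

lemma hom_tinv_if_fg_t_invertible:
  assumes "\<forall>A. nonzero_fg_ideal R A \<and> homogeneous_ideal \<Gamma> G R A \<longrightarrow> t_invertible R A"
  shows hom_tinv
proof (rule hom_tinvI)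
  fix A assume A: "finite A" "A \<subseteq> H" "A \<noteq> {}"
  then have AR: "A \<subseteq> R" and A0: "\<not> A \<subseteq> {0}" by (auto simp: H_iff)
  let ?I = "submod R hull A"
  have "nonzero_fg_ideal R ?I" unfolding nonzero_fg_ideal_iff[OF R_subring] using A(1) AR A0 by blast
  moreover have "homogeneous_ideal \<Gamma> G R ?I"
    using A(2) hull_subset_ring[OF R_subring AR] by (auto simp: homogeneous_ideal_def is_ideal_def submod_hull)
  ultimately have "t_invertible R ?I" using assms by blast
  then show "tinv R A" using t_invertible_iff[OF R_subring A(1) A0] by blast
qed

text \<open>The products of \<open>{1, y}\<close> with a witness have trivial inverse, so they do
  not all lie in \<open>Q\<close>. Hence some \<open>b\<close> or \<open>b * y\<close>, both in
  \<open>R\<close>, is outside \<open>Q\<close> and serves as denominator of \<open>y\<close> or of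
  its inverse.\<close>

lemma PvMD_imp_valuation:
  assumes "PvMD R" and Q: "max_t Q"
  shows "valuation_domain (localization R (R - Q))"
proof -
  let ?L = "localization R (R - Q)"
  note mt = max_t_ideal[OF Q]
  have mult: "a * b \<in> R - Q" if "a \<in> R - Q" "b \<in> R - Q" for a b
    using that max_t_prime[OF Q, of b a] subring_mult[OF R_subring] by blast
  have S: "1 \<in> R - Q" "0 \<notin> R - Q" "R - Q \<subseteq> R" using mt subring_1[OF R_subring] by auto
  note L = subring_localization[OF R_subring S mult]
  have L_iff: "x \<in> ?L \<longleftrightarrow> (\<exists>s\<in>R - Q. s * x \<in> R)" for x using S(2) by (rule localization_iff)
  have qf: "domain_in_qf ?L" using R_qf L by (rule domain_in_qf_mono)
  have "y \<in> ?L \<or> inverse y \<in> ?L" if y: "y \<noteq> 0" for y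
  proof -
    obtain B where B: "finite B" "B \<subseteq> frac_inv R {1, y}" "frac_inv R (products {1, y} B) \<subseteq> R"
      using tinv_fractional[OF assms(1), of "{1, y}"] unfolding tinv_def by auto
    have "\<not> products {1, y} B \<subseteq> Q"
      using max_t_not_superset[OF Q _ B(3)] finite_products[of "{1, y}" B] B(1) by simp
    then obtain a b where ab: "a \<in> {1, y}" "b \<in> B" "a * b \<notin> Q" by (auto simp: products_def)
    have b: "b \<in> R" "b * y \<in> R" using ab(2) B(2) by (auto simp: frac_inv_def)
    show ?thesis
    proof (cases "a = 1")
      case True
      then show ?thesis unfolding L_iff using ab(3) b by auto
    next
      case False
      then have "b * y \<in> R - Q" using ab b by (auto simp: mult.commute)
      moreover have "b * y * inverse y \<in> R" using b y by (simp add: mult.assoc)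
      ultimately show ?thesis unfolding L_iff by blast
    qed
  qed
  then have "a / b \<in> ?L \<or> b / a \<in> ?L" if "a \<noteq> 0" "b \<noteq> 0" for a b
    using that by (metis divide_eq_0_iff inverse_divide)
  then show ?thesis using qf by (simp add: valuation_domain_def)
qed

text \<open>Homogeneous elements of the full localization already lie in \<open>V Q\<close>: a
  denominator outside \<open>Q\<close> has a component outside \<open>Q\<close>, which is a
  denominator as well.\<close>

lemma valuation_imp_graded_valuation:
  assumes "\<forall>Q. max_t Q \<longrightarrow> valuation_domain (localization R (R - Q))"
  shows all_graded_valuation
proof (rule all_graded_valuationI)
  fix Q y assume Q: "max_t Q" and y: "hom y" "y \<noteq> 0"
  note mt = max_t_ideal[OF Q]
  let ?L = "localization R (R - Q)"
  have L_iff: "x \<in> ?L \<longleftrightarrow> (\<exists>s\<in>R - Q. s * x \<in> R)" for x using mt(7) by (intro localization_iff) simp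
  have LV: "x \<in> V Q" if x: "hom x" and xL: "x \<in> ?L" for x
  proof -
    obtain s where s: "s \<in> R" "s \<notin> Q" "s * x \<in> R" using xL unfolding L_iff by blast
    obtain \<gamma> where \<gamma>: "comp s \<gamma> \<in> H - Q" using max_t_component[OF Q s(1,2)] by blast
    obtain \<beta> where \<beta>: "x \<in> K \<beta>" using x by (auto simp: hom_def)
    have "comp (x * s) (\<gamma> + \<beta>) \<in> R" using s(3) by (intro R_comp) (simp add: mult.commute)
    then have "x * comp s \<gamma> \<in> R" by (simp add: comp_mult_hom(2)[OF \<beta> R_whole[OF s(1)]])
    then have "comp s \<gamma> * x \<in> R" by (simp add: mult.commute)
    then show ?thesis unfolding V_iff using \<gamma> by blast
  qed
  obtain h where h: "h \<in> H" "h * y \<in> R" using hom_whole[OF y(1)] unfolding whole_iff by blast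
  have RL: "r \<in> ?L" if "r \<in> R" for r
    unfolding L_iff using that mt(6) subring_1[OF R_subring] by (intro bexI[of _ 1]) auto
  have "h * y / h \<in> ?L \<or> h / (h * y) \<in> ?L"
  proof -
    have "\<forall>a\<in>?L. \<forall>b\<in>?L. a \<noteq> 0 \<longrightarrow> b \<noteq> 0 \<longrightarrow> a / b \<in> ?L \<or> b / a \<in> ?L"
      using assms Q unfolding valuation_domain_def by blast
    moreover have "h * y \<in> ?L" "h \<in> ?L" "h * y \<noteq> 0" "h \<noteq> 0" using RL h y by (simp_all add: H_iff)
    ultimately show ?thesis by blast
  qed
  moreover have "h * y / h = y" "h / (h * y) = inverse y" using h(1) y by (simp_all add: H_iff field_simps)
  ultimately show "y \<in> V Q \<or> inverse y \<in> V Q"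
    using LV[OF y(1)] LV[OF hom_inverse[OF y(1)]] by auto
qed

text \<open>In \<open>V Q\<close> some \<open>a\<close> in \<open>A\<close> divides all of
  \<open>A\<close>, so \<open>s / a\<close> lies in A^-1 for a suitable homogeneous \<open>s\<close>
  outside \<open>Q\<close>. Then \<open>s\<close> itself lies in the ideal generated by A A^-1,
  which was supposed to be inside \<open>Q\<close>.\<close>

lemma graded_valuation_imp_hom_tinv:
  assumes all_graded_valuation
  shows hom_tinv
proof (rule hom_tinvI, rule ccontr)
  fix A assume A: "finite A" "A \<subseteq> H" "A \<noteq> {}" and not: "\<not> tinv R A"
  have A0: "\<not> A \<subseteq> {0}" and AR: "A \<subseteq> R" and Ah: "\<And>a. a \<in> A \<Longrightarrow> hom a \<and> a \<noteq> 0"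
    using A by (auto simp: H_iff)
  define P where "P = products A (frac_inv R A)"
  define J where "J = submod R hull P"
  have PR: "P \<subseteq> R" by (simp add: P_def products_subset_iff)
  have ideal: "is_ideal R J"
    unfolding J_def is_ideal_def using submod_hull hull_subset_ring[OF R_subring PR] by blast
  have PJ: "P \<subseteq> J" unfolding J_def by (rule hull_subset)
  have gr: "graded (frac_inv R A)" using Ah A0 by (intro frac_inv_graded) auto
  have "p \<in> whole \<and> comp p \<alpha> \<in> P" if "p \<in> P" for p \<alpha>
  proof -
    obtain a b where ab: "a \<in> A" "b \<in> frac_inv R A" "p = a * b"
      using \<open>p \<in> P\<close> by (auto simp: P_def products_def)
    obtain \<beta> where \<beta>: "a \<in> K \<beta>" using Ah[OF ab(1)] by (auto simp: hom_def)
    have bW: "b \<in> whole" and cb: "\<And>\<alpha>. comp b \<alpha> \<in> frac_inv R A" using gr ab(2) by (auto simp: graded_def)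
    show ?thesis using comp_mult_hom[OF \<beta> bW] products_memI[OF ab(1) cb] by (simp add: ab(3) P_def)
  qed
  then have Jgr: "graded J" unfolding J_def using PJ by (intro graded_hull) (auto simp: J_def)
  obtain a0 where a0: "a0 \<in> A" using A(3) by blast
  have "1 \<in> frac_inv R A" using AR by (auto simp: frac_inv_def)
  then have "a0 * 1 \<in> J" using PJ products_memI[OF a0] unfolding P_def by blast
  then have J0: "J \<noteq> {0}" using Ah[OF a0] by auto
  have "t_op R J \<noteq> R"
  proof
    assume t: "t_op R J = R"
    have "ideal_mult R (submod R hull A) (frac_inv R (submod R hull A)) = J"
      unfolding J_def P_def by (rule ideal_mult_hull[OF R_subring])
    then have "t_invertible R (submod R hull A)" using t by (simp add: t_invertible_def)
    then show False using t_invertible_iff[OF R_subring A(1) A0] not by blast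
  qed
  then have proper: "\<not> frac_inv R X \<subseteq> R" if "finite X" "X \<subseteq> J" "\<not> X \<subseteq> {0}" for X
    using that unfolding t_op_eq_ring_iff[OF R_subring ideal] by blast
  obtain Q where Q: "max_t Q" "J \<subseteq> Q" using max_t_exists[OF ideal Jgr J0 proper] by blast
  have val: "y \<in> V Q \<or> inverse y \<in> V Q" if "hom y" "y \<noteq> 0" for y
    using assms Q(1) that graded_valuation_iff unfolding all_graded_valuation_def by blast
  have "\<exists>a\<in>A. \<forall>b\<in>A. b * inverse a \<in> V Q"
    using A(1,3) Ah
  proof (induction A rule: finite_ne_induct)
    case (singleton x)
    then show ?case using subring_1[OF V_subring[OF Q(1)]] by simp
  next
    case (insert x F)
    then obtain a where a: "a \<in> F" "\<And>b. b \<in> F \<Longrightarrow> b * inverse a \<in> V Q" by auto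
    have nz: "x \<noteq> 0" "a \<noteq> 0" "hom x" "hom a" using insert.prems a(1) by auto
    have "x * inverse a \<in> V Q \<or> inverse (x * inverse a) \<in> V Q"
      using nz by (intro val hom_mult hom_inverse) auto
    then show ?case
    proof
      assume "x * inverse a \<in> V Q"
      then show ?thesis using a by blast
    next
      assume "inverse (x * inverse a) \<in> V Q"
      then have ax: "a * inverse x \<in> V Q" by (simp add: mult.commute)
      have "b * inverse x \<in> V Q" if "b \<in> F" for b
      proof -
        have "b * inverse a * (a * inverse x) \<in> V Q"
          using a(2)[OF that] ax by (rule subring_mult[OF V_subring[OF Q(1)]])
        then show ?thesis using nz(2) by (simp add: mult.assoc flip: mult.assoc[of "inverse a" a])
      qed
      moreover have "x * inverse x \<in> V Q" using nz subring_1[OF V_subring[OF Q(1)]] by simp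
      ultimately show ?thesis by blast
    qed
  qed
  then obtain a where a: "a \<in> A" "\<forall>b\<in>A. b * inverse a \<in> V Q" by blast
  then have "(\<lambda>b. b * inverse a) ` A \<subseteq> V Q" by blast
  then obtain s where s: "s \<in> H - Q" "\<forall>b\<in>A. s * (b * inverse a) \<in> R"
    using V_common_denominator[OF Q(1), of "(\<lambda>b. b * inverse a) ` A"] A(1) by auto
  then have "s * inverse a \<in> frac_inv R A" by (simp add: frac_inv_def mult_ac)
  then have "a * (s * inverse a) \<in> J" using PJ a(1) products_memI unfolding P_def by blast
  moreover have "a * (s * inverse a) = s" using Ah[OF a(1)] by simp
  ultimately show False using s(1) Q(2) by auto
qed

lemma PvMD_imp_integrally_closed:
  assumes "PvMD R" "t_linked R T"
  shows "integrally_closed T"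
  using t_linked_integrally_closed[OF R_subring tinv_fractional[OF assms(1)] assms(2)] .

lemma t_linked_self: "t_linked R R"
  unfolding t_linked_iff[OF R_subring] using R_subring by blast

text \<open>For \<open>y = a/b\<close> the element \<open>a b\<close> lies in \<open>(a\<^sup>2, b\<^sup>2)\<^sub>v\<close>, since \<open>(z a b)\<^sup>2 = z a\<^sup>2 \<cdot> z b\<^sup>2\<close>.
  Membership in the w-closure gives an equation \<open>s y = r y\<^sup>2 + q\<close> with \<open>s\<close> outside \<open>Q\<close>, and \<open>r y\<close>
  is integral over \<open>R\<close>.\<close>

lemma t_eq_w_imp_graded_valuation:
  assumes ic: "integrally_closed R"
    and tw: "\<forall>I. homogeneous_ideal \<Gamma> G R I \<and> I \<noteq> {0} \<longrightarrow> t_op R I = w_op R I"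
  shows all_graded_valuation
proof (rule all_graded_valuationI)
  fix Q y assume Q: "max_t Q" and y: "hom y" "y \<noteq> 0"
  note mt = max_t_ideal[OF Q]
  obtain b where b: "b \<in> H" "b * y \<in> R" using hom_whole[OF y(1)] unfolding whole_iff by blast
  define a where "a = b * y"
  have a: "a \<in> H" using b y hom_mult[OF _ y(1), of b] by (simp add: a_def H_iff)
  have aR: "a \<in> R" and bR: "b \<in> R" using a b by (simp_all add: H_iff)
  define I where "I = submod R hull {a * a, b * b}"
  have I: "submod R I" "a * a \<in> I" "b * b \<in> I" by (auto simp: I_def submod_hull intro: hull_inc)
  have X: "{a * a, b * b} \<subseteq> H" using a b H_mult by simp
  then have "I \<subseteq> R" unfolding I_def by (intro hull_subset_ring[OF R_subring]) (auto simp: H_iff)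
  then have homI: "homogeneous_ideal \<Gamma> G R I"
    unfolding homogeneous_ideal_def is_ideal_def using I(1) X I_def by blast
  have "I \<noteq> {0}" using I(2) a by (auto simp: H_iff)
  have "a * b \<in> v_op R {a * a, b * b}" unfolding v_op_iff
  proof
    fix z assume "z \<in> frac_inv R {a * a, b * b}"
    then have "z * (a * a) * (z * (b * b)) \<in> R"
      by (intro subring_mult[OF R_subring, of "z * (a * a)"]) (simp_all add: frac_inv_def)
    \<comment> \<open>The element is a square root of the product of \<open>z * (a * a)\<close> and
      \<open>z * (b * b)\<close>.\<close>
    then have "integral_over R (a * b * z)"
      by (intro integral_overI[OF R_subring, where m = 2 and c = "\<lambda>k. if k = 0 then z * (a * a) * (z * (b * b)) else 0"])
         (auto simp: subring_0[OF R_subring] numeral_2_eq_2 mult_ac)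
    then show "a * b * z \<in> R" using ic by (auto simp: integrally_closed_def)
  qed
  then have "a * b \<in> t_op R I"
    unfolding t_op_iff[OF R_subring I(1)] using I(2,3) a
    by (intro exI[of _ "{a * a, b * b}"]) (auto simp: H_iff)
  then have "a * b \<in> w_op R I" using tw homI \<open>I \<noteq> {0}\<close> by blast
  then obtain J where J: "nonzero_fg_ideal R J" "v_op R J = R" "\<forall>j\<in>J. a * b * j \<in> I"
    unfolding w_op_def by blast
  obtain Y where Y: "finite Y" "Y \<subseteq> R" "J = submod R hull Y"
    using J(1) unfolding nonzero_fg_ideal_iff[OF R_subring] by blast
  have "frac_inv R Y \<subseteq> R"
    using J(2) Y(2) unfolding Y(3) by (simp add: v_op_hull R_subring v_op_eq_ring_iff)
  then obtain j where j: "j \<in> Y" "j \<notin> Q" using max_t_not_superset[OF Q Y(1)] by blast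
  have jR: "j \<in> R" using j Y(2) by blast
  obtain \<gamma> where \<gamma>: "comp j \<gamma> \<in> H - Q" using max_t_component[OF Q jR j(2)] by blast
  define s where "s = comp j \<gamma>"
  have "j \<in> J" unfolding Y(3) using j(1) by (rule hull_inc)
  then have "a * b * j \<in> I" using J(3) by blast
  obtain \<alpha> \<beta> where K: "a \<in> K \<alpha>" "b \<in> K \<beta>" using a b by (auto simp: H_iff hom_def)
  have "I \<subseteq> {r * (a * a) + q * (b * b) | r q. r \<in> R \<and> q \<in> R}" (is "_ \<subseteq> ?U") unfolding I_def
  proof (rule hull_minimal)
    have "1 * (a * a) + 0 * (b * b) \<in> ?U" "0 * (a * a) + 1 * (b * b) \<in> ?U"
      using subring_0[OF R_subring] subring_1[OF R_subring] by blast+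
    then show "{a * a, b * b} \<subseteq> ?U" by simp
    show "submod R ?U" unfolding submod_def
    proof (intro conjI ballI)
      have "0 * (a * a) + 0 * (b * b) \<in> ?U" using subring_0[OF R_subring] by blast
      then show "0 \<in> ?U" by simp
      fix u assume "u \<in> ?U"
      then obtain r q where u: "u = r * (a * a) + q * (b * b)" "r \<in> R" "q \<in> R" by blast
      {
        fix u' assume "u' \<in> ?U"
        then obtain r' q' where u': "u' = r' * (a * a) + q' * (b * b)" "r' \<in> R" "q' \<in> R" by blast
        have "(r + r') * (a * a) + (q + q') * (b * b) \<in> ?U" using u u' subring_add[OF R_subring] by blast
        then show "u + u' \<in> ?U" by (simp add: u u' algebra_simps)
      }
      fix t assume "t \<in> R"
      then have "(t * r) * (a * a) + (t * q) * (b * b) \<in> ?U" using u subring_mult[OF R_subring] by blast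
      then show "t * u \<in> ?U" by (simp add: u algebra_simps)
    qed
  qed
  then obtain r0 q0 where rq0: "a * b * j = r0 * (a * a) + q0 * (b * b)" "r0 \<in> R" "q0 \<in> R"
    using \<open>a * b * j \<in> I\<close> by blast
  \<comment> \<open>The equation for \<open>a * b * j\<close> is read in the degree of
    \<open>a * b * s\<close>. The shifts by twice the degrees of \<open>a\<close> and
    \<open>b\<close> select homogeneous \<open>r\<close> and \<open>q\<close>.\<close>
  define \<delta> where "\<delta> = \<gamma> + (\<alpha> + \<beta>)"
  define r where "r = comp r0 (\<delta> - (\<alpha> + \<alpha>))"
  define q where "q = comp q0 (\<delta> - (\<beta> + \<beta>))"
  have rq: "r \<in> R" "q \<in> R" "hom r" "hom q"
    using rq0(2,3) R_comp hom_comp R_whole by (simp_all add: r_def q_def)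
  have "a * b * s = comp (a * b * j) \<delta>"
    using comp_mult_hom(2)[OF K_mult[OF K] R_whole[OF jR]] by (simp add: \<delta>_def s_def)
  also have "a * b * j = (a * a) * r0 + (b * b) * q0" using rq0(1) by (simp add: mult.commute)
  also have "comp \<dots> \<delta> = (a * a) * r + (b * b) * q"
    using comp_mult_hom[OF K_mult[OF K(1) K(1)] R_whole[OF rq0(2)]]
      comp_mult_hom[OF K_mult[OF K(2) K(2)] R_whole[OF rq0(3)]]
    by (simp add: comp_add r_def q_def)
  finally have "a * b * s = a * a * r + b * b * q" .
  then have "(b * b) * (s * y) = (b * b) * (r * y * y + q)" by (simp add: a_def algebra_simps)
  then have eq: "s * y = r * y * y + q" using b(1) by (simp add: H_iff)
  have sR: "s \<in> R" "s \<notin> Q" using \<gamma> by (simp_all add: s_def H_iff)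
  \<comment> \<open>Multiplying \<open>s * y = r * y * y + q\<close> by \<open>r\<close> gives a
    monic equation for \<open>r * y\<close>.\<close>
  have "(r * y) ^ 2 = (\<Sum>k<2. (if k = 0 then - (r * q) else s) * (r * y) ^ k)"
  proof -
    have "(r * y) ^ 2 = r * (s * y - q)" unfolding eq by (simp add: power2_eq_square algebra_simps)
    then show ?thesis by (simp add: numeral_2_eq_2 algebra_simps)
  qed
  then have "integral_over R (r * y)"
    by (rule integral_overI[OF R_subring, rotated])
       (use rq sR in \<open>auto intro: subring_uminus[OF R_subring] subring_mult[OF R_subring]\<close>)
  then have ryR: "r * y \<in> R" using ic by (auto simp: integrally_closed_def)
  \<comment> \<open>Since \<open>s = r * y + f\<close> is outside \<open>Q\<close>, one summand is:
    \<open>r * y\<close> is then a denominator of the inverse of \<open>y\<close>, or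
    \<open>f\<close> is a denominator of \<open>y\<close>.\<close>
  define f where "f = s - r * y"
  have fR: "f \<in> R" unfolding f_def using sR(1) ryR by (rule subring_diff[OF R_subring])
  have fy: "f * y = q" using eq by (simp add: f_def algebra_simps)
  have "r * y \<notin> Q \<or> f \<notin> Q"
    using sR(2) submod_add[OF mt(2), of "r * y" f] by (auto simp: f_def)
  then show "y \<in> V Q \<or> inverse y \<in> V Q"
  proof
    assume n: "r * y \<notin> Q"
    then have "r * y \<noteq> 0" using mt(7) by metis
    then have "r * y \<in> H - Q" using n ryR rq y hom_mult by (simp add: H_iff)
    moreover have "r * y * inverse y \<in> R" using rq y by (simp add: mult.assoc)
    ultimately show ?thesis unfolding V_iff by blast
  next
    assume n: "f \<notin> Q"
    have "f = q * inverse y" unfolding fy[symmetric] using y by (simp add: mult.assoc)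
    then have "hom f" using rq y hom_mult hom_inverse by simp
    moreover have "f \<noteq> 0" using n mt(7) by metis
    ultimately have "f \<in> H - Q" using n fR by (simp add: H_iff)
    moreover have "f * y \<in> R" using fy rq by simp
    ultimately show ?thesis unfolding V_iff by blast
  qed
qed


text \<open>An element \<open>z\<close> inverting \<open>J\<close> over \<open>T\<close> is first
  placed in \<open>whole\<close> by a homogeneous common denominator of \<open>z J\<close>. Some
  \<open>j\<close> in \<open>J\<close> has a component outside \<open>Q\<close>, a unit of
  \<open>T\<close>; a power of it multiplies \<open>z\<close> into \<open>T\<close> and can be
  divided out.\<close>

lemma t_linked_over_V:
  assumes Q: "max_t Q" and T: "is_subring T" "graded T" "V Q \<subseteq> T"
  shows "t_linked R T"
  unfolding t_linked_iff[OF R_subring]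
proof (intro conjI allI impI subsetI)
  show "is_subring T" by fact
  have RT: "R \<subseteq> T" using R_subset_V[OF Q] T(3) by blast
  then show "x \<in> T" if "x \<in> R" for x using that by blast
  fix J z assume J: "finite J \<and> J \<subseteq> R \<and> frac_inv R J \<subseteq> R" and z: "z \<in> frac_inv T J"
  have zj: "z * j \<in> T" if "j \<in> J" for j using z that by (simp add: frac_inv_def)
  have "(*) z ` J \<subseteq> whole" using zj T(2) by (auto simp: graded_def)
  then obtain h where h: "h \<in> H" "\<forall>x\<in>(*) z ` J. h * x \<in> R"
    using H_common_denominator[of "(*) z ` J"] J by blast
  then have "h * z \<in> frac_inv R J" by (simp add: frac_inv_def mult.assoc)
  then have zW: "z \<in> whole" using J h(1) whole_iff by blast
  obtain j where j: "j \<in> J" "j \<notin> Q" using max_t_not_superset[OF Q] J by blast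
  have jR: "j \<in> R" using j J by blast
  obtain \<gamma> where \<gamma>: "comp j \<gamma> \<in> H - Q" using max_t_component[OF Q jR j(2)] by blast
  have "\<exists>n. comp j \<gamma> ^ n * z \<in> T"
  proof (rule component_power_mult[OF T(2)])
    show "comp j \<alpha> * m \<in> T" if "m \<in> T" for \<alpha> m
      using subring_mult[OF T(1) _ that] R_comp[OF jR] RT by blast
  qed (use T(1) zW jR R_whole zj[OF j(1)] in \<open>auto simp: subring_diff subring_0\<close>)
  then obtain n where n: "comp j \<gamma> ^ n * z \<in> T" by blast
  have p: "comp j \<gamma> ^ n \<in> H - Q" using max_t_H_power[OF Q \<gamma>] .
  then have "inverse (comp j \<gamma> ^ n) \<in> T" using V_inverse T(3) by blast
  then have "inverse (comp j \<gamma> ^ n) * (comp j \<gamma> ^ n * z) \<in> T" using n by (rule subring_mult[OF T(1)])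
  moreover have "inverse (comp j \<gamma> ^ n) * (comp j \<gamma> ^ n * z) = z"
    using p unfolding mult.assoc[symmetric] by (simp add: H_iff)
  ultimately show "z \<in> T" by simp
qed

text \<open>The graded form of the \<open>(u, u\<inverse>)\<close> lemma: the leading coefficient \<open>a\<^sub>m\<close> or \<open>a\<^sub>m y\<close>, which is
  integral over \<open>R\<close>, lies outside \<open>Q\<close>, or the equation can be shortened by one term.\<close>

lemma root_imp_valuation:
  assumes ic: "integrally_closed R" and Q: "max_t Q" and y: "y \<in> K \<delta>" "y \<noteq> 0"
    and "\<And>k. a k \<in> R" "\<And>k. a k \<in> K (\<sigma> - zm (int k) \<delta>)"
    and "(\<Sum>k<n. a k * y ^ k) = 0" "\<exists>k<n. a k \<notin> Q"
  shows "y \<in> V Q \<or> inverse y \<in> V Q"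
  using assms(5-)
proof (induction n arbitrary: a)
  case (Suc m)
  note mt = max_t_ideal[OF Q]
  have sum: "a m * y ^ m = - (\<Sum>k<m. a k * y ^ k)"
    using Suc.prems(3) by (simp add: eq_neg_iff_add_eq_0 add.commute)
  have m: "m \<noteq> 0"
  proof
    assume "m = 0"
    then have "a 0 = 0" using sum by simp
    then show False using Suc.prems(4) \<open>m = 0\<close> mt(7) by auto
  qed
  \<comment> \<open>Multiplying the equation by \<open>a m ^ (m - 1)\<close> makes it monic in
    \<open>b\<close>.\<close>
  define b where "b = a m * y"
  have hb: "hom b" "hom (a m)" using Suc.prems(2) y(1) unfolding b_def hom_def by (blast intro: K_mult)+
  have "b ^ m = a m ^ (m - 1) * (a m * y ^ m)"
    using m by (cases m) (simp_all add: b_def power_mult_distrib)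
  also have "\<dots> = (\<Sum>k<m. - (a k * a m ^ (m - 1 - k)) * b ^ k)"
  proof -
    have "a m ^ (m - 1) * (a k * y ^ k) = a k * a m ^ (m - 1 - k) * b ^ k" if "k < m" for k
    proof -
      have "a m ^ (m - 1) = a m ^ (m - 1 - k) * a m ^ k" using that by (simp flip: power_add)
      then show ?thesis by (simp add: b_def power_mult_distrib mult_ac)
    qed
    then have "(\<Sum>k<m. a m ^ (m - 1) * (a k * y ^ k)) = (\<Sum>k<m. a k * a m ^ (m - 1 - k) * b ^ k)"
      by (intro sum.cong) simp_all
    then show ?thesis unfolding sum by (simp add: sum_distrib_left sum_negf del: One_nat_def)
  qed
  finally have "integral_over R b"
  proof (rule integral_overI[OF R_subring, rotated])
    show "- (a k * a m ^ (m - 1 - k)) \<in> R" for k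
      by (intro subring_uminus[OF R_subring] subring_mult[OF R_subring] subring_power[OF R_subring] Suc.prems)
  qed
  then have bR: "b \<in> R" using ic by (auto simp: integrally_closed_def)
  consider "a m \<notin> Q" | "b \<notin> Q" | "a m \<in> Q" "b \<in> Q" by blast
  then show ?case
  proof cases
    case 1
    then have "a m \<in> H - Q" using Suc.prems(1) hb mt(7) by (auto simp: H_iff)
    then show ?thesis unfolding V_iff using bR b_def by blast
  next
    case 2
    then have "b \<in> H - Q" using bR hb mt(7) by (auto simp: H_iff)
    moreover have "b * inverse y \<in> R" using y(2) Suc.prems(1) by (simp add: b_def mult.assoc)
    ultimately show ?thesis unfolding V_iff by blast
  next
    case 3
    obtain l where l: "m = Suc l" using m by (cases m) auto
    \<comment> \<open>The top term is absorbed one exponent lower, since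
      \<open>a m * y ^ m = b * y ^ l\<close>. As \<open>b\<close> lies in \<open>Q\<close>, a
      coefficient \<open>a l\<close> outside \<open>Q\<close> stays outside.\<close>
    define a' where "a' = a(l := a l + b)"
    show ?thesis
    proof (rule Suc.IH)
      show "a' k \<in> R" for k using Suc.prems(1) bR subring_add[OF R_subring] by (simp add: a'_def)
      have "b \<in> K (\<sigma> - zm (int m) \<delta> + \<delta>)" unfolding b_def using Suc.prems(2) y(1) by (rule K_mult)
      moreover have "\<sigma> - zm (int m) \<delta> + \<delta> = \<sigma> - zm (int l) \<delta>" by (simp add: l zm.scale_left_distrib)
      ultimately have "b \<in> K (\<sigma> - zm (int l) \<delta>)" by simp
      then show "a' k \<in> K (\<sigma> - zm (int k) \<delta>)" for k
        using Suc.prems(2) K_add by (simp add: a'_def)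
      have "(\<Sum>k<l. a' k * y ^ k) = (\<Sum>k<l. a k * y ^ k)" by (intro sum.cong) (auto simp: a'_def)
      then show "(\<Sum>k<m. a' k * y ^ k) = 0"
        using Suc.prems(3) by (simp add: l a'_def b_def algebra_simps)
      obtain k where k: "k < Suc m" "a k \<notin> Q" using Suc.prems(4) by blast
      have "a' k \<notin> Q"
      proof (cases "k = l")
        case True
        have "- 1 * b \<in> Q"
          using 3(2) by (intro submod_mult[OF mt(2)] subring_uminus[OF R_subring] subring_1[OF R_subring])
        then show ?thesis using submod_add[OF mt(2), of "a l + b" "- 1 * b"] k(2) True by (auto simp: a'_def)
      qed (use k in \<open>simp add: a'_def\<close>)
      moreover have "k < m" using k 3(1) less_Suc_eq by blast
      ultimately show "\<exists>k<m. a' k \<notin> Q" by blast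
    qed
  qed
qed simp

text \<open>The overring \<open>T\<close> generated by y^2 over \<open>V Q\<close> has
  \<open>y\<close> as an integral element, hence contains it. Writing \<open>y\<close> as a
  polynomial in y^2 and clearing denominators gives an equation for \<open>y\<close> whose linear
  coefficient is outside \<open>Q\<close>.\<close>

lemma overrings_imp_graded_valuation:
  assumes ov: "\<forall>T. homogeneous_overring \<Gamma> G R T \<and> t_linked R T \<longrightarrow> integrally_closed T"
  shows all_graded_valuation
proof (rule all_graded_valuationI)
  fix Q y assume Q: "max_t Q" and y: "hom y" "y \<noteq> 0"
  note mt = max_t_ideal[OF Q] and VS = V_subring[OF Q]
  have ic: "integrally_closed R"
    using ov homogeneous_overringI[OF R_subring R_graded] t_linked_self by blast
  obtain \<delta> where \<delta>: "y \<in> K \<delta>" using y by (auto simp: hom_def)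
  define u where "u = y * y"
  have uK: "u ^ i \<in> K (zm (int i) (\<delta> + \<delta>))" for i unfolding u_def by (intro K_power K_mult \<delta>)
  define T where "T = {poly p u | p. coeffs_in (V Q) p}"
  have T: "is_subring T" unfolding is_subring_def
  proof (intro conjI ballI)
    have "poly (monom 1 0) u \<in> T"
      unfolding T_def using coeffs_in_monom[OF VS subring_1[OF VS]] by blast
    then show "1 \<in> T" by (simp add: poly_monom)
    fix s t assume "s \<in> T" "t \<in> T"
    then obtain p q where pq: "s = poly p u" "coeffs_in (V Q) p" "t = poly q u" "coeffs_in (V Q) q"
      by (auto simp: T_def)
    have "s - t = poly (p - q) u" "s * t = poly (p * q) u" by (simp_all add: pq)
    then show "s - t \<in> T" "s * t \<in> T"
      unfolding T_def using coeffs_in_diff[OF VS pq(2,4)] coeffs_in_mult[OF VS pq(2,4)] by blast+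
  qed
  have VT: "V Q \<subseteq> T"
  proof
    fix v assume "v \<in> V Q"
    then have "poly (monom v 0) u \<in> T" unfolding T_def using coeffs_in_monom[OF VS] by blast
    then show "v \<in> T" by (simp add: poly_monom)
  qed
  have "poly (monom 1 1) u \<in> T"
    unfolding T_def using coeffs_in_monom[OF VS subring_1[OF VS]] by blast
  then have uT: "u \<in> T" by (simp add: poly_monom)
  have VW: "v \<in> whole" "comp v \<alpha> \<in> V Q" if "v \<in> V Q" for v \<alpha>
    using V_graded that by (auto simp: graded_def)
  have poly_comp: "poly p u \<in> whole"
    "comp (poly p u) \<alpha> = (\<Sum>i\<le>degree p. u ^ i * comp (coeff p i) (\<alpha> - zm (int i) (\<delta> + \<delta>)))"
    if "coeffs_in (V Q) p" for p \<alpha>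
  proof -
    have c: "coeff p i \<in> whole" for i using that VW(1) by (auto simp: coeffs_in_def)
    have eq: "poly p u = (\<Sum>i\<le>degree p. u ^ i * coeff p i)" by (simp add: poly_altdef mult.commute)
    show "poly p u \<in> whole" unfolding eq using comp_mult_hom(1)[OF uK c] by (rule whole_sum)
    show "comp (poly p u) \<alpha> = (\<Sum>i\<le>degree p. u ^ i * comp (coeff p i) (\<alpha> - zm (int i) (\<delta> + \<delta>)))"
      unfolding eq using comp_mult_hom[OF uK c] by (simp add: comp_sum)
  qed
  have Tg: "graded T" unfolding graded_def
  proof (intro conjI ballI allI subsetI)
    fix t \<alpha> assume "t \<in> T"
    then obtain p where p: "t = poly p u" "coeffs_in (V Q) p" by (auto simp: T_def)
    show "t \<in> whole" unfolding p(1) using p(2) by (rule poly_comp)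
    have "comp (coeff p i) \<beta> \<in> T" for i \<beta> using p(2) VW(2) VT by (auto simp: coeffs_in_def)
    then show "comp t \<alpha> \<in> T" unfolding p(1) poly_comp(2)[OF p(2)]
      using uT by (intro subring_sum[OF T] subring_mult[OF T] subring_power[OF T])
  qed
  have "R \<subseteq> T" using R_subset_V[OF Q] VT by blast
  then have icT: "integrally_closed T"
    using ov homogeneous_overringI[OF T Tg] t_linked_over_V[OF Q T Tg VT] by blast
  have "integral_over T y"
    by (rule integral_overI[OF T, where m = 2 and c = "\<lambda>k. if k = 0 then u else 0"])
       (use uT subring_0[OF T] in \<open>auto simp: numeral_2_eq_2 u_def\<close>)
  then have "y \<in> T" using icT by (auto simp: integrally_closed_def)
  then obtain p where p: "y = poly p u" "coeffs_in (V Q) p" by (auto simp: T_def)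
  define n where "n = Suc (degree p)"
  \<comment> \<open>Only these components of the coefficients contribute to the degree of
    \<open>y\<close>; they make all terms of the equation homogeneous of one degree.\<close>
  define v where "v i = comp (coeff p i) (\<delta> - zm (int i) (\<delta> + \<delta>))" for i
  have cV: "coeff p i \<in> V Q" for i using p(2) by (simp add: coeffs_in_def)
  have vV: "v i \<in> V Q" and vK: "v i \<in> K (\<delta> - zm (int i) (\<delta> + \<delta>))" for i
    unfolding v_def using VW(2)[OF cV] comp_in_K[OF VW(1)[OF cV]] by auto
  have "y = comp y \<delta>" using comp_K[OF \<delta>] by simp
  also have "comp y \<delta> = (\<Sum>i<n. u ^ i * v i)"
    unfolding p(1) poly_comp(2)[OF p(2)] n_def lessThan_Suc_atMost v_def ..
  finally have y_eq: "y = (\<Sum>i<n. u ^ i * v i)" .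
  obtain s where s: "s \<in> H - Q" "\<forall>x\<in>v ` {..<n}. s * x \<in> R"
    using V_common_denominator[OF Q, of "v ` {..<n}"] vV by auto
  obtain \<sigma> where \<sigma>: "s \<in> K \<sigma>" using s(1) by (auto simp: H_iff hom_def)
  \<comment> \<open>The even exponents carry \<open>s * v i\<close>. The term \<open>- s * y\<close>
    is the only odd one, so index 1 supplies the coefficient outside \<open>Q\<close>.\<close>
  define a where "a k = (if even k then (if k div 2 < n then s * v (k div 2) else 0)
    else if k = 1 then - s else 0)" for k :: nat
  show "y \<in> V Q \<or> inverse y \<in> V Q"
  proof (rule root_imp_valuation[OF ic Q \<delta> y(2), of a "\<sigma> + \<delta>" "2 * n"])
    have sR: "s \<in> R" "s \<notin> Q" using s(1) by (simp_all add: H_iff)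
    have "s * v i \<in> R" if "i < n" for i using s(2) that by blast
    then show "a k \<in> R" for k
      using subring_0[OF R_subring] subring_uminus[OF R_subring sR(1)] by (simp add: a_def)
    show "a k \<in> K (\<sigma> + \<delta> - zm (int k) \<delta>)" for k
    proof -
      have "s * v i \<in> K (\<sigma> + \<delta> - zm (int (2 * i)) \<delta>)" for i
      proof -
        have "int (2 * i) = int i + int i" by simp
        then have "zm (int (2 * i)) \<delta> = zm (int i) (\<delta> + \<delta>)"
          by (simp only: zm.scale_left_distrib zm.scale_right_distrib)
        then show ?thesis using K_mult[OF \<sigma> vK[of i]] by (simp add: add_diff_eq)
      qed
      moreover have "- s \<in> K \<sigma>" using K_diff[OF K_zero \<sigma>] by simp
      ultimately show ?thesis by (auto simp: a_def K_zero elim!: evenE)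
    qed
    have odd: "a (2 * i + 1) * y ^ (2 * i + 1) = (if i = 0 then - (s * y) else 0)" for i
      by (simp add: a_def)
    have even: "a (2 * i) * y ^ (2 * i) = s * (u ^ i * v i)" if "i < n" for i
    proof -
      have "y ^ (2 * i) = u ^ i" by (simp only: u_def power_mult power2_eq_square)
      then show ?thesis using that by (simp add: a_def mult_ac)
    qed
    have "(\<Sum>k<2 * n. a k * y ^ k) = (\<Sum>i<n. s * (u ^ i * v i)) + (\<Sum>i<n. if i = 0 then - (s * y) else 0)"
      unfolding sum_even_odd sum.distrib odd using even by (intro arg_cong2[of _ _ _ _ "(+)"] sum.cong) auto
    also have "(\<Sum>i<n. s * (u ^ i * v i)) = s * y" unfolding sum_distrib_left[symmetric] y_eq[symmetric] ..
    also have "(\<Sum>i<n. if i = 0 then - (s * y) else 0) = - (s * y)" by (simp add: n_def)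
    finally show "(\<Sum>k<2 * n. a k * y ^ k) = 0" by simp
    have "- s \<notin> Q"
      using submod_mult[OF mt(2) subring_uminus[OF R_subring subring_1[OF R_subring]], of "- s"] sR by auto
    then show "\<exists>k<2 * n. a k \<notin> Q" by (intro exI[of _ 1]) (simp add: a_def n_def)
  qed
qed

section \<open>Elements of unit content\<close>

abbreviation N :: "'k set" where "N \<equiv> N_set \<Gamma> G R"

lemma N_iff: "f \<in> N \<longleftrightarrow> f \<in> R \<and> f \<noteq> 0 \<and> frac_inv R (range (comp f)) \<subseteq> R"
proof (cases "f \<in> R")
  case True
  have "hom_component \<Gamma> G f = comp f" by (simp add: hom_component_def comp_def fun_eq_iff)
  moreover have "range (comp f) \<subseteq> R" using R_comp[OF True] by blast
  ultimately show ?thesis using True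
    by (simp add: N_set_def content_def v_op_hull v_op_eq_ring_iff R_subring)
qed (simp add: N_set_def)

text \<open>Powers of the components of \<open>f\<close> multiply \<open>z\<close> into
  \<open>R\<close>, and the set of components has trivial inverse. So inverting \<open>N\<close>
  adds no element of \<open>whole\<close> to \<open>R\<close>.\<close>

lemma N_cancel:
  assumes f: "f \<in> N" and z: "z \<in> whole" "z * f \<in> R"
  shows "z \<in> R"
proof -
  have fR: "f \<in> R" and inv: "frac_inv R (range (comp f)) \<subseteq> R" using f by (simp_all add: N_iff)
  have "range (comp f) \<subseteq> insert 0 (comp f ` supp f)" by (auto simp: supp_def)
  then have "finite (range (comp f))"
    using finite_supp[OF R_whole[OF fR]] by (meson finite_imageI finite_insert finite_subset)
  moreover have "\<exists>n. comp f \<gamma> ^ n * z \<in> R" for \<gamma>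
    by (rule component_power_mult[OF R_graded])
       (use z fR R_whole R_comp in \<open>auto intro: subring_diff[OF R_subring] subring_0[OF R_subring]
         subring_mult[OF R_subring]\<close>)
  ultimately show ?thesis
    using R_comp[OF fR] by (intro frac_inv_powers[OF R_subring _ _ inv]) auto
qed

text \<open>An element multiplying all components of \<open>f * g\<close> into \<open>R\<close> also
  multiplies \<open>f * g\<close> into \<open>R\<close>, and two cancellations remove the factors. A
  nonzero component first places the element in \<open>whole\<close>, as cancellation
  requires.\<close>

lemma N_mult:
  assumes f: "f \<in> N" and g: "g \<in> N"
  shows "f * g \<in> N"
proof -
  have R: "f \<in> R" "g \<in> R" "f \<noteq> 0" "g \<noteq> 0" using f g by (simp_all add: N_iff)
  have fgR: "f * g \<in> R" using R(1,2) by (rule subring_mult[OF R_subring])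
  note W = R_whole[OF fgR]
  have "frac_inv R (range (comp (f * g))) \<subseteq> R"
  proof
    fix z assume z: "z \<in> frac_inv R (range (comp (f * g)))"
    then have zc: "z * comp (f * g) \<alpha> \<in> R" for \<alpha> by (auto simp: frac_inv_def)
    obtain \<alpha> where "comp (f * g) \<alpha> \<noteq> 0" using supp_eq_empty_iff[OF W] R by (auto simp: supp_def)
    then have zW: "z \<in> whole"
      using hom_mult_whole[OF hom_comp[OF W]] R_whole[OF zc[of \<alpha>]] by (simp add: mult.commute)
    have "z * (f * g) \<in> R" using zc by (intro comps_mult_mem[OF W]) (auto simp: comps_def)
    then have "z * f * g \<in> R" by (simp add: mult.assoc)
    then have "z * f \<in> R" by (rule N_cancel[OF g whole_mult[OF zW R_whole[OF R(1)]]])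
    then show "z \<in> R" by (rule N_cancel[OF f zW])
  qed
  then show ?thesis using R fgR by (simp add: N_iff)
qed

lemma N_1: "1 \<in> N"
proof -
  have "comp 1 0 = 1" using comp_K[OF K_one] by simp
  then have "frac_inv R (range (comp 1)) \<subseteq> frac_inv R {1}"
    by (intro frac_inv_antimono) (metis insert_subset empty_subsetI rangeI)
  also have "\<dots> = R" by (simp add: frac_inv_def)
  finally show ?thesis using subring_1[OF R_subring] by (simp add: N_iff)
qed

lemma N_subset: "N \<subseteq> R" and N_0: "0 \<notin> N"
  by (auto simp: N_iff)

text \<open>A witness over the localization, multiplied by a denominator from \<open>N\<close> and
  split into components, becomes a homogeneous witness over \<open>R\<close>. An element inverting
  the new products lies in \<open>whole\<close> and, up to a factor from \<open>N\<close>, in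
  \<open>R\<close>, so \<open>N_cancel\<close> applies.\<close>

lemma localization_N_imp_hom_tinv:
  assumes "PvMD (localization R N)"
  shows hom_tinv
proof (rule hom_tinvI)
  fix A assume A: "finite A" "A \<subseteq> H" "A \<noteq> {}"
  let ?L = "localization R N"
  have A0: "\<not> A \<subseteq> {0}" and Ah: "\<And>a. a \<in> A \<Longrightarrow> hom a" using A by (auto simp: H_iff)
  have L_iff: "x \<in> ?L \<longleftrightarrow> (\<exists>s\<in>N. s * x \<in> R)" for x using N_0 by (rule localization_iff)
  note L = subring_localization[OF R_subring N_1 N_0 N_subset N_mult]
  obtain B where B: "finite B" "B \<subseteq> frac_inv ?L A" "frac_inv ?L (products A B) \<subseteq> ?L"
    "\<not> products A B \<subseteq> {0}"
    using tinvE[OF L(1) tinv_fractional[OF assms A(1) A0] A0] by blast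
  have "products A B \<subseteq> ?L" using B(2) by (simp add: products_subset_iff)
  then obtain s where s: "s \<in> N" "\<forall>x\<in>products A B. s * x \<in> R"
    using common_denominator[OF N_mult N_1 R_subring N_subset finite_products[OF A(1) B(1)]] L_iff by blast
  define B' where "B' = comps ((*) s ` B)"
  have sB: "(*) s ` B \<subseteq> frac_inv R A"
  proof -
    have "s * b * a \<in> R" if "a \<in> A" "b \<in> B" for a b
    proof -
      have "s * (a * b) \<in> R" using s(2) products_memI[OF that] by blast
      then show ?thesis by (simp add: mult_ac)
    qed
    then show ?thesis by (auto simp: frac_inv_def)
  qed
  note gr = frac_inv_graded[OF Ah A0]
  have sW: "(*) s ` B \<subseteq> whole" using sB gr by (auto simp: graded_def)
  have B': "finite B'" "B' \<subseteq> frac_inv R A"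
    unfolding B'_def using finite_comps[OF _ sW] B(1) comps_subset[OF gr sB] by auto
  have "frac_inv R (products A B') \<subseteq> R"
  proof
    fix z assume "z \<in> frac_inv R (products A B')"
    then have zR: "z * a * c \<in> R" if "a \<in> A" "c \<in> B'" for a c
      using that unfolding frac_inv_products_iff by blast
    have zs: "z * a * (s * b) \<in> R" if "a \<in> A" "b \<in> B" for a b
      using zR[OF that(1)] that(2) sW by (intro comps_mult_mem[of "s * b"]) (auto simp: B'_def comps_def)
    obtain a b where ab: "a \<in> A" "b \<in> B" "a * b \<noteq> 0" using B(4) unfolding products_def by blast
    have "s \<noteq> 0" using s(1) N_0 by auto
    then have "\<not> (*) s ` B \<subseteq> {0}" using ab by auto
    then have "\<not> B' \<subseteq> {0}" unfolding B'_def by (rule comps_nonzero[OF sW])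
    then obtain c where c: "c \<in> B'" "c \<noteq> 0" by blast
    have "a * c * z \<in> R" using zR[OF ab(1) c(1)] by (simp add: mult_ac)
    moreover have "hom (a * c)" using Ah[OF ab(1)] comps_hom[OF sW] c(1) unfolding B'_def by (blast intro: hom_mult)
    ultimately have zW: "z \<in> whole" using hom_mult_whole[of "a * c" z] R_whole c(2) ab(3) by auto
    have "z * s \<in> frac_inv ?L (products A B)"
      unfolding frac_inv_products_iff using zs L(2) by (auto simp: mult_ac)
    then obtain t where t: "t \<in> N" "t * (z * s) \<in> R" using B(3) L_iff by blast
    then have "z * (t * s) \<in> R" by (simp add: mult_ac)
    then show "z \<in> R" using N_cancel[OF N_mult[OF t(1) s(1)] zW] by blast
  qed
  then show "tinv R A" unfolding tinv_def using B' by blast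
qed

end

theorem corollary9:
  fixes \<Gamma> :: "'g::ab_group_add set" and G :: "'g \<Rightarrow> 'k::field set" and R H N :: "'k set"
  assumes "graded_domain \<Gamma> G R"
    and H_def: "H = homs \<Gamma> G"
    and N_def: "N = N_set \<Gamma> G R"
  shows
    "(PvMD R \<longleftrightarrow>
        (\<forall>Q. homogeneous_max_t_ideal \<Gamma> G R Q \<longrightarrow> valuation_domain (localization R (R - Q)))) \<and>
     (PvMD R \<longleftrightarrow>
        integrally_closed R \<and>
        (\<forall>I. homogeneous_ideal \<Gamma> G R I \<and> I \<noteq> {0} \<longrightarrow> t_op R I = w_op R I)) \<and>
     (PvMD R \<longleftrightarrow>
        (\<forall>T. homogeneous_overring \<Gamma> G R T \<and> t_linked R T \<longrightarrow> integrally_closed T)) \<and>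
     (PvMD R \<longleftrightarrow>
        (\<forall>Q. homogeneous_max_t_ideal \<Gamma> G R Q \<longrightarrow>
           graded_valuation_domain
             (\<lambda>\<alpha>. localization R (H - Q) \<inter> quot_grading \<Gamma> G \<alpha>) (localization R (H - Q)))) \<and>
     (PvMD R \<longleftrightarrow> PvMD (localization R N)) \<and>
     (PvMD R \<longleftrightarrow>
        (\<forall>A. nonzero_fg_ideal R A \<and> homogeneous_ideal \<Gamma> G R A \<longrightarrow> t_invertible R A))"
proof -
  interpret graded_integral_domain \<Gamma> G R by unfold_locales (rule assms(1))
  \<comment> \<open>Conditions (2), (3) and (4) all reach (1) through (5), so this implication
    closes each of their cycles.\<close>
  have graded_valuation: "PvMD R" if all_graded_valuation
    using graded_valuation_imp_hom_tinv[OF that] by (rule PvMD_if_hom_tinv)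
  have "t_op R I = w_op R I" if "PvMD R" "homogeneous_ideal \<Gamma> G R I" "I \<noteq> {0}" for I
  proof (rule antisym)
    have I: "submod R I" using that(2) by (simp add: homogeneous_ideal_def is_ideal_def)
    show "t_op R I \<subseteq> w_op R I" using that(1) I by (rule PvMD_t_op_subset_w_op)
    show "w_op R I \<subseteq> t_op R I" using R_subring I that(3) by (rule w_op_subset_t_op)
  qed
  then have 3: "PvMD R \<longleftrightarrow> integrally_closed R \<and>
      (\<forall>I. homogeneous_ideal \<Gamma> G R I \<and> I \<noteq> {0} \<longrightarrow> t_op R I = w_op R I)"
    using PvMD_imp_integrally_closed[OF _ t_linked_self] t_eq_w_imp_graded_valuation graded_valuation
    by blast
  have 2: "PvMD R \<longleftrightarrow>
      (\<forall>Q. homogeneous_max_t_ideal \<Gamma> G R Q \<longrightarrow> valuation_domain (localization R (R - Q)))"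
    using PvMD_imp_valuation valuation_imp_graded_valuation graded_valuation by blast
  have 4: "PvMD R \<longleftrightarrow>
      (\<forall>T. homogeneous_overring \<Gamma> G R T \<and> t_linked R T \<longrightarrow> integrally_closed T)"
    using PvMD_imp_integrally_closed overrings_imp_graded_valuation graded_valuation by blast
  have 5: "PvMD R \<longleftrightarrow> all_graded_valuation"
    using 2 valuation_imp_graded_valuation graded_valuation by blast
  have 6: "PvMD R \<longleftrightarrow> PvMD (localization R N)"
    unfolding N_def using PvMD_localization[OF _ N_1 N_0 N_subset N_mult]
      localization_N_imp_hom_tinv PvMD_if_hom_tinv by blast
  have 7: "PvMD R \<longleftrightarrow>
      (\<forall>A. nonzero_fg_ideal R A \<and> homogeneous_ideal \<Gamma> G R A \<longrightarrow> t_invertible R A)"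
    using hom_tinv_if_fg_t_invertible PvMD_if_hom_tinv unfolding PvMD_def by blast
  show ?thesis
    using 2 3 4 5 6 7 unfolding all_graded_valuation_def H_def by blast
qed

end
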